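(* Let $\widetilde{\mathcal{O}}=(\widetilde S,\tilde\nu)$ and $\mathcal{O}=(S,\nu)$ be hyperbolic orbifolds such that the inclusion $\widetilde{\mathcal{O}}\hookrightarrow\mathcal{O}$ is holomorphic, and let $\rho_{\widetilde{\mathcal{O}}}$ and $\rho_{\mathcal{O}}$ be the densities of their orbifold metrics. Let $z\in\widetilde{\mathcal{O}}$ be unramified and suppose that $R:=d_{\mathcal{O}}\big(z,\mathbb{B}^{\mathcal{O}}_{\widetilde{\mathcal{O}}}\big)<\infty$. Then $$1<\frac{e^R}{\sqrt{e^{2R}-1}}\leq\frac{\rho_{\widetilde{\mathcal{O}}}(z)}{\rho_{\mathcal{O}}(z)}\leq 1+\frac{2}{e^R-1}.$$
   Context: A Riemann orbifold is a pair $\mathcal{O}=(S,\nu)$ of a Riemann surface $S$ (the underlying surface, possibly disconnected, in which case notions are understood componentwise) and a map $\nu\colon S\to\mathbb{N}_{\ge1}$ such that $\{z\in S:\nu(z)>1\}$ is discrete; points with $\nu(z)>1$ are ramified, the others unramified. "$z\in\mathcal{O}$" means $z\in S$. A holomorphic map $f\colon\widetilde S\to S$ is a branched covering map if every $z\in S$ has a connected neighbourhood $U$ such that $f$ maps any component of $f^{-1}(U)$ onto $U$ as a proper map. An orbifold covering map $f\colon(\widetilde S,\tilde\nu)\to(S,\nu)$ is a holomorphic branched covering map $f\colon\widetilde S\to S$ with $\nu(f(z))=\deg(f,z)\,\tilde\nu(z)$ for all $z\in\widetilde S$, where $\deg(f,z)$ is the local degree. The inclusion $\widetilde{\mathcal{O}}\hookrightarrow\mathcal{O}$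 is holomorphic if $\widetilde S\subseteq S$ and $\nu(z)$ divides $\tilde\nu(z)$ for all $z\in\widetilde S$. An orbifold is hyperbolic if each of its components admits an orbifold covering map $\pi$ from the unit disc $\mathbb{D}$ (with ramification map $\equiv1$). Its orbifold metric $\rho_{\mathcal{O}}(w)|dw|$ is the pushforward of the hyperbolic metric, determined by $\rho_{\mathbb{D}}(x)=|\pi'(x)|\,\rho_{\mathcal{O}}(\pi(x))$ with $\rho_{\mathbb{D}}(x)=2/(1-|x|^2)$; it is finite at unramified points and has integrable singularities at ramified points. $d_{\mathcal{O}}(x,y)$ is the infimum of the lengths $\int_\gamma\rho_{\mathcal{O}}(w)|dw|$ over rectifiable curves $\gamma\subset S$ joining $x$ and $y$, and $d_{\mathcal{O}}(A,B)=\inf\{d_{\mathcal{O}}(x,y):x\in A,y\in B\}$ for $A,B\subset S$ (infimum of the empty set is $\infty$). The boundary of $\widetilde{\mathcal{O}}$ in $\mathcal{O}$ is $\mathbb{B}^{\mathcal{O}}_{\widetilde{\mathcal{O}}}:=\partial\widetilde S\cup\{z\in\widetilde S:\tilde\nu(z)>\nu(z)\}$, where $\partial\widetilde S$ consists of the boundary points of $\widetilde S$ that lie in $S$. *)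

theory Defs
  imports "HOL-Complex_Analysis.Complex_Analysis"
begin

section \<open>Riemann surfaces and holomorphic maps\<close>

text \<open>
  A surface is a topology together with an atlas of pairs \<open>(U, \<phi>)\<close> of a domain and a coordinate.
  The atlas need not be maximal; the values of \<open>\<phi>\<close> outside \<open>U\<close> are irrelevant.
\<close>

record 'a surface =
  topol :: "'a topology"
  charts :: "('a set \<times> ('a \<Rightarrow> complex)) set"

abbreviation points :: "('a, 'm) surface_scheme \<Rightarrow> 'a set" where
  "points X \<equiv> topspace (topol X)"

text \<open>
  Surfaces may be disconnected. Second countability is not required: by Rado's theorem it is
  automatic for each component.
\<close>

definition riemann_surface :: "('a, 'm) surface_scheme \<Rightarrow> bool" where
  "riemann_surface X \<longleftrightarrow>
     Hausdorff_space (topol X) \<and>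
     (\<Union>(U, \<phi>)\<in>charts X. U) = points X \<and>
     (\<forall>(U, \<phi>)\<in>charts X.
        openin (topol X) U \<and> open (\<phi> ` U) \<and>
        homeomorphic_map (subtopology (topol X) U) (top_of_set (\<phi> ` U)) \<phi>) \<and>
     (\<forall>(U, \<phi>)\<in>charts X. \<forall>(V, \<psi>)\<in>charts X.
        (\<lambda>w. \<psi> (inv_into U \<phi> w)) holomorphic_on \<phi> ` (U \<inter> V))"

definition surface_restrict :: "('a, 'm) surface_scheme \<Rightarrow> 'a set \<Rightarrow> ('a, 'm) surface_scheme" where
  "surface_restrict X C =
     X\<lparr>topol := subtopology (topol X) C, charts := (\<lambda>(U, \<phi>). (U \<inter> C, \<phi>)) ` charts X\<rparr>"

definition holomorphic_map ::
  "('a, 'm) surface_scheme \<Rightarrow> ('b, 'n) surface_scheme \<Rightarrow> ('a \<Rightarrow> 'b) \<Rightarrow> bool" where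
  "holomorphic_map X Y f \<longleftrightarrow>
     continuous_map (topol X) (topol Y) f \<and>
     (\<forall>(U, \<phi>)\<in>charts X. \<forall>(V, \<psi>)\<in>charts Y.
        (\<lambda>w. \<psi> (f (inv_into U \<phi> w))) holomorphic_on \<phi> ` {x \<in> U. f x \<in> V})"

text \<open>
  The local degree is the order of the zero of \<open>f - f x\<close> at \<open>x\<close> in local coordinates. It does not
  depend on the coordinates, and is meaningful when \<open>f\<close> is not constant near \<open>x\<close>, which holds for
  branched covering maps.
\<close>

definition local_degree ::
  "('a, 'm) surface_scheme \<Rightarrow> ('b, 'n) surface_scheme \<Rightarrow> ('a \<Rightarrow> 'b) \<Rightarrow> 'a \<Rightarrow> nat" where
  "local_degree X Y f x = (THE n. \<exists>U \<phi> V \<psi>.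
     (U, \<phi>) \<in> charts X \<and> x \<in> U \<and> (V, \<psi>) \<in> charts Y \<and> f x \<in> V \<and>
     int n = zorder (\<lambda>w. \<psi> (f (inv_into U \<phi> w)) - \<psi> (f x)) (\<phi> x))"

text \<open>Neighbourhoods are taken to be open.\<close>

definition branched_covering_map ::
  "('a, 'm) surface_scheme \<Rightarrow> ('b, 'n) surface_scheme \<Rightarrow> ('a \<Rightarrow> 'b) \<Rightarrow> bool" where
  "branched_covering_map X Y f \<longleftrightarrow>
     holomorphic_map X Y f \<and>
     (\<forall>z\<in>points Y. \<exists>U. openin (topol Y) U \<and> z \<in> U \<and> connectedin (topol Y) U \<and>
        (\<forall>C\<in>connected_components_of (subtopology (topol X) {x \<in> points X. f x \<in> U}).
           f ` C = U \<and> proper_map (subtopology (topol X) C) (subtopology (topol Y) U) f))"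


section \<open>Riemann orbifolds\<close>

record 'a orbifold = "'a surface" +
  ramif :: "'a \<Rightarrow> nat"

text \<open>
  Discreteness means that the subspace topology is discrete. For hyperbolic orbifolds the set of
  ramified points is then automatically closed as well.
\<close>

definition riemann_orbifold :: "'a orbifold \<Rightarrow> bool" where
  "riemann_orbifold X \<longleftrightarrow>
     riemann_surface X \<and>
     (\<forall>z\<in>points X. 1 \<le> ramif X z) \<and>
     (let A = {z \<in> points X. 1 < ramif X z} in subtopology (topol X) A = discrete_topology A)"

definition orbifold_covering_map :: "'a orbifold \<Rightarrow> 'b orbifold \<Rightarrow> ('a \<Rightarrow> 'b) \<Rightarrow> bool" where
  "orbifold_covering_map X Y f \<longleftrightarrow>
     branched_covering_map X Y f \<and>
     (\<forall>z\<in>points X. ramif Y (f z) = local_degree X Y f z * ramif X z)"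

definition holomorphic_inclusion :: "'a orbifold \<Rightarrow> 'a orbifold \<Rightarrow> bool" where
  "holomorphic_inclusion X Y \<longleftrightarrow>
     points X \<subseteq> points Y \<and>
     holomorphic_map X Y (\<lambda>z. z) \<and>
     (\<forall>z\<in>points X. ramif Y z dvd ramif X z)"

definition unit_disc :: "complex orbifold" where
  "unit_disc =
     \<lparr>topol = top_of_set (ball 0 1), charts = {(ball 0 1, \<lambda>z. z)}, ramif = (\<lambda>_. 1)\<rparr>"

definition hyperbolic_orbifold :: "'a orbifold \<Rightarrow> bool" where
  "hyperbolic_orbifold X \<longleftrightarrow>
     riemann_orbifold X \<and>
     (\<forall>C\<in>connected_components_of (topol X).
        \<exists>\<pi>. orbifold_covering_map unit_disc (surface_restrict X C) \<pi>)"

text \<open>The boundary of \<open>X\<close> in \<open>Y\<close>.\<close>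

definition orbifold_boundary :: "'a orbifold \<Rightarrow> 'a orbifold \<Rightarrow> 'a set" where
  "orbifold_boundary X Y =
     (topol Y) frontier_of (points X) \<union> {z \<in> points X. ramif Y z < ramif X z}"


section \<open>The orbifold metric\<close>

definition disc_density :: "complex \<Rightarrow> real" where
  "disc_density x = 2 / (1 - (cmod x)\<^sup>2)"

text \<open>
  A density \<open>\<rho>(w)|dw|\<close> on a surface has a value at \<open>w\<close> only relative to a local coordinate \<open>\<phi>\<close>
  near \<open>w\<close>. In this coordinate the pushforward relation
  \<open>\<rho>\<^sub>D(x) = |\<pi>'(x)| \<rho>(\<pi>(x))\<close> uses the derivative of \<open>\<phi> \<circ> \<pi>\<close>. The division takes place in the
  extended nonnegative reals, so that the density is infinite at ramified points, where
  this derivative vanishes.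
\<close>

definition orbifold_density :: "'a orbifold \<Rightarrow> ('a \<Rightarrow> complex) \<Rightarrow> 'a \<Rightarrow> ennreal" where
  "orbifold_density X \<phi> w = (THE r. \<exists>C\<in>connected_components_of (topol X). \<exists>\<pi> x.
     orbifold_covering_map unit_disc (surface_restrict X C) \<pi> \<and> x \<in> ball 0 1 \<and> \<pi> x = w \<and>
     r = ennreal (disc_density x) / ennreal (cmod (deriv (\<lambda>y. \<phi> (\<pi> y)) x)))"

text \<open>
  The total variation (arc length) of \<open>g\<close> on \<open>[a, b]\<close>; for \<open>b < a\<close> it is \<open>0\<close>.
\<close>

definition path_variation :: "(real \<Rightarrow> complex) \<Rightarrow> real \<Rightarrow> real \<Rightarrow> ennreal" where
  "path_variation g a b =
     (SUP ts\<in>{ts. sorted ts \<and> set ts \<subseteq> {a..b}}.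
        \<Sum>i<length ts - 1. ennreal (dist (g (ts ! i)) (g (ts ! Suc i))))"

text \<open>
  The integral of \<open>h\<close> with respect to the arc length of a continuous rectifiable \<open>g\<close> on \<open>[a, b]\<close>,
  as the Stieltjes integral for the function assigning to \<open>t\<close> the length of \<open>g\<close> on \<open>[a, t]\<close>
  (extended by constants outside \<open>[a, b]\<close>).
\<close>

definition arc_length_integral ::
  "(real \<Rightarrow> complex) \<Rightarrow> real \<Rightarrow> real \<Rightarrow> (real \<Rightarrow> ennreal) \<Rightarrow> ennreal" where
  "arc_length_integral g a b h =
     (\<integral>\<^sup>+t\<in>{a..b}. h t \<partial>interval_measure (\<lambda>t. enn2real (path_variation g a (min t b))))"

text \<open>
  The curve \<open>\<gamma>\<close> on \<open>[0, 1]\<close> is rectifiable and \<open>l\<close> is its length in the orbifold metric. Arc length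
  only makes sense in a coordinate, so \<open>[0, 1]\<close> is subdivided into finitely many intervals,
  each mapped into the domain of one chart and rectifiable in that chart. The value \<open>l\<close> does not
  depend on the subdivision and the charts.
\<close>

definition rectifiable_with_length :: "'a orbifold \<Rightarrow> (real \<Rightarrow> 'a) \<Rightarrow> ennreal \<Rightarrow> bool" where
  "rectifiable_with_length X \<gamma> l \<longleftrightarrow>
     pathin (topol X) \<gamma> \<and>
     (\<exists>n t U \<phi>. t 0 = 0 \<and> t n = 1 \<and>
        (\<forall>i<n. t i \<le> t (Suc i) \<and> (U i, \<phi> i) \<in> charts X \<and> \<gamma> ` {t i..t (Suc i)} \<subseteq> U i \<and>
           path_variation (\<phi> i \<circ> \<gamma>) (t i) (t (Suc i)) < \<infinity>) \<and>
        l = (\<Sum>i<n. arc_length_integral (\<phi> i \<circ> \<gamma>) (t i) (t (Suc i))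
                      (\<lambda>s. orbifold_density X (\<phi> i) (\<gamma> s))))"

definition orbifold_dist :: "'a orbifold \<Rightarrow> 'a \<Rightarrow> 'a \<Rightarrow> ennreal" where
  "orbifold_dist X x y = Inf {l. \<exists>\<gamma>. \<gamma> 0 = x \<and> \<gamma> 1 = y \<and> rectifiable_with_length X \<gamma> l}"

definition orbifold_setdist :: "'a orbifold \<Rightarrow> 'a set \<Rightarrow> 'a set \<Rightarrow> ennreal" where
  "orbifold_setdist X A B = (INF x\<in>A. INF y\<in>B. orbifold_dist X x y)"

end

theory Submission
  imports Defs
begin

text \<open>
  Let \<open>\<pi>'\<close> and \<open>\<pi>\<close> be coverings of the components of \<open>X'\<close> and \<open>X\<close> containing \<open>z\<close> by the disc,
  with \<open>\<pi>' 0 = \<pi> 0 = z\<close>. The distance \<open>R\<close> is the hyperbolic distance from \<open>0\<close> to the preimage under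
  \<open>\<pi>\<close> of the boundary. Hence \<open>\<pi>\<close> maps the hyperbolic disc of radius \<open>R\<close> about \<open>0\<close> into \<open>X'\<close> without
  meeting additional ramification, so its restriction lifts through \<open>\<pi>'\<close>, and the Schwarz lemma
  for the lift gives the upper bound. Conversely \<open>\<pi>'\<close> lifts through \<open>\<pi>\<close> to a self-map \<open>h\<close> of the
  disc fixing \<open>0\<close>, which over a boundary point \<open>\<pi> y\<close> either omits \<open>y\<close> or is ramified there to a constant
  order \<open>m \<ge> 2\<close>. After moving \<open>y\<close> to \<open>0\<close>, \<open>h\<close> is therefore the \<open>m\<close>-th power of another self-map of the
  disc, and the Schwarz-Pick lemma for that map gives the lower bound. Since the ratio of the
  densities is finite, the lower bound also shows \<open>R > 0\<close>.

  Lifts are constructed without covering space theory: they exist locally by normal forms, and are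
  continued from a disc to a larger concentric one by gluing the extensions at its boundary points.
  Curves are never lifted; instead, the distance of the fibre over \<open>\<gamma> t\<close> to \<open>0\<close> is shown to grow at
  most as fast as the length of \<open>\<gamma>\<close>, which needs to be verified only where \<open>\<gamma> t\<close> is unramified.
\<close>


section \<open>Arc length\<close>

text \<open>The constants: the hyperbolic disc of radius R about 0 is the Euclidean disc of radius s
  = tanh (R/2), and 1/s = 1 + 2/(e^R - 1) is the upper bound. A boundary fibre point at hyperbolic
  distance r has modulus k = tanh (r/2); the root argument gives |h'(0)| \<le> 2 sqrt k / (1 + k) =
  sqrt (1 - e^(-2r)), where m = 2 is the worst exponent, and the reciprocal is the lower bound. The
  coordinate: a density is a number only in a chart, so both coverings are expressed in the charts
  of \<open>X\<close>, through the predicate \<open>disc_cover\<close>. The length: the infimum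
  defining R runs over arbitrary rectifiable curves. They may pass through ramified points, where
  the density is infinite and lifts branch, and measurability of the density along them is never
  established. Lengths are therefore bounded below using only superadditivity of the integral and
  the fact that, near an unramified point, the density is constant up to a factor \<eta> > 1, which
  finally tends to 1. Lengths are bounded above only for images of radial segments, which are
  continuously differentiable in every chart.\<close>

fun list_variation :: "(real \<Rightarrow> complex) \<Rightarrow> real list \<Rightarrow> ennreal" where
  "list_variation g [] = 0"
| "list_variation g [x] = 0"
| "list_variation g (x # y # ts) = ennreal (dist (g x) (g y)) + list_variation g (y # ts)"

lemma list_variation_eq_sum:
  "list_variation g ts = (\<Sum>i<length ts - 1. ennreal (dist (g (ts ! i)) (g (ts ! Suc i))))"
proof (induction g ts rule: list_variation.induct)
  case (3 g x y ts)
  show ?case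
    using 3 by (simp add: sum.lessThan_Suc_shift del: sum.lessThan_Suc)
qed auto

lemma path_variation_eq_SUP:
  "path_variation g a b = (SUP ts\<in>{ts. sorted ts \<and> set ts \<subseteq> {a..b}}. list_variation g ts)"
  by (simp add: path_variation_def list_variation_eq_sum)

lemma list_variation_le_path_variation:
  "sorted ts \<Longrightarrow> set ts \<subseteq> {a..b} \<Longrightarrow> list_variation g ts \<le> path_variation g a b"
  unfolding path_variation_eq_SUP by (rule SUP_upper) auto

lemma path_variation_leI:
  "(\<And>ts. sorted ts \<Longrightarrow> set ts \<subseteq> {a..b} \<Longrightarrow> list_variation g ts \<le> B) \<Longrightarrow> path_variation g a b \<le> B"
  unfolding path_variation_eq_SUP by (rule SUP_least) auto

lemma path_variation_mono:
  "a \<le> a' \<Longrightarrow> b' \<le> b \<Longrightarrow> path_variation g a' b' \<le> path_variation g a b"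
  by (rule path_variation_leI, rule list_variation_le_path_variation) auto

lemma dist_le_path_variation:
  "a \<le> b \<Longrightarrow> ennreal (dist (g a) (g b)) \<le> path_variation g a b"
  using list_variation_le_path_variation[of "[a, b]" a b g] by simp

lemma list_variation_const:
  "(\<And>x. x \<in> set ts \<Longrightarrow> g x = c) \<Longrightarrow> list_variation g ts = 0"
  by (induction g ts rule: list_variation.induct) auto

lemma path_variation_empty: "b \<le> a \<Longrightarrow> path_variation g a b = 0"
proof -
  assume "b \<le> a"
  have "path_variation g a b \<le> 0"
  proof (rule path_variation_leI)
    fix ts assume "set ts \<subseteq> {a..b}"
    then have "x = a" if "x \<in> set ts" for x using that \<open>b \<le> a\<close> by fastforce
    then show "list_variation g ts \<le> 0" by (simp add: list_variation_const[of ts g "g a"])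
  qed
  then show ?thesis by simp
qed

lemma list_variation_append_ge:
  "list_variation g xs + list_variation g ys \<le> list_variation g (xs @ ys)"
proof (induction g xs rule: list_variation.induct)
  case (2 g x) then show ?case by (cases ys) auto
next
  case (3 g x y ts) then show ?case by (simp add: add.assoc add_left_mono)
qed auto

lemma list_variation_Cons_le:
  "list_variation g (x # ys) \<le> ennreal (dist (g x) (g c)) + list_variation g (c # ys)"
proof (cases ys)
  case (Cons y zs)
  have "ennreal (dist (g x) (g y)) \<le> ennreal (dist (g x) (g c)) + ennreal (dist (g c) (g y))"
    by (simp add: dist_triangle flip: ennreal_plus)
  then show ?thesis using Cons by (simp add: add_right_mono flip: add.assoc)
qed auto

text \<open>Inserting \<open>c\<close> at the junction cannot decrease the sum, by the triangle
  inequality. This is how a partition is cut at a point that it may not contain.\<close>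

lemma list_variation_append_le:
  "list_variation g (xs @ ys) \<le> list_variation g (xs @ [c]) + list_variation g (c # ys)"
proof (induction g xs rule: list_variation.induct)
  case (1 g) then show ?case by (cases ys) auto
next
  case (2 g x) then show ?case by (simp add: list_variation_Cons_le)
next
  case (3 g x y ts) then show ?case by (simp add: add.assoc add_left_mono)
qed

lemma sorted_filter_append:
  fixes ts :: "real list"
  shows "sorted ts \<Longrightarrow> filter (\<lambda>t. t \<le> c) ts @ filter (\<lambda>t. c < t) ts = ts"
proof (induction ts)
  case (Cons x ts)
  show ?case
  proof (cases "x \<le> c")
    case False
    then have "filter (\<lambda>t. t \<le> c) ts = []" "filter (\<lambda>t. c < t) ts = ts"
      using Cons.prems by (auto simp: filter_empty_conv intro!: filter_True)
    then show ?thesis using False by simp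
  qed (use Cons in auto)
qed simp

text \<open>For \<open>\<le>\<close>, every partition is cut at \<open>c\<close>; for
  \<open>\<ge>\<close>, partitions of the two halves are concatenated, the joining term being
  nonnegative.\<close>

lemma path_variation_add:
  assumes "a \<le> c" "c \<le> b"
  shows "path_variation g a b = path_variation g a c + path_variation g c b"
proof (rule antisym)
  show "path_variation g a b \<le> path_variation g a c + path_variation g c b"
  proof (rule path_variation_leI)
    fix ts assume ts: "sorted ts" "set ts \<subseteq> {a..b}"
    let ?xs = "filter (\<lambda>t. t \<le> c) ts" and ?ys = "filter (\<lambda>t. c < t) ts"
    have "list_variation g ts = list_variation g (?xs @ ?ys)"
      by (simp add: sorted_filter_append[OF ts(1)])
    also have "\<dots> \<le> list_variation g (?xs @ [c]) + list_variation g (c # ?ys)"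
      by (rule list_variation_append_le)
    also have "\<dots> \<le> path_variation g a c + path_variation g c b"
      using ts assms
      by (intro add_mono list_variation_le_path_variation)
         (auto simp: sorted_append sorted_wrt_filter)
    finally show "list_variation g ts \<le> path_variation g a c + path_variation g c b" .
  qed
next
  have 1: "list_variation g xs + path_variation g c b \<le> path_variation g a b"
    if xs: "sorted xs" "set xs \<subseteq> {a..c}" for xs
  proof -
    have "list_variation g xs + path_variation g c b =
      (SUP ys\<in>{ys. sorted ys \<and> set ys \<subseteq> {c..b}}. list_variation g xs + list_variation g ys)"
      unfolding path_variation_eq_SUP by (subst ennreal_SUP_add_right) (auto intro: exI[of _ "[]"])
    also have "\<dots> \<le> path_variation g a b"
    proof (rule SUP_least)
      fix ys assume ys: "ys \<in> {ys. sorted ys \<and> set ys \<subseteq> {c..b}}"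
      have "list_variation g xs + list_variation g ys \<le> list_variation g (xs @ ys)"
        by (rule list_variation_append_ge)
      also have "\<dots> \<le> path_variation g a b"
        using xs ys assms
        by (intro list_variation_le_path_variation) (fastforce simp: sorted_append)+
      finally show "list_variation g xs + list_variation g ys \<le> path_variation g a b" .
    qed
    finally show ?thesis .
  qed
  have "path_variation g a c + path_variation g c b =
      (SUP xs\<in>{xs. sorted xs \<and> set xs \<subseteq> {a..c}}. path_variation g c b + list_variation g xs)"
    unfolding path_variation_eq_SUP[of g a c]
    by (subst add.commute, subst ennreal_SUP_add_right) (auto intro: exI[of _ "[]"])
  also have "\<dots> \<le> path_variation g a b"
    by (rule SUP_least) (use 1 in \<open>auto simp: add.commute\<close>)
  finally show "path_variation g a c + path_variation g c b \<le> path_variation g a b" .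
qed

text \<open>Take a partition whose sum is within \<open>e/2\<close> of the total variation and move
  its part at \<open>c\<close> to a nearby \<open>d\<close>, which costs at most \<open>e/2\<close>
  by continuity. The variation on \<open>{d..b}\<close> is then within \<open>e\<close> of the
  total, and additivity leaves less than \<open>e\<close> for \<open>{c..d}\<close>.\<close>

lemma path_variation_right_small:
  assumes "c < b" "path_variation g c b < \<infinity>" "continuous_on {c..b} g" "0 < e"
  shows "\<exists>d. c < d \<and> d \<le> b \<and> path_variation g c d < ennreal e"
proof -
  have "\<exists>ts. sorted ts \<and> set ts \<subseteq> {c..b} \<and> path_variation g c b < list_variation g ts + ennreal (e/2)"
  proof (rule ccontr)
    assume "\<not> ?thesis"
    then have *: "list_variation g ts + ennreal (e/2) \<le> path_variation g c b"
      if "sorted ts" "set ts \<subseteq> {c..b}" for ts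
      using that by (meson not_le)
    have "path_variation g c b + ennreal (e/2) =
      (SUP ts\<in>{ts. sorted ts \<and> set ts \<subseteq> {c..b}}. ennreal (e/2) + list_variation g ts)"
      unfolding path_variation_eq_SUP
      by (subst add.commute, subst ennreal_SUP_add_right) (auto intro: exI[of _ "[]"])
    also have "\<dots> \<le> path_variation g c b"
      by (rule SUP_least) (use * in \<open>auto simp: add.commute\<close>)
    finally have "path_variation g c b + ennreal (e/2) \<le> path_variation g c b" .
    then have "enn2real (path_variation g c b + ennreal (e/2)) \<le> enn2real (path_variation g c b)"
      using assms(2) by (intro enn2real_mono) auto
    moreover have "enn2real (path_variation g c b + ennreal (e/2)) = enn2real (path_variation g c b) + e/2"
      using assms by (subst enn2real_plus) auto
    ultimately show False
      using assms(4) by simp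
  qed
  then obtain ts where ts: "sorted ts" "set ts \<subseteq> {c..b}"
    "path_variation g c b < list_variation g ts + ennreal (e/2)" by blast
  obtain d1 where d1: "d1 > 0" "\<And>t. t \<in> {c..b} \<Longrightarrow> dist t c < d1 \<Longrightarrow> dist (g t) (g c) < e/2"
    using assms(1,4) assms(3)[unfolded continuous_on_iff, THEN bspec, of c, rule_format, of "e/2"] by auto
  define us where "us = filter (\<lambda>t. c < t) ts"
  define xs where "xs = filter (\<lambda>t. t \<le> c) ts"
  \<comment> \<open>\<open>d\<close> precedes every partition point to the right of
    \<open>c\<close>, so \<open>d # us\<close> is a partition of \<open>{d..b}\<close>; being closer
    to \<open>c\<close> than \<open>d1\<close>, it changes \<open>g\<close> by less than
    \<open>e/2\<close>.\<close>
  define d where "d = Min (insert b (insert (c + d1/2) (set us)))"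
  have d: "c < d" "d \<le> b" "d \<le> c + d1/2" "\<And>u. u \<in> set us \<Longrightarrow> d \<le> u"
  proof -
    have fin: "finite (insert b (insert (c + d1/2) (set us)))" by simp
    show "c < d" using assms d1 unfolding d_def by (subst Min_gr_iff) (auto simp: us_def)
    show "d \<le> b" "d \<le> c + d1/2" "\<And>u. u \<in> set us \<Longrightarrow> d \<le> u"
      unfolding d_def by (rule Min_le[OF fin]; simp)+
  qed
  have "list_variation g ts = list_variation g (xs @ us)"
    by (simp add: xs_def us_def sorted_filter_append[OF ts(1)])
  also have "\<dots> \<le> list_variation g (xs @ [c]) + list_variation g (c # us)"
    by (rule list_variation_append_le)
  also have "list_variation g (xs @ [c]) = 0"
    by (rule list_variation_const[of _ _ "g c"]) (use ts in \<open>force simp: xs_def\<close>)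
  also have "list_variation g (c # us) \<le> ennreal (dist (g c) (g d)) + list_variation g (d # us)"
    by (rule list_variation_Cons_le)
  also have "dist (g c) (g d) < e/2"
    using d1(2)[of d] d d1(1) by (auto simp: dist_commute dist_real_def)
  then have "ennreal (dist (g c) (g d)) \<le> ennreal (e/2)" by (simp add: ennreal_leI)
  also have "list_variation g (d # us) \<le> path_variation g d b"
    using d ts by (intro list_variation_le_path_variation) (auto simp: us_def sorted_wrt_filter)
  finally have le: "list_variation g ts \<le> ennreal (e/2) + path_variation g d b"
    by (simp add: add_right_mono)
  have fin: "path_variation g d b < \<infinity>"
    by (rule le_less_trans[OF path_variation_mono assms(2)]) (use d in auto)
  have "path_variation g c d + path_variation g d b = path_variation g c b"
    using d by (simp add: path_variation_add[of c d b])
  also have "\<dots> < list_variation g ts + ennreal (e/2)" by fact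
  also have "\<dots> \<le> ennreal (e/2) + path_variation g d b + ennreal (e/2)"
    by (intro add_right_mono le)
  also have "\<dots> = ennreal e + path_variation g d b"
  proof -
    have "ennreal (e/2) + P + ennreal (e/2) = (ennreal (e/2) + ennreal (e/2)) + P" for P :: ennreal
      by (simp only: ac_simps)
    moreover have "ennreal (e/2) + ennreal (e/2) = ennreal e"
      using assms(4) by (simp flip: ennreal_plus)
    ultimately show ?thesis by simp
  qed
  finally have "path_variation g c d + path_variation g d b < ennreal e + path_variation g d b" .
  then have "path_variation g c d < ennreal e"
    by (rule contrapos_pp) (simp add: not_less add_right_mono)
  with d show ?thesis by blast
qed

section \<open>The Stieltjes measure of arc length\<close>

definition variation_function :: "(real \<Rightarrow> complex) \<Rightarrow> real \<Rightarrow> real \<Rightarrow> real \<Rightarrow> real" where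
  "variation_function g a b t = enn2real (path_variation g a (min t b))"

lemma variation_function_fin:
  "path_variation g a b < \<infinity> \<Longrightarrow> path_variation g a (min t b) < \<infinity>"
  by (rule le_less_trans[OF path_variation_mono]) auto

lemma ennreal_variation_function:
  "path_variation g a b < \<infinity> \<Longrightarrow> ennreal (variation_function g a b t) = path_variation g a (min t b)"
  using variation_function_fin[of g a b t] by (simp add: variation_function_def)

lemma variation_function_mono:
  assumes "path_variation g a b < \<infinity>" "s \<le> t"
  shows "variation_function g a b s \<le> variation_function g a b t"
  unfolding variation_function_def
  by (rule enn2real_mono[OF path_variation_mono])
     (use assms variation_function_fin[OF assms(1)] in auto)

lemma variation_function_diff:
  assumes "path_variation g a b < \<infinity>" "a \<le> s" "s \<le> t" "t \<le> b"
  shows "ennreal (variation_function g a b t - variation_function g a b s) = path_variation g s t"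
proof -
  have "ennreal (variation_function g a b t - variation_function g a b s)
      = ennreal (variation_function g a b t) - ennreal (variation_function g a b s)"
    by (rule ennreal_minus[symmetric]) (simp add: variation_function_def)
  also have "\<dots> = path_variation g a t - path_variation g a s"
    using assms by (simp add: ennreal_variation_function min_absorb1)
  also have "\<dots> = path_variation g a s + path_variation g s t - path_variation g a s"
    using assms by (simp add: path_variation_add[of a s t])
  also have "\<dots> = path_variation g s t"
    using variation_function_fin[OF assms(1), of s] assms
    by (intro ennreal_add_diff_cancel_left) (simp add: min_absorb1 less_top)
  finally show ?thesis .
qed

text \<open>\<open>interval_measure\<close> gives half-open intervals the increments of its
  integrator if the integrator is monotone and right continuous. To the right of \<open>c\<close> it
  is locally constant unless \<open>a \<le> c < b\<close>, and there its increments are controlled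
  by \<open>path_variation_right_small\<close>.\<close>

lemma variation_function_right_cont:
  assumes fin: "path_variation g a b < \<infinity>" and g: "continuous_on {a..b} g"
  shows "continuous (at_right c) (variation_function g a b)"
proof -
  let ?F = "variation_function g a b"
  have "\<exists>d>c. \<forall>t. c < t \<and> t < d \<longrightarrow> dist (?F t) (?F c) < e" if "e > 0" for e
  proof (cases "b \<le> c \<or> b \<le> a")
    case True
    then show ?thesis
      using \<open>e > 0\<close>
      by (intro exI[of _ "c+1"]) (auto simp: variation_function_def min_def path_variation_empty)
  next
    case False
    show ?thesis
    proof (cases "c < a")
      case True
      then show ?thesis
        using \<open>e > 0\<close> by (intro exI[of _ a]) (auto simp: variation_function_def path_variation_empty)
    next
      case ca: False
      have fin': "path_variation g c b < \<infinity>"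
        using path_variation_mono[of a c b b g] fin ca by (auto intro: le_less_trans)
      have "continuous_on {c..b} g" using g ca by (auto intro: continuous_on_subset)
      then obtain d where d: "c < d" "d \<le> b" "path_variation g c d < ennreal e"
        using path_variation_right_small[of c b g e] False fin' \<open>e > 0\<close> by auto
      have "dist (?F t) (?F c) < e" if "c < t" "t < d" for t
      proof -
        have "ennreal (?F t - ?F c) = path_variation g c t"
          using that d ca by (intro variation_function_diff fin) auto
        also have "\<dots> \<le> path_variation g c d" using that by (intro path_variation_mono) auto
        also have "\<dots> < ennreal e" by fact
        finally have "?F t - ?F c < e" using ennreal_leI[of e "?F t - ?F c"] by (auto simp flip: not_le)
        then show ?thesis using variation_function_mono[OF fin, of c t] that by (auto simp: dist_real_def)
      qed
      then show ?thesis using d by blast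
    qed
  qed
  then show ?thesis
    unfolding continuous_within tendsto_iff eventually_at_right_field by blast
qed

lemma arc_length_integral_eq:
  "arc_length_integral g a b h =
     (\<integral>\<^sup>+t\<in>{a..b}. h t \<partial>interval_measure (variation_function g a b))"
  by (simp add: arc_length_integral_def variation_function_def[abs_def])

lemma emeasure_variation_Ioc:
  assumes "path_variation g a b < \<infinity>" "continuous_on {a..b} g" "a \<le> s" "s \<le> t" "t \<le> b"
  shows "emeasure (interval_measure (variation_function g a b)) {s<..t} = path_variation g s t"
  using assms
  by (simp add: emeasure_interval_measure_Ioc variation_function_mono variation_function_right_cont
      variation_function_diff)

text \<open>The integral is a supremum over simple functions below the integrand, and simple
  functions below \<open>f\<close> and \<open>g\<close> add up to one below the sum. As this holds
  for arbitrary functions, it applies to the density along a curve without a discussion of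
  measurability.\<close>

lemma nn_integral_superadditive:
  "(\<integral>\<^sup>+x. f x \<partial>M) + (\<integral>\<^sup>+x. g x \<partial>M) \<le> (\<integral>\<^sup>+x. f x + g x \<partial>M)"
proof -
  have 1: "integral\<^sup>S M u + (\<integral>\<^sup>+x. g x \<partial>M) \<le> (\<integral>\<^sup>+x. f x + g x \<partial>M)"
    if u: "simple_function M u" "u \<le> f" for u
  proof -
    have "integral\<^sup>S M u + (\<integral>\<^sup>+x. g x \<partial>M) =
        (SUP v\<in>{v. simple_function M v \<and> v \<le> g}. integral\<^sup>S M u + integral\<^sup>S M v)"
      unfolding nn_integral_def
      by (subst ennreal_SUP_add_right) (auto intro!: exI[of _ "\<lambda>_. 0"] simp: le_fun_def)
    also have "\<dots> \<le> (\<integral>\<^sup>+x. f x + g x \<partial>M)"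
    proof (rule SUP_least)
      fix v assume v: "v \<in> {v. simple_function M v \<and> v \<le> g}"
      have "integral\<^sup>S M u + integral\<^sup>S M v = (\<integral>\<^sup>+x. u x + v x \<partial>M)"
        using u v by (simp add: nn_integral_eq_simple_integral)
      also have "\<dots> \<le> (\<integral>\<^sup>+x. f x + g x \<partial>M)"
        using u v by (intro nn_integral_mono add_mono) (auto simp: le_fun_def)
      finally show "integral\<^sup>S M u + integral\<^sup>S M v \<le> (\<integral>\<^sup>+x. f x + g x \<partial>M)" .
    qed
    finally show ?thesis .
  qed
  have "(\<integral>\<^sup>+x. f x \<partial>M) + (\<integral>\<^sup>+x. g x \<partial>M) =
      (SUP u\<in>{u. simple_function M u \<and> u \<le> f}. integral\<^sup>S M u + (\<integral>\<^sup>+x. g x \<partial>M))"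
    unfolding nn_integral_def[of M f]
    by (subst ennreal_SUP_add_left) (auto intro!: exI[of _ "\<lambda>_. 0"] simp: le_fun_def)
  also have "\<dots> \<le> (\<integral>\<^sup>+x. f x + g x \<partial>M)"
    by (rule SUP_least) (use 1 in auto)
  finally show ?thesis .
qed

lemma set_nn_integral_Ioc_superadditive:
  fixes h :: "real \<Rightarrow> ennreal"
  assumes "s \<le> t" "t \<le> u"
  shows "(\<integral>\<^sup>+x\<in>{s<..t}. h x \<partial>M) + (\<integral>\<^sup>+x\<in>{t<..u}. h x \<partial>M) \<le> (\<integral>\<^sup>+x\<in>{s<..u}. h x \<partial>M)"
proof -
  have "(\<integral>\<^sup>+x\<in>{s<..t}. h x \<partial>M) + (\<integral>\<^sup>+x\<in>{t<..u}. h x \<partial>M)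
      \<le> (\<integral>\<^sup>+x. h x * indicator {s<..t} x + h x * indicator {t<..u} x \<partial>M)"
    by (rule nn_integral_superadditive)
  also have "\<dots> = (\<integral>\<^sup>+x\<in>{s<..u}. h x \<partial>M)"
    using assms by (intro nn_integral_cong) (auto simp: indicator_def)
  finally show ?thesis .
qed

text \<open>\<open>ennreal\<close> truncates negative reals to 0: if one summand is negative, the
  sum is at most the other one.\<close>

lemma ennreal_add_le: "ennreal (x + y) \<le> ennreal x + ennreal y"
proof (cases "0 \<le> x \<and> 0 \<le> y")
  case False
  then have "x + y \<le> y \<or> x + y \<le> x" by auto
  then show ?thesis
    by (metis add_increasing add_increasing2 ennreal_leI order.refl zero_le)
qed auto

text \<open>
  A mean value inequality for \<open>f\<close> against an interval function \<open>N\<close>: it needs to be verified only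
  locally, and near points of a closed exceptional set on which \<open>f\<close> is locally constant it need
  not be verified at all.
\<close>

lemma interval_bound_from_local:
  fixes f :: "real \<Rightarrow> real" and N :: "real \<Rightarrow> real \<Rightarrow> ennreal"
  assumes "a \<le> b" and f: "continuous_on {a..b} f"
    and super: "\<And>s t u. a \<le> s \<Longrightarrow> s \<le> t \<Longrightarrow> t \<le> u \<Longrightarrow> u \<le> b \<Longrightarrow> N s t + N t u \<le> N s u"
    and E: "closed E"
    and regular: "\<And>x. x \<in> {a..b} - E \<Longrightarrow> \<exists>d>0. \<forall>s t. a \<le> s \<longrightarrow> s \<le> x \<longrightarrow> x \<le> t \<longrightarrow> t \<le> b \<longrightarrow> t - s < d
      \<longrightarrow> ennreal (f t - f s) \<le> N s t"
    and singular: "\<And>x. x \<in> {a..b} \<inter> E \<Longrightarrow> \<exists>d>0. \<forall>t\<in>{a..b} \<inter> E. \<bar>t - x\<bar> < d \<longrightarrow> f t = f x"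
  shows "ennreal (f b - f a) \<le> N a b"
proof -
  have chain: "ennreal (f u - f s) \<le> N s u"
    if "ennreal (f t - f s) \<le> N s t" "ennreal (f u - f t) \<le> N t u" "a \<le> s" "s \<le> t" "t \<le> u" "u \<le> b" for s t u
  proof -
    have "ennreal (f u - f s) = ennreal ((f u - f t) + (f t - f s))" by simp
    also have "\<dots> \<le> ennreal (f u - f t) + ennreal (f t - f s)"
      by (rule ennreal_add_le)
    also have "\<dots> \<le> N s t + N t u" using that by (simp add: add.commute add_mono)
    also have "\<dots> \<le> N s u" using that by (intro super) auto
    finally show ?thesis .
  qed
  have Nmono: "N s t \<le> N s' t'" if "a \<le> s'" "s' \<le> s" "s \<le> t" "t \<le> t'" "t' \<le> b" for s t s' t'
  proof -
    have "N s t \<le> N s t + N t t'" by simp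
    also have "\<dots> \<le> N s t'" using that by (intro super) auto
    also have "\<dots> \<le> N s' s + N s t'" by simp
    also have "\<dots> \<le> N s' t'" using that by (intro super) auto
    finally show ?thesis .
  qed
  \<comment> \<open>Away from the exceptional set the local bounds are combined by bisection, with
    \<open>chain\<close> as the combination step.\<close>
  have free: "ennreal (f t - f s) \<le> N s t" if st: "a \<le> s" "s \<le> t" "t \<le> b" "{s..t} \<inter> E = {}" for s t
  proof -
    have "s \<le> s \<longrightarrow> t \<le> t \<longrightarrow> ennreal (f t - f s) \<le> N s t"
    proof (rule Bolzano[where P="\<lambda>u v. s \<le> u \<longrightarrow> v \<le> t \<longrightarrow> ennreal (f v - f u) \<le> N u v", OF st(2)])
      fix u v w
      assume IH: "s \<le> u \<longrightarrow> v \<le> t \<longrightarrow> ennreal (f v - f u) \<le> N u v"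
        "s \<le> v \<longrightarrow> w \<le> t \<longrightarrow> ennreal (f w - f v) \<le> N v w" "u \<le> v" "v \<le> w"
      show "s \<le> u \<longrightarrow> w \<le> t \<longrightarrow> ennreal (f w - f u) \<le> N u w"
      proof (intro impI)
        assume uw: "s \<le> u" "w \<le> t"
        show "ennreal (f w - f u) \<le> N u w"
          by (rule chain[where s=u and t=v and u=w]) (use IH uw st in auto)
      qed
    next
      fix x assume x: "s \<le> x" "x \<le> t"
      then have "x \<in> {a..b} - E" using st by auto
      from regular[OF this] obtain d where d: "d > 0"
        "\<forall>s t. a \<le> s \<longrightarrow> s \<le> x \<longrightarrow> x \<le> t \<longrightarrow> t \<le> b \<longrightarrow> t - s < d \<longrightarrow> ennreal (f t - f s) \<le> N s t"
        by blast
      show "\<exists>d>0. \<forall>u v. u \<le> x \<and> x \<le> v \<and> v - u < d \<longrightarrow>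
          s \<le> u \<longrightarrow> v \<le> t \<longrightarrow> ennreal (f v - f u) \<le> N u v"
        by (rule exI[of _ d]) (use st d in auto)
    qed
    then show ?thesis using st by auto
  qed
  \<comment> \<open>The right endpoint may be exceptional. It is approached from inside, using the
    continuity of \<open>f\<close> and \<open>N s r \<le> N s t\<close>; \<open>free_left\<close> is
    the mirror image.\<close>
  have free_right: "ennreal (f t - f s) \<le> N s t"
    if st: "a \<le> s" "s \<le> t" "t \<le> b" "{s..<t} \<inter> E = {}" for s t
  proof (cases "s = t")
    case False
    have lim: "((\<lambda>r. ennreal (f r - f s)) \<longlongrightarrow> ennreal (f t - f s)) (at t within {s..<t})"
    proof (intro tendsto_ennrealI tendsto_diff tendsto_const)
      show "(f \<longlongrightarrow> f t) (at t within {s..<t})"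
        by (rule tendsto_within_subset[of _ _ _ "{a..b}"]) (use st f in \<open>auto simp: continuous_on_def\<close>)
    qed
    have nt: "at t within {s..<t} \<noteq> bot"
      using st False by (simp add: trivial_limit_within islimpt_greaterThanLessThan2 islimpt_subset[of t "{s<..<t}"])
    have "eventually (\<lambda>r. ennreal (f r - f s) \<le> N s t) (at t within {s..<t})"
      unfolding eventually_at_topological
    proof (intro exI[of _ UNIV] conjI ballI impI)
      fix r assume r: "r \<in> {s..<t}"
      have "ennreal (f r - f s) \<le> N s r" using r st by (intro free) (auto simp: disjoint_iff)
      also have "\<dots> \<le> N s t" using r st by (intro Nmono) auto
      finally show "ennreal (f r - f s) \<le> N s t" .
    qed auto
    from tendsto_upperbound[OF lim this nt] show ?thesis .
  qed simp
  have free_left: "ennreal (f t - f s) \<le> N s t"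
    if st: "a \<le> s" "s \<le> t" "t \<le> b" "{s<..t} \<inter> E = {}" for s t
  proof (cases "s = t")
    case False
    have lim: "((\<lambda>r. ennreal (f t - f r)) \<longlongrightarrow> ennreal (f t - f s)) (at s within {s<..t})"
    proof (intro tendsto_ennrealI tendsto_diff tendsto_const)
      show "(f \<longlongrightarrow> f s) (at s within {s<..t})"
        by (rule tendsto_within_subset[of _ _ _ "{a..b}"]) (use st f in \<open>auto simp: continuous_on_def\<close>)
    qed
    have nt: "at s within {s<..t} \<noteq> bot"
      using st False by (simp add: trivial_limit_within islimpt_greaterThanLessThan1 islimpt_subset[of s "{s<..<t}"])
    have "eventually (\<lambda>r. ennreal (f t - f r) \<le> N s t) (at s within {s<..t})"
      unfolding eventually_at_topological
    proof (intro exI[of _ UNIV] conjI ballI impI)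
      fix r assume r: "r \<in> {s<..t}"
      have "ennreal (f t - f r) \<le> N r t" using r st by (intro free) (auto simp: disjoint_iff)
      also have "\<dots> \<le> N s t" using r st by (intro Nmono) auto
      finally show "ennreal (f t - f r) \<le> N s t" .
    qed auto
    from tendsto_upperbound[OF lim this nt] show ?thesis .
  qed simp
  have "a \<le> a \<longrightarrow> b \<le> b \<longrightarrow> ennreal (f b - f a) \<le> N a b"
  proof (rule Bolzano[where P="\<lambda>u v. a \<le> u \<longrightarrow> v \<le> b \<longrightarrow> ennreal (f v - f u) \<le> N u v", OF \<open>a \<le> b\<close>])
    fix u v w
    assume IH: "a \<le> u \<longrightarrow> v \<le> b \<longrightarrow> ennreal (f v - f u) \<le> N u v"
      "a \<le> v \<longrightarrow> w \<le> b \<longrightarrow> ennreal (f w - f v) \<le> N v w" "u \<le> v" "v \<le> w"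
    show "a \<le> u \<longrightarrow> w \<le> b \<longrightarrow> ennreal (f w - f u) \<le> N u w"
      proof (intro impI)
        assume uw: "a \<le> u" "w \<le> b"
        show "ennreal (f w - f u) \<le> N u w"
          by (rule chain[where s=u and t=v and u=w]) (use IH uw in auto)
      qed
  next
    fix x assume local: "a \<le> x" "x \<le> b"
    show "\<exists>d>0. \<forall>u v. u \<le> x \<and> x \<le> v \<and> v - u < d \<longrightarrow>
        a \<le> u \<longrightarrow> v \<le> b \<longrightarrow> ennreal (f v - f u) \<le> N u v"
    proof (cases "x \<in> E")
      case False
      then have "x \<in> {a..b} - E" using local by auto
      from regular[OF this] obtain d where d: "d > 0"
        "\<forall>s t. a \<le> s \<longrightarrow> s \<le> x \<longrightarrow> x \<le> t \<longrightarrow> t \<le> b \<longrightarrow> t - s < d \<longrightarrow> ennreal (f t - f s) \<le> N s t"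
        by blast
      show ?thesis
        by (rule exI[of _ d]) (use d in auto)
    next
      case True
      then have "x \<in> {a..b} \<inter> E" using local by auto
      from singular[OF this] obtain d where d: "d > 0" "\<forall>t\<in>{a..b} \<inter> E. \<bar>t - x\<bar> < d \<longrightarrow> f t = f x"
        by blast
      have "ennreal (f t - f s) \<le> N s t" if st: "s \<le> x" "x \<le> t" "t - s < d" "a \<le> s" "t \<le> b" for s t
      proof -
        \<comment> \<open>\<open>f\<close> has the same value at the first and the last exceptional
          time \<open>e1\<close> and \<open>e2\<close>, so its increment comes from the two outer
          intervals alone; \<open>N\<close> on the middle one is given away.\<close>
        let ?K = "{s..t} \<inter> E"
        have K: "compact ?K" "?K \<noteq> {}" using E True st by (auto intro: compact_Int_closed)
        obtain e1 where e1: "e1 \<in> ?K" "\<And>y. y \<in> ?K \<Longrightarrow> e1 \<le> y" using compact_attains_inf[OF K] by blast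
        obtain e2 where e2: "e2 \<in> ?K" "\<And>y. y \<in> ?K \<Longrightarrow> y \<le> e2" using compact_attains_sup[OF K] by blast
        have "f e1 = f x" "f e2 = f x" using d(2)[rule_format, of e1] d(2)[rule_format, of e2] e1(1) e2(1) st by auto
        have "e1 \<le> e2" using e1 e2 by blast
        have free1: "{s..<e1} \<inter> E = {}"
        proof -
          have False if "y \<in> E" "s \<le> y" "y < e1" for y
            using e1(2)[of y] e1(1) that by auto
          then show ?thesis by auto
        qed
        have free2: "{e2<..t} \<inter> E = {}"
        proof -
          have False if "y \<in> E" "y \<le> t" "e2 < y" for y
            using e2(2)[of y] e2(1) that by auto
          then show ?thesis by auto
        qed
        have "ennreal (f e1 - f s) \<le> N s e1"
          by (rule free_right) (use e1(1) st free1 in auto)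
        also have "\<dots> \<le> N s e2" using e1 e2 st \<open>e1 \<le> e2\<close> by (intro Nmono) auto
        finally have 1: "ennreal (f e2 - f s) \<le> N s e2" using \<open>f e1 = f x\<close> \<open>f e2 = f x\<close> by simp
        have 2: "ennreal (f t - f e2) \<le> N e2 t"
          by (rule free_left) (use e2(1) st free2 in auto)
        show ?thesis by (rule chain[where s=s and t=e2 and u=t]) (use 1 2 e2(1) st in auto)
      qed
      then show ?thesis using d by blast
    qed
  qed
  then show ?thesis by simp
qed


section \<open>Arc length of continuously differentiable curves\<close>

lemma list_variation_lipschitz:
  assumes "\<And>x y. x \<in> {s..t} \<Longrightarrow> y \<in> {s..t} \<Longrightarrow> dist (g x) (g y) \<le> M * \<bar>x - y\<bar>" "0 \<le> M"
  shows "sorted (u # ts) \<Longrightarrow> set (u # ts) \<subseteq> {s..t} \<Longrightarrow> list_variation g (u # ts) \<le> ennreal (M * (t - u))"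
proof (induction ts arbitrary: u)
  case (Cons v ts)
  have "list_variation g (u # v # ts) \<le> ennreal (M * (v - u)) + ennreal (M * (t - v))"
    using Cons.prems Cons.IH[of v] assms(1)[of u v] by (auto intro!: add_mono ennreal_leI)
  also have "\<dots> = ennreal (M * (t - u))"
    using Cons.prems assms(2) by (subst ennreal_plus[symmetric]) (auto simp flip: distrib_left)
  finally show ?case .
qed simp

lemma path_variation_lipschitz:
  assumes "\<And>x y. x \<in> {s..t} \<Longrightarrow> y \<in> {s..t} \<Longrightarrow> dist (g x) (g y) \<le> M * \<bar>x - y\<bar>" "0 \<le> M"
  shows "path_variation g s t \<le> ennreal (M * (t - s))"
proof (rule path_variation_leI)
  fix ts assume ts: "sorted ts" "set ts \<subseteq> {s..t}"
  show "list_variation g ts \<le> ennreal (M * (t - s))"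
  proof (cases ts)
    case (Cons u us)
    have "list_variation g ts \<le> ennreal (M * (t - u))"
      using list_variation_lipschitz[OF assms, where u=u and ts=us] ts Cons by auto
    also have "\<dots> \<le> ennreal (M * (t - s))"
      using ts Cons assms(2) by (intro ennreal_leI mult_left_mono) auto
    finally show ?thesis .
  qed simp
qed

context
  fixes g g' :: "real \<Rightarrow> complex" and a b :: real
  assumes ab: "a \<le> b"
    and deriv: "\<And>t. t \<in> {a..b} \<Longrightarrow> (g has_vector_derivative g' t) (at t within {a..b})"
    and cont: "continuous_on {a..b} g'"
begin

lemma C1_lipschitz:
  assumes "a \<le> s" "t \<le> b" "\<And>x. x \<in> {s..t} \<Longrightarrow> cmod (g' x) \<le> M" "x \<in> {s..t}" "y \<in> {s..t}"
  shows "dist (g x) (g y) \<le> M * \<bar>x - y\<bar>"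
proof -
  have "norm (g x - g y) \<le> M * norm (x - y)"
  proof (rule differentiable_bound)
    show "convex {s..t}" by simp
    show "(g has_derivative (\<lambda>h. h *\<^sub>R g' u)) (at u within {s..t})" if "u \<in> {s..t}" for u
      using deriv[of u] that assms(1,2) unfolding has_vector_derivative_def
      by (auto intro: has_derivative_subset)
    show "onorm (\<lambda>h. h *\<^sub>R g' u) \<le> M" if "u \<in> {s..t}" for u
      using assms(3)[OF that] by (simp add: onorm_scaleR_left bounded_linear_ident onorm_id)
  qed (use assms in auto)
  then show ?thesis by (simp add: dist_norm)
qed

lemma C1_variation_finite: "path_variation g a b < \<infinity>"
proof -
  have "bounded (g' ` {a..b})"
    by (intro compact_imp_bounded compact_continuous_image cont) auto
  then obtain M where M: "\<And>x. x \<in> {a..b} \<Longrightarrow> cmod (g' x) \<le> M" "0 \<le> M"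
    unfolding bounded_pos by (metis imageI less_imp_le)
  have "path_variation g a b \<le> ennreal (M * (b - a))"
    using M by (intro path_variation_lipschitz C1_lipschitz[of a b]) auto
  then show ?thesis by (metis ennreal_less_top infinity_ennreal_def order_le_less_trans)
qed

lemma C1_continuous: "continuous_on {a..b} g"
  using deriv by (meson continuous_on_eq_continuous_within has_vector_derivative_continuous)

text \<open>An increment of the variation lies between the chord, which is
  \<open>cmod (g' x)\<close> times the increment of the parameter up to a relative error
  \<open>e\<close>, and the Lipschitz bound with constant \<open>cmod (g' x) + e\<close>, valid near
  \<open>x\<close> by continuity of \<open>g'\<close>.\<close>

lemma C1_variation_derivative:
  assumes x: "x \<in> {a..b}"
  shows "(variation_function g a b has_vector_derivative cmod (g' x)) (at x within {a..b})"
  unfolding has_vector_derivative_def has_derivative_within_alt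
proof (intro conjI allI impI bounded_linear_scaleR_left)
  fix e :: real assume "e > 0"
  let ?F = "variation_function g a b"
  obtain d1 where d1: "d1 > 0" "\<And>y. y \<in> {a..b} \<Longrightarrow> norm (y - x) < d1 \<Longrightarrow>
      norm (g y - g x - (y - x) *\<^sub>R g' x) \<le> e * norm (y - x)"
    using deriv[OF x, unfolded has_vector_derivative_def has_derivative_within_alt] \<open>e > 0\<close> by blast
  obtain d2 where d2: "d2 > 0" "\<And>y. y \<in> {a..b} \<Longrightarrow> dist y x < d2 \<Longrightarrow> dist (g' y) (g' x) < e"
    using cont[unfolded continuous_on_iff] x \<open>e > 0\<close> by blast
  have upper: "ennreal (?F t - ?F s) \<le> ennreal ((cmod (g' x) + e) * (t - s))"
    if st: "a \<le> s" "s \<le> x" "x \<le> t" "t \<le> b" "t - s < d2" for s t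
  proof -
    have "cmod (g' u) \<le> cmod (g' x) + e" if "u \<in> {s..t}" for u
    proof -
      have "dist (g' u) (g' x) < e" using d2(2)[of u] that st by (auto simp: dist_real_def)
      then show ?thesis using norm_triangle_ineq2[of "g' u" "g' x"] by (simp add: dist_norm)
    qed
    then have "path_variation g s t \<le> ennreal ((cmod (g' x) + e) * (t - s))"
      using st \<open>e > 0\<close> by (intro path_variation_lipschitz C1_lipschitz[of s t]) auto
    then show ?thesis using st by (subst variation_function_diff[OF C1_variation_finite]) auto
  qed
  have lower: "cmod (g t - g s) \<le> ?F t - ?F s" if st: "a \<le> s" "s \<le> t" "t \<le> b" for s t
  proof -
    have "ennreal (cmod (g t - g s)) \<le> path_variation g s t"
      using dist_le_path_variation[of s t g] st by (simp add: dist_norm norm_minus_commute)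
    also have "\<dots> = ennreal (?F t - ?F s)"
      using st by (subst variation_function_diff[OF C1_variation_finite]) auto
    finally show ?thesis
      by (subst (asm) ennreal_le_iff) (use variation_function_mono[OF C1_variation_finite, of s t] st in auto)
  qed
  show "\<exists>d>0. \<forall>y\<in>{a..b}. norm (y - x) < d \<longrightarrow>
      norm (?F y - ?F x - (y - x) *\<^sub>R cmod (g' x)) \<le> e * norm (y - x)"
  proof (intro exI[of _ "min d1 d2"] conjI ballI impI)
    fix y assume y: "y \<in> {a..b}" "norm (y - x) < min d1 d2"
    have g: "\<bar>cmod (g y - g x) - \<bar>y - x\<bar> * cmod (g' x)\<bar> \<le> e * \<bar>y - x\<bar>"
      using d1(2)[of y] y norm_triangle_ineq3[of "g y - g x" "(y - x) *\<^sub>R g' x"] by simp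
    have sc: "0 \<le> (cmod (g' x) + e) * r" if "0 \<le> r" for r using that \<open>e > 0\<close> by simp
    show "norm (?F y - ?F x - (y - x) *\<^sub>R cmod (g' x)) \<le> e * norm (y - x)"
    proof (cases "x \<le> y")
      case True
      have "?F y - ?F x \<le> (cmod (g' x) + e) * (y - x)"
        using upper[of x y] True y x sc[of "y - x"] by (auto simp: ennreal_le_iff)
      moreover have "cmod (g y - g x) \<le> ?F y - ?F x" using lower[of x y] True y x by auto
      ultimately show ?thesis using True g by (auto simp: abs_le_iff algebra_simps)
    next
      case False
      have "?F x - ?F y \<le> (cmod (g' x) + e) * (x - y)"
        using upper[of y x] False y x sc[of "x - y"] by (auto simp: ennreal_le_iff)
      moreover have "cmod (g x - g y) \<le> ?F x - ?F y" using lower[of y x] False y x by auto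
      ultimately show ?thesis using False g by (auto simp: abs_le_iff algebra_simps norm_minus_commute)
    qed
  qed (use d1 d2 in auto)
qed

text \<open>Arc length is |g'| dt: by the fundamental theorem of calculus the two measures agree on
  half-open intervals, which form an intersection-stable generator of the Borel sets.\<close>

lemma C1_interval_measure:
  "interval_measure (variation_function g a b) =
     density lborel (\<lambda>t. ennreal (indicator {a..b} t * cmod (g' t)))"
proof -
  let ?F = "variation_function g a b"
  define N where "N = density lborel (\<lambda>t. ennreal (indicator {a..b} t * cmod (g' t)))"
  have [measurable]: "(\<lambda>t. indicator {a..b} t * cmod (g' t)) \<in> borel_measurable borel"
    using borel_measurable_continuous_on_indicator[of "{a..b}" "\<lambda>t. cmod (g' t)"] cont
    by (auto intro: continuous_on_norm)
  have eq: "emeasure (interval_measure ?F) {s<..t} = emeasure N {s<..t}" for s t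
  proof (cases "s \<le> t")
    case True
    define s' t' where "s' = max a (min s b)" and "t' = max a (min t b)"
    have st': "a \<le> s'" "s' \<le> t'" "t' \<le> b" using True ab by (auto simp: s'_def t'_def)
    have "?F s' = ?F s" "?F t' = ?F t"
      using ab by (auto simp: s'_def t'_def variation_function_def max_def min_def path_variation_empty)
    then have "emeasure (interval_measure ?F) {s<..t} = ennreal (?F t' - ?F s')"
      using True by (subst emeasure_interval_measure_Ioc)
        (auto intro: variation_function_mono C1_variation_finite variation_function_right_cont C1_continuous)
    also have "\<dots> = (\<integral>\<^sup>+r. ennreal (cmod (g' r)) * indicator {s'..t'} r \<partial>lborel)"
    proof -
      have "((\<lambda>t. cmod (g' t)) has_integral (?F t' - ?F s')) {s'..t'}"
        using st' by (intro fundamental_theorem_of_calculus)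
          (auto intro: has_vector_derivative_within_subset[OF C1_variation_derivative])
      then show ?thesis by (subst nn_integral_has_integral_lebesgue') auto
    qed
    also have "\<dots> = (\<integral>\<^sup>+r. ennreal (indicator {a..b} r * cmod (g' r)) * indicator {s<..t} r \<partial>lborel)"
    proof (rule nn_integral_cong_AE)
      \<comment> \<open>\<open>{s'..t'}\<close> and \<open>{s<..t} \<inter> {a..b}\<close> differ at
        most at these two points.\<close>
      have "AE r in lborel. r \<noteq> s' \<and> r \<noteq> a"
        by (intro AE_conjI AE_lborel_singleton)
      then show "AE r in lborel. ennreal (cmod (g' r)) * indicator {s'..t'} r =
          ennreal (indicator {a..b} r * cmod (g' r)) * indicator {s<..t} r"
        by eventually_elim (auto simp: s'_def t'_def indicator_def max_def min_def split: if_splits)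
    qed
    also have "\<dots> = emeasure N {s<..t}"
      unfolding N_def by (subst emeasure_density) auto
    finally show ?thesis .
  qed simp
  have "interval_measure ?F = N"
  proof (rule measure_eqI_generator_eq[where E="range (\<lambda>(a, b). {a<..b::real})" and \<Omega>=UNIV
        and A="\<lambda>n. {- real n<..real n}"])
    show "Int_stable (range (\<lambda>(a, b). {a<..b::real}))"
      by (auto simp: Int_stable_def Int_greaterThanAtMost)
    show "(\<Union>i::nat. {- real i<..real i}) = UNIV"
    proof (intro set_eqI iffI UNIV_I)
      fix x :: real
      obtain n where "\<bar>x\<bar> < real n" using reals_Archimedean2 by blast
      then show "x \<in> (\<Union>i. {- real i<..real i})" by (intro UN_I[of n]) auto
    qed
    show "emeasure (interval_measure ?F) {- real i<..real i} \<noteq> \<infinity>" for i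
      by (subst emeasure_interval_measure_Ioc)
        (auto intro: variation_function_mono C1_variation_finite variation_function_right_cont C1_continuous)
    have "sets borel = sigma_sets UNIV (range (\<lambda>(a, b). {a<..b::real}))"
      by (subst borel_sigma_sets_Ioc) (simp add: sets_measure_of)
    then show "sets (interval_measure ?F) = sigma_sets UNIV (range (\<lambda>(a, b). {a<..b}))"
      "sets N = sigma_sets UNIV (range (\<lambda>(a, b). {a<..b}))"
      by (auto simp: N_def)
  qed (auto simp: eq)
  then show ?thesis by (simp add: N_def)
qed

text \<open>\<open>h\<close> ds = \<open>h\<close> |g'| dt is at most \<open>k\<close> dt. Where
  \<open>g'\<close> vanishes, the bound for \<open>h\<close> may be infinite, but it has weight 0
  and \<open>0 * \<infinity> = 0\<close>; hence an inequality is what remains.\<close>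

lemma C1_arc_length_integral_le:
  assumes k: "continuous_on {a..b} k" "\<And>t. t \<in> {a..b} \<Longrightarrow> 0 \<le> k t"
    and K: "\<And>t. t \<in> {a..b} \<Longrightarrow> (K has_vector_derivative k t) (at t within {a..b})"
    and h: "\<And>t. t \<in> {a..b} \<Longrightarrow> h t \<le> ennreal (k t) / ennreal (cmod (g' t))"
  shows "arc_length_integral g a b h \<le> ennreal (K b - K a)"
proof -
  have [measurable]: "(\<lambda>t. indicator {a..b} t * cmod (g' t)) \<in> borel_measurable borel"
    using borel_measurable_continuous_on_indicator[of "{a..b}" "\<lambda>t. cmod (g' t)"] cont
    by (auto intro: continuous_on_norm)
  have [measurable]: "(\<lambda>t. indicator {a..b} t * k t) \<in> borel_measurable borel"
    using borel_measurable_continuous_on_indicator[of "{a..b}" k] k by auto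
  have "arc_length_integral g a b h \<le>
      (\<integral>\<^sup>+t. ennreal (indicator {a..b} t * k t) / ennreal (indicator {a..b} t * cmod (g' t))
         \<partial>interval_measure (variation_function g a b))"
    unfolding arc_length_integral_eq
    by (rule nn_integral_mono) (use h in \<open>auto simp: indicator_def\<close>)
  also have "\<dots> = (\<integral>\<^sup>+t. ennreal (indicator {a..b} t * cmod (g' t)) *
      (ennreal (indicator {a..b} t * k t) / ennreal (indicator {a..b} t * cmod (g' t))) \<partial>lborel)"
    unfolding C1_interval_measure by (subst nn_integral_density) auto
  also have "\<dots> \<le> (\<integral>\<^sup>+t. ennreal (k t) * indicator {a..b} t \<partial>lborel)"
  proof (rule nn_integral_mono)
    fix t
    have "ennreal c * (ennreal d / ennreal c) \<le> ennreal d" if "0 \<le> c" for c d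
      using that
      by (cases "c = 0") (auto simp: ennreal_times_divide mult.commute[of "ennreal c"] ennreal_mult_divide_eq)
    then show "ennreal (indicator {a..b} t * cmod (g' t)) *
      (ennreal (indicator {a..b} t * k t) / ennreal (indicator {a..b} t * cmod (g' t)))
      \<le> ennreal (k t) * indicator {a..b} t"
      by (auto simp: indicator_def)
  qed
  also have "\<dots> = ennreal (K b - K a)"
    using k K ab by (intro nn_integral_has_integral_lebesgue' fundamental_theorem_of_calculus) auto
  finally show ?thesis .
qed

end


section \<open>Holomorphic functions on the disc\<close>

lemma Moebius_has_field_derivative:
  assumes "cmod w < 1" "cmod z < 1"
  shows "(Moebius_function 0 w has_field_derivative (1 - (cmod w)\<^sup>2) / (1 - cnj w * z)\<^sup>2) (at z)"
proof -
  have nz: "1 - cnj w * z \<noteq> 0"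
    using assms norm_mult_less[of "cnj w" 1 z 1] by (metis complex_mod_cnj less_irrefl mult_1 norm_one right_minus_eq)
  have "((\<lambda>z. (z - w) / (1 - cnj w * z)) has_field_derivative
      (1 * (1 - cnj w * z) - (z - w) * (- cnj w)) / (1 - cnj w * z)\<^sup>2) (at z)"
    using nz by (auto intro!: derivative_eq_intros simp: power2_eq_square)
  moreover have "1 * (1 - cnj w * z) - (z - w) * (- cnj w) = 1 - (cmod w)\<^sup>2"
    using complex_norm_square[of w] by (simp add: algebra_simps)
  ultimately show ?thesis
    by (simp only: Moebius_function_simple[abs_def])
qed

text \<open>Automorphisms of the disc move \<open>x\<close> and \<open>h x\<close> to
  \<open>0\<close>, where the Schwarz lemma applies. Their derivatives are \<open>1 - |x|^2\<close>
  at \<open>0\<close> and \<open>1 / (1 - |h x|^2)\<close> at \<open>h x\<close>.\<close>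

lemma Schwarz_Pick:
  assumes h: "h holomorphic_on ball 0 1" "h \<in> ball 0 1 \<rightarrow> ball 0 1" and x: "x \<in> ball 0 1"
  shows "cmod (deriv h x) * (1 - (cmod x)\<^sup>2) \<le> 1 - (cmod (h x))\<^sup>2"
proof -
  let ?A = "Moebius_function 0 (- x)" and ?B = "Moebius_function 0 (h x)"
  have hx: "cmod (h x) < 1" "cmod x < 1" using h x by auto
  have A0: "?A 0 = x" by (simp add: Moebius_function_of_zero)
  have A: "?A holomorphic_on ball 0 1" "?A \<in> ball 0 1 \<rightarrow> ball 0 1"
    using hx by (auto intro!: Moebius_function_holomorphic Moebius_function_norm_lt_1)
  have B: "?B holomorphic_on ball 0 1" "?B \<in> ball 0 1 \<rightarrow> ball 0 1"
    using hx by (auto intro!: Moebius_function_holomorphic Moebius_function_norm_lt_1)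
  let ?F = "?B \<circ> (h \<circ> ?A)"
  have "?F holomorphic_on ball 0 1"
    using A B h by (intro holomorphic_on_compose_gen[where t="ball 0 1"]) (auto intro: holomorphic_on_compose_gen)
  moreover have "?F 0 = 0" using A0 by (simp add: Moebius_function_eq_zero)
  moreover have "cmod (?F z) < 1" if "cmod z < 1" for z
    using A B h that by (auto simp: Pi_iff)
  ultimately have le: "cmod (deriv ?F 0) \<le> 1"
    using Schwarz_Lemma(2)[of ?F 0] by auto
  have "(?A has_field_derivative (1 - (cmod x)\<^sup>2)) (at 0)"
    using Moebius_has_field_derivative[of "- x" 0] hx by simp
  moreover have "(h has_field_derivative deriv h x) (at (?A 0))"
    unfolding A0 using h(1) x by (intro holomorphic_derivI) auto
  ultimately have "((h \<circ> ?A) has_field_derivative deriv h x * (1 - (cmod x)\<^sup>2)) (at 0)"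
    by (rule DERIV_chain[rotated])
  moreover have "(?B has_field_derivative 1 / (1 - (cmod (h x))\<^sup>2)) (at ((h \<circ> ?A) 0))"
  proof -
    have "1 - (cmod (h x))\<^sup>2 \<noteq> 0" using hx abs_square_less_1[of "cmod (h x)"] by auto
    then have "complex_of_real (1 - (cmod (h x))\<^sup>2) / (1 - cnj (h x) * h x)\<^sup>2 = 1 / complex_of_real (1 - (cmod (h x))\<^sup>2)"
      using complex_norm_square[of "h x"] by (simp add: power2_eq_square mult.commute)
    then show ?thesis
      using Moebius_has_field_derivative[of "h x" "h x"] hx A0 by simp
  qed
  ultimately have "(?F has_field_derivative 1 / (1 - (cmod (h x))\<^sup>2) * (deriv h x * (1 - (cmod x)\<^sup>2))) (at 0)"
    by (rule DERIV_chain[rotated])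
  then have "deriv ?F 0 = complex_of_real (1 / (1 - (cmod (h x))\<^sup>2)) * (deriv h x * complex_of_real (1 - (cmod x)\<^sup>2))"
    by (simp add: DERIV_imp_deriv)
  then have "cmod (deriv ?F 0) = 1 / (1 - (cmod (h x))\<^sup>2) * (cmod (deriv h x) * (1 - (cmod x)\<^sup>2))"
    using hx by (simp only: norm_mult norm_of_real) (simp add: abs_square_le_1 less_imp_le)
  then show ?thesis
    using le hx by (simp add: divide_le_eq abs_square_less_1)
qed

lemma disc_density_pos: "cmod x < 1 \<Longrightarrow> 0 < disc_density x"
  by (simp add: disc_density_def abs_square_less_1)

text \<open>The Schwarz lemma for \<open>k (s z)\<close>. It turns the radius of the disc on which a
  lift exists into the upper bound of the theorem.\<close>

lemma Schwarz_deriv_ball: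
  assumes k: "k holomorphic_on ball 0 s" "k \<in> ball 0 s \<rightarrow> ball 0 1" "k 0 = 0" and "0 < s"
  shows "cmod (deriv k 0) \<le> 1 / s"
proof -
  let ?F = "\<lambda>z. k (complex_of_real s * z)"
  have "(*) (complex_of_real s) ` ball 0 1 \<subseteq> ball 0 s"
    using \<open>0 < s\<close> by (auto simp: norm_mult)
  then have "?F holomorphic_on ball 0 1"
    using holomorphic_on_compose_gen[of "\<lambda>z. complex_of_real s * z" "ball 0 1" k "ball 0 s"] k(1)
    by (auto simp: o_def intro!: holomorphic_intros)
  moreover have "cmod (?F z) < 1" if "cmod z < 1" for z
    using k(2) that \<open>0 < s\<close> by (auto simp: Pi_iff norm_mult)
  ultimately have "cmod (deriv ?F 0) \<le> 1"
    using Schwarz_Lemma(2)[of ?F 0] k(3) by auto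
  moreover have "(k has_field_derivative deriv k 0) (at (complex_of_real s * 0))"
    using k(1) \<open>0 < s\<close> by (auto intro: holomorphic_derivI)
  then have "(?F has_field_derivative deriv k 0 * s) (at 0)"
    by (rule DERIV_chain2) (auto intro!: derivative_eq_intros)
  ultimately show ?thesis
    using \<open>0 < s\<close> by (simp add: DERIV_imp_deriv norm_mult field_simps)
qed

section \<open>Roots, local normal forms and continuation on discs\<close>

lemma nonvanishing_nth_root:
  assumes "F holomorphic_on ball x r" "\<And>w. w \<in> ball x r \<Longrightarrow> F w \<noteq> 0" "0 < r" "0 < n"
  obtains G where "G holomorphic_on ball x r" "\<And>w. w \<in> ball x r \<Longrightarrow> G w ^ n = F w"
proof -
  obtain l where l: "l holomorphic_on ball x r" "\<And>w. w \<in> ball x r \<Longrightarrow> exp (l w) = F w"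
    using holomorphic_logarithm_exists[of "ball x r" F x] assms by auto
  show ?thesis
  proof
    show "(\<lambda>w. exp (l w / of_nat n)) holomorphic_on ball x r"
      using l assms by (intro holomorphic_intros) auto
    show "exp (l w / of_nat n) ^ n = F w" if "w \<in> ball x r" for w
      using l(2)[OF that] assms(4) by (simp flip: exp_of_nat_mult)
  qed
qed

text \<open>Near a point where \<open>G\<close> does not vanish, the quotient is continuous with
  values in the finite set of roots of unity, hence constant; the identity theorem extends the
  relation to \<open>S\<close>. This controls the ambiguity of local lifts and roots.\<close>

lemma equal_powers_imp_proportional:
  fixes G H :: "complex \<Rightarrow> complex"
  assumes S: "open S" "connected S" and hol: "G holomorphic_on S" "H holomorphic_on S"
    and "0 < n" and eq: "\<And>z. z \<in> S \<Longrightarrow> H z ^ n = G z ^ n"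
  obtains \<omega> where "\<omega> ^ n = 1" "\<And>z. z \<in> S \<Longrightarrow> H z = \<omega> * G z"
proof (cases "\<forall>z\<in>S. G z = 0")
  case True
  then have "H z = 1 * G z" if "z \<in> S" for z
    using eq[OF that] that \<open>0 < n\<close> by (simp add: zero_power)
  then show ?thesis using that[of 1] by simp
next
  case False
  then obtain z0 where z0: "z0 \<in> S" "G z0 \<noteq> 0" by blast
  have "continuous_on S G" using hol by (simp add: holomorphic_on_imp_continuous_on)
  then have "open (S \<inter> G -` (- {0}))"
    using S by (intro continuous_open_preimage) auto
  then obtain r where r: "r > 0" "ball z0 r \<subseteq> S \<inter> G -` (- {0})"
    using z0 open_contains_ball by blast
  let ?q = "\<lambda>z. H z / G z"
  have "continuous_on (ball z0 r) ?q"
    using r hol by (intro holomorphic_on_imp_continuous_on holomorphic_intros) (auto intro: holomorphic_on_subset)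
  moreover have "?q ` ball z0 r \<subseteq> {w. w ^ n = 1}"
    using r eq by (auto simp: power_divide subset_iff)
  then have "finite (?q ` ball z0 r)"
    using finite_roots_unity[of n] \<open>0 < n\<close> finite_subset by (metis One_nat_def Suc_leI)
  ultimately have "?q constant_on ball z0 r"
    by (intro continuous_finite_range_constant) auto
  then obtain \<omega> where \<omega>: "\<And>z. z \<in> ball z0 r \<Longrightarrow> ?q z = \<omega>" unfolding constant_on_def by blast
  have "\<omega> ^ n = 1"
    using \<omega>[of z0] eq[OF z0(1)] r z0 by (auto simp: power_divide)
  moreover have "H z = \<omega> * G z" if "z \<in> S" for z
  proof (rule analytic_continuation_open[of "ball z0 r" S H "\<lambda>z. \<omega> * G z"])
    show "H z = \<omega> * G z" if "z \<in> ball z0 r" for z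
    proof -
      have "G z \<noteq> 0" using r(2) that by blast
      then show ?thesis using \<omega>[OF that] by (metis nonzero_eq_divide_eq)
    qed
  qed (use S r hol that in \<open>auto intro!: holomorphic_intros\<close>)
  ultimately show ?thesis using that by blast
qed

lemma zero_factor:
  assumes "f holomorphic_on S" "open S" "x \<in> S" "f x = 0"
  obtains g where "g holomorphic_on S" "g x = deriv f x" "\<And>w. w \<in> S \<Longrightarrow> f w = (w - x) * g w"
proof
  let ?g = "\<lambda>w. if w = x then deriv f x else (f w - f x) / (w - x)"
  show "?g holomorphic_on S"
    by (rule pole_lemma_open) (use assms in auto)
  show "f w = (w - x) * ?g w" for w using assms by auto
qed auto

text \<open>Write the difference as \<open>(w - x)^n\<close> times a nonvanishing function and take
  an n-th root \<open>G\<close> of the latter. Then \<open>\<xi> w = (w - x) G w\<close> has the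
  derivative \<open>G x \<noteq> 0\<close> at \<open>x\<close>, so it is injective nearby.\<close>

lemma local_power_form:
  assumes F: "F holomorphic_on S" "open S" "connected S" "x \<in> S" and nc: "\<exists>w\<in>S. F w \<noteq> F x"
    and ord: "zorder (\<lambda>w. F w - F x) x = int n"
  obtains e \<xi> where "0 < n" "0 < e" "ball x e \<subseteq> S" "\<xi> holomorphic_on ball x e" "inj_on \<xi> (ball x e)"
    "\<xi> x = 0" "\<And>w. w \<in> ball x e \<Longrightarrow> F w = F x + \<xi> w ^ n"
proof -
  let ?f = "\<lambda>w. F w - F x" and ?g = "zor_poly (\<lambda>w. F w - F x) x"
  have "?f holomorphic_on S" using F by (intro holomorphic_intros)
  from zorder_exist_zero[OF this F(2-4)] nc ord obtain r where n: "0 < n"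
    and r: "0 < r" "cball x r \<subseteq> S" "?g holomorphic_on cball x r"
    "\<And>w. w \<in> cball x r \<Longrightarrow> ?f w = ?g w * (w - x) ^ n \<and> ?g w \<noteq> 0"
    by auto
  obtain G where G: "G holomorphic_on ball x r" "\<And>w. w \<in> ball x r \<Longrightarrow> G w ^ n = ?g w"
  proof (rule nonvanishing_nth_root[of ?g x r n])
    show "?g holomorphic_on ball x r" using r(3) ball_subset_cball by (rule holomorphic_on_subset)
    show "?g w \<noteq> 0" if "w \<in> ball x r" for w
      using r(4)[of w] that ball_subset_cball[of x r] by blast
  qed (use r(1) n in auto)
  let ?\<xi> = "\<lambda>w. (w - x) * G w"
  have hol: "?\<xi> holomorphic_on ball x r" using G by (intro holomorphic_intros)
  have "(?\<xi> has_field_derivative G x) (at x)"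
  proof -
    have "(G has_field_derivative deriv G x) (at x)" using G(1) r(1) by (intro holomorphic_derivI) auto
    then show ?thesis by (auto intro!: derivative_eq_intros)
  qed
  moreover have "G x \<noteq> 0"
  proof
    assume "G x = 0"
    then have "?g x = 0" using G(2)[of x] r(1) n by (simp add: zero_power)
    then show False using r(4)[of x] r(1) by (metis centre_in_cball less_imp_le)
  qed
  ultimately have "deriv ?\<xi> x \<noteq> 0" by (simp add: DERIV_imp_deriv)
  with hol r(1) obtain e where e: "0 < e" "ball x e \<subseteq> ball x r" "inj_on ?\<xi> (ball x e)"
    using has_complex_derivative_locally_injective[of ?\<xi> "ball x r" x] by auto
  have "F w = F x + ?\<xi> w ^ n" if "w \<in> ball x e" for w
  proof -
    have "w \<in> ball x r" using that e(2) by blast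
    then have "F w - F x = G w ^ n * (w - x) ^ n"
      using r(4)[of w] G(2)[of w] ball_subset_cball by (metis subsetD)
    then have "F w = F x + G w ^ n * (w - x) ^ n" by (metis add.commute diff_add_cancel)
    then show ?thesis by (simp only: power_mult_distrib mult.commute)
  qed
  then show ?thesis
  proof (rule that[rotated 6])
    show "ball x e \<subseteq> S" using e(2) r(2) ball_subset_cball by blast
    show "?\<xi> holomorphic_on ball x e" using hol e(2) by (rule holomorphic_on_subset)
  qed (use e n in auto)
qed

text \<open>\<open>L w v\<close> says that \<open>v\<close> is an admissible value at
  \<open>w\<close>, such as a point over \<open>f w\<close> or a root of \<open>F w\<close>.
  Extensions of the initial germ are unique by the identity theorem and hence fit together to one of
  maximal radius \<open>R\<close>. If \<open>R < \<rho>\<close>, then \<open>ext\<close> continues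
  it across every boundary point, and these continuations fit together on a larger disc.\<close>

lemma disc_continuation:
  fixes L :: "complex \<Rightarrow> complex \<Rightarrow> bool" and y0 :: complex and \<rho> :: real
  assumes "0 < \<rho>"
    and start: "\<exists>e>0. e \<le> \<rho> \<and> (\<exists>h. h holomorphic_on ball 0 e \<and> h 0 = y0 \<and> (\<forall>w\<in>ball 0 e. L w (h w)))"
    and ext: "\<And>r h x. 0 < r \<Longrightarrow> r < \<rho> \<Longrightarrow> h holomorphic_on ball 0 r \<Longrightarrow> (\<forall>w\<in>ball 0 r. L w (h w))
      \<Longrightarrow> cmod x = r \<Longrightarrow> \<exists>e>0. \<exists>k. k holomorphic_on ball x e \<and> (\<forall>w\<in>ball x e. L w (k w)) \<and>
        (\<forall>w\<in>ball x e \<inter> ball 0 r. k w = h w)"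
  obtains h where "h holomorphic_on ball 0 \<rho>" "h 0 = y0" "\<And>w. w \<in> ball 0 \<rho> \<Longrightarrow> L w (h w)"
proof -
  obtain e0 h0 where e0: "0 < e0" "e0 \<le> \<rho>"
    and h0: "h0 holomorphic_on ball 0 e0" "h0 0 = y0" "\<And>w. w \<in> ball 0 e0 \<Longrightarrow> L w (h0 w)"
    using start by blast
  \<comment> \<open>Prescribing the germ \<open>h0\<close> on a fixed small disc is what makes
    extensions of different radii agree.\<close>
  define G where "G r h \<longleftrightarrow> e0 \<le> r \<and> r \<le> \<rho> \<and> h holomorphic_on ball 0 r \<and> (\<forall>w\<in>ball 0 r. L w (h w)) \<and>
    (\<forall>w\<in>ball 0 e0. h w = h0 w)" for r h
  have uniq: "h w = h' w" if "G r h" "G r' h'" "cmod w < r" "cmod w < r'" for r r' h h' w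
  proof (rule analytic_continuation_open[of "ball 0 e0" "ball 0 (min r r')" h h'])
    have G: "h holomorphic_on ball 0 r" "h' holomorphic_on ball 0 r'" "e0 \<le> r" "e0 \<le> r'"
      "\<forall>w\<in>ball 0 e0. h w = h0 w" "\<forall>w\<in>ball 0 e0. h' w = h0 w"
      using that(1,2) unfolding G_def by blast+
    show "h z = h' z" if "z \<in> ball 0 e0" for z
      using that G(5,6) by metis
    show "h holomorphic_on ball 0 (min r r')" "h' holomorphic_on ball 0 (min r r')"
      by (rule holomorphic_on_subset[OF G(1)], force) (rule holomorphic_on_subset[OF G(2)], force)
    show "ball 0 e0 \<subseteq> ball (0::complex) (min r r')" using G(3,4) by auto
  qed (use that(3,4) e0 in auto)
  define A where "A = {r. \<exists>h. G r h}"
  define H where "H r = (SOME h. G r h)" for r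
  have GH: "G r (H r)" if "r \<in> A" for r
    using that someI_ex[of "G r"] unfolding A_def H_def by blast
  have e0A: "e0 \<in> A" using e0 h0 by (auto simp: A_def G_def)
  have bdd: "bdd_above A" "\<And>r. r \<in> A \<Longrightarrow> r \<le> \<rho>" by (auto simp: A_def G_def bdd_above_def)
  define R where "R = Sup A"
  have R: "e0 \<le> R" "R \<le> \<rho>"
    unfolding R_def using e0A bdd by (auto intro: cSup_upper cSup_least)
  define rr where "rr w = (SOME r. r \<in> A \<and> cmod w < r)" for w
  have rr: "rr w \<in> A \<and> cmod w < rr w" if "cmod w < R" for w
  proof -
    have "\<exists>r. r \<in> A \<and> cmod w < r"
      using that less_cSup_iff[of A "cmod w"] bdd(1) e0A unfolding R_def by blast
    then show ?thesis unfolding rr_def by (rule someI_ex)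
  qed
  define hR where "hR w = H (rr w) w" for w
  have hR_eq: "hR w = H r w" if "r \<in> A" "cmod w < r" for r w
  proof -
    have "r \<le> R" using that bdd by (auto simp: R_def intro: cSup_upper)
    then show ?thesis
      unfolding hR_def by (intro uniq[OF GH GH]) (use rr[of w] that in auto)
  qed
  have GR: "G R hR"
    unfolding G_def
  proof (intro conjI ballI)
    show "hR holomorphic_on ball 0 R"
    proof (rule holomorphic_on_subset)
      show "hR holomorphic_on (\<Union>r\<in>A. ball 0 r)"
      proof (rule holomorphic_on_UN_open)
        show "hR holomorphic_on ball 0 r" if "r \<in> A" for r
        proof -
          have "hR holomorphic_on ball 0 r \<longleftrightarrow> H r holomorphic_on ball 0 r"
            by (rule holomorphic_cong[OF refl], rule hR_eq[OF that]) simp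
          then show ?thesis using GH[OF that] unfolding G_def by blast
        qed
      qed auto
      show "ball (0::complex) R \<subseteq> (\<Union>r\<in>A. ball 0 r)"
      proof
        fix w :: complex assume "w \<in> ball 0 R"
        then show "w \<in> (\<Union>r\<in>A. ball 0 r)" using rr[of w] by (intro UN_I[of "rr w"]) auto
      qed
    qed
    show "L w (hR w)" if "w \<in> ball 0 R" for w
    proof -
      have w: "rr w \<in> A" "w \<in> ball 0 (rr w)" using rr[of w] that by auto
      then show ?thesis using GH[OF w(1)] unfolding G_def hR_def by blast
    qed
    show "hR w = h0 w" if "w \<in> ball 0 e0" for w
    proof -
      have "hR w = H e0 w" using hR_eq[OF e0A, of w] that by simp
      then show ?thesis using GH[OF e0A] that unfolding G_def by metis
    qed
  qed (use R in auto)
  have "R = \<rho>"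
  proof (rule ccontr)
    assume "R \<noteq> \<rho>"
    then have "R < \<rho>" "0 < R" using R e0 by auto
    have "\<exists>e k. 0 < e \<and> k holomorphic_on ball x e \<and> (\<forall>w\<in>ball x e. L w (k w)) \<and>
        (\<forall>w\<in>ball x e \<inter> ball 0 R. k w = hR w)" if "cmod x = R" for x
      using ext[OF \<open>0 < R\<close> \<open>R < \<rho>\<close> _ _ that, of hR] GR unfolding G_def by blast
    then obtain e k where ek: "\<And>x. cmod x = R \<Longrightarrow> 0 < e x \<and> k x holomorphic_on ball x (e x) \<and>
        (\<forall>w\<in>ball x (e x). L w (k x w)) \<and> (\<forall>w\<in>ball x (e x) \<inter> ball 0 R. k x w = hR w)"
      by metis
    have agree: "k x w = k x' w" if x: "cmod x = R" "cmod x' = R" and w: "w \<in> ball x (e x)" "w \<in> ball x' (e x')" for x x' w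
    proof (cases "x = x'")
      case False
      let ?I = "ball x (e x) \<inter> ball x' (e x')"
      have d: "dist x x' < e x + e x'" "0 < e x" "0 < e x'"
        using w dist_triangle2[of x x' w] zero_le_dist[of x w] zero_le_dist[of x' w]
        unfolding mem_ball by linarith+
      \<comment> \<open>The point dividing the segment from \<open>x\<close> to \<open>x'\<close> in
        the ratio of the two radii lies in both discs, and strictly inside the circle by strict
        convexity. So the connected intersection of the discs meets \<open>ball 0 R\<close>, where
        both continuations equal \<open>hR\<close>.\<close>
      define t where "t = e x / (e x + e x')"
      let ?p = "x + t *\<^sub>R (x' - x)"
      have t: "0 < t" "t < 1" "t * (e x + e x') = e x" "(1 - t) * (e x + e x') = e x'"
        using d by (auto simp: t_def field_simps)
      have "?p \<in> open_segment x x'"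
        using t(1,2) False by (auto simp: in_segment algebra_simps intro!: exI[of _ t])
      then have "cmod ?p < R"
        using dist_decreases_open_segment[of ?p x x' 0] x by auto
      moreover have "dist x ?p < e x"
      proof -
        have "dist x ?p = t * dist x x'" using t(1) by (simp add: dist_norm norm_minus_commute)
        also have "\<dots> < t * (e x + e x')" using d t(1) by (intro mult_strict_left_mono) auto
        finally show ?thesis using t(3) by simp
      qed
      moreover have "dist x' ?p < e x'"
      proof -
        have "x' - ?p = (1 - t) *\<^sub>R (x' - x)" by (simp add: algebra_simps)
        then have "dist x' ?p = (1 - t) * dist x x'" using t(2) by (simp add: dist_norm norm_minus_commute)
        also have "\<dots> < (1 - t) * (e x + e x')" using d t(2) by (intro mult_strict_left_mono) auto
        finally show ?thesis using t(4) by simp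
      qed
      ultimately have ne: "?p \<in> ?I \<inter> ball 0 R" by simp
      show ?thesis
      proof (rule analytic_continuation_open[of "?I \<inter> ball 0 R" ?I "k x" "k x'"])
        show "connected ?I" by (intro convex_connected convex_Int convex_ball)
        show "k x z = k x' z" if "z \<in> ?I \<inter> ball 0 R" for z
        proof -
          have "k x z = hR z" "k x' z = hR z" using that ek[OF x(1)] ek[OF x(2)] by blast+
          then show ?thesis by simp
        qed
        show "k x holomorphic_on ?I" "k x' holomorphic_on ?I"
          by (rule holomorphic_on_subset[of _ "ball x (e x)"], use ek[OF x(1)] in blast, blast)
             (rule holomorphic_on_subset[of _ "ball x' (e x')"], use ek[OF x(2)] in blast, blast)
      qed (use ne w in auto)
    qed simp
    \<comment> \<open>An open neighbourhood of the closed disc of radius \<open>R\<close>; by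
      compactness it contains a concentric disc of larger radius.\<close>
    define S where "S = ball 0 R \<union> (\<Union>x\<in>sphere 0 R. ball x (e x))"
    define xx where "xx w = (SOME x. cmod x = R \<and> w \<in> ball x (e x))" for w
    define h' where "h' w = (if cmod w < R then hR w else k (xx w) w)" for w
    have h'k: "h' w = k x w" if "cmod x = R" "w \<in> ball x (e x)" for x w
    proof (cases "cmod w < R")
      case True
      then have "k x w = hR w" using ek[OF that(1)] that(2) by simp
      then show ?thesis using True by (simp add: h'_def)
    next
      case False
      have "cmod (xx w) = R \<and> w \<in> ball (xx w) (e (xx w))"
        unfolding xx_def by (rule someI[of _ x]) (use that in simp)
      then have "k (xx w) w = k x w" using agree[of "xx w" x w] that by blast
      then show ?thesis using False by (simp add: h'_def)
    qed
    have "S = (\<Union>B\<in>insert (ball 0 R) ((\<lambda>x. ball x (e x)) ` sphere 0 R). B)"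
      by (auto simp: S_def)
    moreover have "h' holomorphic_on (\<Union>B\<in>insert (ball 0 R) ((\<lambda>x. ball x (e x)) ` sphere 0 R). B)"
    proof (rule holomorphic_on_UN_open)
      fix B assume "B \<in> insert (ball 0 R) ((\<lambda>x. ball x (e x)) ` sphere 0 R)"
      then consider "B = ball 0 R" | x where "cmod x = R" "B = ball x (e x)" by auto
      then show "h' holomorphic_on B"
      proof cases
        case 1
        have "h' holomorphic_on ball 0 R \<longleftrightarrow> hR holomorphic_on ball 0 R"
          by (rule holomorphic_cong) (auto simp: h'_def)
        then show ?thesis using 1 GR unfolding G_def by blast
      next
        case 2
        have "h' holomorphic_on ball x (e x) \<longleftrightarrow> k x holomorphic_on ball x (e x)"
          by (rule holomorphic_cong[OF refl], rule h'k[OF 2(1)])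
        then show ?thesis using 2 ek[OF 2(1)] by simp
      qed
    qed auto
    ultimately have hol: "h' holomorphic_on S" by simp
    have LS: "L w (h' w)" if "w \<in> S" for w
    proof (cases "cmod w < R")
      case True
      then have "L w (hR w)" using GR unfolding G_def by simp
      then show ?thesis using True by (simp add: h'_def)
    next
      case False
      then obtain x where x: "cmod x = R" "w \<in> ball x (e x)" using \<open>w \<in> S\<close> by (auto simp: S_def)
      then show ?thesis using h'k[OF x] ek[OF x(1)] x(2) by simp
    qed
    have "open S" by (auto simp: S_def)
    have "cball 0 R \<subseteq> S"
    proof
      fix w :: complex assume "w \<in> cball 0 R"
      then show "w \<in> S"
        using ek[of w] by (cases "cmod w < R") (simp_all add: S_def, force)
    qed
    then obtain d where d: "0 < d" "(\<Union>x\<in>cball 0 R. ball x d) \<subseteq> S"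
      using compact_subset_open_imp_ball_epsilon_subset[OF compact_cball \<open>open S\<close>, of 0 R] by blast
    define R' where "R' = min \<rho> (R + d)"
    have R': "R < R'" "R' \<le> \<rho>" "R' \<le> R + d" using \<open>R < \<rho>\<close> d by (auto simp: R'_def)
    have sub: "ball 0 R' \<subseteq> S"
    proof
      fix w :: complex assume w: "w \<in> ball 0 R'"
      show "w \<in> S"
      proof (cases "cmod w \<le> R")
        case True
        then show ?thesis using \<open>cball 0 R \<subseteq> S\<close> by auto
      next
        case False
        let ?x = "complex_of_real (R / cmod w) * w"
        have pos: "0 < cmod w" using False \<open>0 < R\<close> by linarith
        have "cmod ?x = R" using pos \<open>0 < R\<close> by (simp add: norm_mult norm_divide)
        moreover have "dist ?x w < d"
        proof -
          have "?x - w = complex_of_real (R / cmod w - 1) * w" by (simp add: algebra_simps)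
          then have "dist ?x w = \<bar>R / cmod w - 1\<bar> * cmod w"
            by (simp only: dist_norm norm_mult norm_of_real)
          also have "\<dots> = cmod w - R" using pos False by (simp add: abs_if field_simps)
          finally show ?thesis using w R' by simp
        qed
        ultimately have "w \<in> (\<Union>x\<in>cball 0 R. ball x d)" by (intro UN_I[of ?x]) auto
        then show ?thesis using d by blast
      qed
    qed
    have "G R' h'"
      unfolding G_def
    proof (intro conjI ballI)
      show "h' w = h0 w" if "w \<in> ball 0 e0" for w
      proof -
        have "hR w = h0 w" using GR that unfolding G_def by blast
        then show ?thesis using that R(1) by (simp add: h'_def)
      qed
      show "h' holomorphic_on ball 0 R'" by (rule holomorphic_on_subset[OF hol sub])
      show "L w (h' w)" if "w \<in> ball 0 R'" for w using LS that sub by blast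
    qed (use R R' in auto)
    then have "R' \<le> R" unfolding R_def using bdd by (intro cSup_upper) (auto simp: A_def)
    with R' show False by simp
  qed
  show ?thesis
  proof (rule that[of hR])
    show "hR holomorphic_on ball 0 \<rho>" using GR \<open>R = \<rho>\<close> unfolding G_def by blast
    have "hR 0 = h0 0" using GR e0(1) unfolding G_def by simp
    then show "hR 0 = y0" using h0(2) by simp
  qed (use GR \<open>R = \<rho>\<close> in \<open>unfold G_def, blast\<close>)
qed

text \<open>\<open>F\<close> may have zeros, so there need not be a logarithm. On overlaps two local
  roots differ by a constant root of unity, which is absorbed into the local root, and
  \<open>disc_continuation\<close> applies.\<close>

lemma holomorphic_root_on_disc:
  fixes F :: "complex \<Rightarrow> complex"
  assumes "0 < m"
    and loc: "\<And>x. x \<in> ball 0 1 \<Longrightarrow> \<exists>e>0. \<exists>G. G holomorphic_on ball x e \<and> (\<forall>w\<in>ball x e. G w ^ m = F w)"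
  obtains g where "g holomorphic_on ball 0 1" "\<And>w. w \<in> ball 0 1 \<Longrightarrow> g w ^ m = F w"
proof -
  obtain e G where G: "0 < e" "G holomorphic_on ball 0 e" "\<And>w. w \<in> ball 0 e \<Longrightarrow> G w ^ m = F w"
    using loc[of 0] by auto
  show ?thesis
  proof (rule disc_continuation[of 1 "G 0" "\<lambda>w v. v ^ m = F w"])
    show "\<exists>e>0. e \<le> 1 \<and> (\<exists>h. h holomorphic_on ball 0 e \<and> h 0 = G 0 \<and> (\<forall>w\<in>ball 0 e. h w ^ m = F w))"
      using G by (intro exI[of _ "min 1 e"]) (auto intro!: exI[of _ G] intro: holomorphic_on_subset)
  next
    fix r :: real and h :: "complex \<Rightarrow> complex" and x :: complex
    assume r: "0 < r" "r < 1" and h: "h holomorphic_on ball 0 r" "\<forall>w\<in>ball 0 r. h w ^ m = F w" and x: "cmod x = r"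
    obtain e G where G: "0 < e" "G holomorphic_on ball x e" "\<And>w. w \<in> ball x e \<Longrightarrow> G w ^ m = F w"
      using loc[of x] x r by auto
    obtain \<omega> where \<omega>: "\<omega> ^ m = 1" "\<And>z. z \<in> ball x e \<inter> ball 0 r \<Longrightarrow> h z = \<omega> * G z"
    proof (rule equal_powers_imp_proportional[of "ball x e \<inter> ball 0 r" G h m])
      show "connected (ball x e \<inter> ball 0 r)" by (intro convex_connected convex_Int convex_ball)
    qed (use G h assms in \<open>auto intro: holomorphic_on_subset\<close>)
    show "\<exists>e>0. \<exists>k. k holomorphic_on ball x e \<and> (\<forall>w\<in>ball x e. k w ^ m = F w) \<and>
        (\<forall>w\<in>ball x e \<inter> ball 0 r. k w = h w)"
      using G \<omega> by (intro exI[of _ e] conjI exI[of _ "\<lambda>w. \<omega> * G w"])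
        (auto intro!: holomorphic_intros simp: power_mult_distrib)
  qed (use that in auto)
qed

text \<open>Convexity of \<open>sinh\<close> on the half-line together with
  \<open>sinh 0 = 0\<close>.\<close>

lemma sinh_scale_le:
  fixes t c :: real
  assumes "0 \<le> t" "0 \<le> c" "c \<le> 1"
  shows "sinh (c * t) \<le> c * sinh t"
proof -
  have "convex_on {0..} (sinh :: real \<Rightarrow> real)"
    by (rule f''_ge0_imp_convex[where f'=cosh and f''=sinh]) (auto intro!: derivative_eq_intros)
  from convex_onD[OF this, of c 0 t] assms show ?thesis by simp
qed

text \<open>In terms of \<open>s = - ln a\<close> the left-hand side is \<open>m sinh s / sinh (m s)\<close>, which decreases in \<open>m\<close>.\<close>

lemma power_root_bound:
  fixes a :: real
  assumes a: "0 < a" "a < 1" and m: "2 \<le> m"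
  shows "real m * a ^ (m - 1) * (1 - a\<^sup>2) / (1 - (a ^ m)\<^sup>2) \<le> 2 * sqrt (a ^ m) / (1 + a ^ m)"
proof -
  define s where "s = - ln a"
  have s: "0 < s" using a by (simp add: s_def)
  have ea: "exp (- s) = a" "exp s = 1 / a" using a by (auto simp: s_def exp_minus field_simps)
  let ?T = "real m * s"
  have eT: "exp (- ?T) = a ^ m"
  proof -
    have "exp (- ?T) = exp (real m * (- s))" by (simp only: mult_minus_right)
    also have "\<dots> = exp (- s) ^ m" by (rule exp_of_nat_mult)
    finally show ?thesis by (simp only: ea)
  qed
  have eT2: "exp (- ?T / 2) = sqrt (a ^ m)"
  proof -
    have "2 * (- ?T / 2) = - ?T" by simp
    then have "(exp (- ?T / 2))\<^sup>2 = a ^ m" using exp_double[of "- ?T / 2"] eT by metis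
    then show ?thesis by (metis exp_ge_zero real_sqrt_unique)
  qed
  have mpos: "0 < real m" using m by simp
  have am: "0 < a ^ m" "a ^ m < 1" using a m by (auto simp: power_less_one_iff)
  \<comment> \<open>With \<open>?T / 2 = m s / 2\<close> and the factor
    \<open>2 / m \<le> 1\<close>, convexity compares the exponent \<open>m\<close> with the exponent
    2, for which the claimed bound is an equality.\<close>
  have "sinh s \<le> 2 / real m * sinh (?T / 2)"
    using sinh_scale_le[of "?T/2" "2 / real m"] s m by (simp add: field_simps)
  then have main: "real m * sinh s \<le> 2 * sinh (?T / 2)"
    using mpos by (simp add: field_simps)
  have "sinh s = (1 - a\<^sup>2) / (2 * a)"
    using a by (simp add: sinh_field_def ea field_simps power2_eq_square)
  then have lhs: "real m * a ^ (m - 1) * (1 - a\<^sup>2) = 2 * a ^ m * (real m * sinh s)"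
  proof -
    assume "sinh s = (1 - a\<^sup>2) / (2 * a)"
    then have s1: "1 - a\<^sup>2 = 2 * a * sinh s" using a by (simp add: field_simps)
    have s2: "a ^ m = a ^ (m - 1) * a" using m by (cases m) auto
    show ?thesis unfolding s1 s2 by (simp add: mult_ac)
  qed
  define q where "q = sqrt (a ^ m)"
  have q: "0 < q" "q\<^sup>2 = a ^ m" "q < 1" using am by (auto simp: q_def real_sqrt_lt_1_iff)
  have "sinh (?T / 2) = (1 / q - q) / 2"
    using eT2 exp_minus[of "- ?T / 2"] by (simp add: sinh_field_def q_def inverse_eq_divide)
  then have rhs: "2 * a ^ m * (2 * sinh (?T / 2)) = 2 * q * (1 - q\<^sup>2)"
  proof -
    assume sq: "sinh (?T / 2) = (1 / q - q) / 2"
    have "2 * q\<^sup>2 * (2 * ((1 / q - q) / 2)) = 2 * q * (1 - q\<^sup>2)"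
      using q(1) by (simp add: field_simps power2_eq_square)
    then show ?thesis by (simp only: sq q(2))
  qed
  have "real m * a ^ (m - 1) * (1 - a\<^sup>2) \<le> 2 * q * (1 - q\<^sup>2)"
    unfolding lhs rhs[symmetric] using main am by (intro mult_left_mono) auto
  then have "real m * a ^ (m - 1) * (1 - a\<^sup>2) / (1 - (a ^ m)\<^sup>2) \<le> 2 * q * (1 - q\<^sup>2) / (1 - (a ^ m)\<^sup>2)"
    using am by (intro divide_right_mono) (auto simp: power_le_one)
  also have "\<dots> = 2 * q / (1 + a ^ m)"
  proof -
    have "1 - (a ^ m)\<^sup>2 = (1 - q\<^sup>2) * (1 + a ^ m)" using q by (simp add: power2_eq_square algebra_simps)
    then show ?thesis using q am by simp
  qed
  finally show ?thesis by (simp add: q_def)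
qed

text \<open>The hypothesis \<open>loc\<close> provides \<open>g\<close> with \<open>g^m\<close>
  equal to the Moebius transform of \<open>h\<close>. Differentiation at \<open>0\<close>, where
  \<open>|g 0|^m = |y|\<close>, and Schwarz-Pick for \<open>g\<close> leave exactly the expression
  in \<open>power_root_bound\<close>; its bound depends on \<open>|y|\<close> alone and no longer on
  \<open>m\<close>.\<close>

lemma ramified_Schwarz:
  assumes h: "h holomorphic_on ball 0 1" "h \<in> ball 0 1 \<rightarrow> ball 0 1" "h 0 = 0"
    and y: "cmod y < 1" "y \<noteq> 0" and m: "2 \<le> m"
    and loc: "\<And>x. x \<in> ball 0 1 \<Longrightarrow>
      \<exists>e>0. \<exists>G. G holomorphic_on ball x e \<and> (\<forall>w\<in>ball x e. G w ^ m = Moebius_function 0 y (h w))"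
  shows "cmod (deriv h 0) \<le> 2 * sqrt (cmod y) / (1 + cmod y)"
proof -
  have m0: "0 < m" using m by simp
  obtain g where g: "g holomorphic_on ball 0 1" "\<And>w. w \<in> ball 0 1 \<Longrightarrow> g w ^ m = Moebius_function 0 y (h w)"
    using holomorphic_root_on_disc[OF m0 loc] by blast
  have "cmod (g w) < 1" if "w \<in> ball 0 1" for w
  proof -
    have "cmod (Moebius_function 0 y (h w)) < 1"
      using h(2) that y by (intro Moebius_function_norm_lt_1) auto
    then have "cmod (g w ^ m) < 1" by (simp only: g(2)[OF that])
    then show ?thesis using one_le_power[of "cmod (g w)" m] by (fastforce simp: norm_power)
  qed
  then have g01: "g \<in> ball 0 1 \<rightarrow> ball 0 1" by auto
  define a where "a = cmod (g 0)"
  have am: "a ^ m = cmod y"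
    using g(2)[of 0] h(3) by (simp add: a_def Moebius_function_simple flip: norm_power)
  have a: "0 < a" "a < 1"
  proof -
    have "a \<noteq> 0" using am y(2) m by (auto simp: zero_power)
    then show "0 < a" by (simp add: a_def)
    show "a < 1" using g01 by (auto simp: a_def)
  qed
  have dg: "cmod (deriv g 0) \<le> 1 - a\<^sup>2"
    using Schwarz_Pick[OF g(1) g01, of 0] by (simp add: a_def)
  have "(g has_field_derivative deriv g 0) (at 0)"
    using g(1) by (intro holomorphic_derivI) auto
  then have "((\<lambda>w. g w ^ m) has_field_derivative (of_nat m * g 0 ^ (m - 1) * deriv g 0)) (at 0)"
    by (auto intro!: derivative_eq_intros)
  moreover have "(h has_field_derivative deriv h 0) (at 0)"
    using h(1) by (intro holomorphic_derivI) auto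
  then have "((\<lambda>w. Moebius_function 0 y (h w)) has_field_derivative (1 - (cmod y)\<^sup>2) / (1 - cnj y * h 0)\<^sup>2 * deriv h 0) (at 0)"
    using Moebius_has_field_derivative[of y "h 0"] y h(3) by (intro DERIV_chain2) auto
  then have "((\<lambda>w. g w ^ m) has_field_derivative (1 - (cmod y)\<^sup>2) / (1 - cnj y * h 0)\<^sup>2 * deriv h 0) (at 0)"
    by (rule has_field_derivative_transform_within_open[of _ _ _ "ball 0 1"]) (use g(2) in auto)
  ultimately have "of_nat m * g 0 ^ (m - 1) * deriv g 0 = complex_of_real (1 - (cmod y)\<^sup>2) * deriv h 0"
    using h(3) by (auto dest: DERIV_unique)
  then have "cmod (of_nat m * g 0 ^ (m - 1) * deriv g 0) = \<bar>1 - (cmod y)\<^sup>2\<bar> * cmod (deriv h 0)"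
    by (simp only: norm_mult norm_of_real)
  moreover have "\<bar>1 - (cmod y)\<^sup>2\<bar> = 1 - (cmod y)\<^sup>2" "0 < 1 - (cmod y)\<^sup>2"
    using y by (auto simp: abs_square_less_1 abs_square_le_1)
  ultimately have "cmod (deriv h 0) = real m * a ^ (m - 1) * cmod (deriv g 0) / (1 - (cmod y)\<^sup>2)"
    by (simp add: norm_mult norm_power a_def field_simps)
  also have "\<dots> \<le> real m * a ^ (m - 1) * (1 - a\<^sup>2) / (1 - (cmod y)\<^sup>2)"
    using dg a y by (intro divide_right_mono mult_left_mono) (auto simp: abs_square_le_1)
  also have "\<dots> \<le> 2 * sqrt (cmod y) / (1 + cmod y)"
    using power_root_bound[OF a m] by (simp add: am)
  finally show ?thesis .
qed


section \<open>Lifting through branched coverings\<close>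

text \<open>The properties of an orbifold covering by the disc on which everything below rests, in
  the charts of \<open>X\<close> even when the covered orbifold lives on a smaller surface:
  continuity, a normal form in which \<pi> is the \<open>\<nu>\<close>-th power of a local
  coordinate, and a substitute for properness. The latter says that connected sets over a small
  neighbourhood stay away from the unit circle, which prevents lifts from escaping there.\<close>

definition disc_cover :: "('a, 'm) surface_scheme \<Rightarrow> ('a \<Rightarrow> nat) \<Rightarrow> (complex \<Rightarrow> 'a) \<Rightarrow> bool" where
  "disc_cover X \<nu> \<pi> \<longleftrightarrow>
     continuous_map (top_of_set (ball 0 1)) (topol X) \<pi> \<and>
     (\<forall>x\<in>ball 0 1. \<forall>(V, \<phi>)\<in>charts X. \<pi> x \<in> V \<longrightarrow> 0 < \<nu> (\<pi> x) \<and>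
        (\<exists>e>0. \<exists>\<xi>. ball x e \<subseteq> ball 0 1 \<and> \<pi> ` ball x e \<subseteq> V \<and> \<xi> holomorphic_on ball x e \<and>
           inj_on \<xi> (ball x e) \<and> \<xi> x = 0 \<and> (\<forall>w\<in>ball x e. \<phi> (\<pi> w) = \<phi> (\<pi> x) + \<xi> w ^ \<nu> (\<pi> x)))) \<and>
     (\<forall>p\<in>\<pi> ` ball 0 1. \<exists>U. openin (topol X) U \<and> p \<in> U \<and>
        (\<forall>A. connected A \<longrightarrow> A \<subseteq> ball 0 1 \<longrightarrow> \<pi> ` A \<subseteq> U \<longrightarrow> (\<exists>r<1. A \<subseteq> cball 0 r)))"

lemma open_preimage_ball:
  assumes "continuous_map (top_of_set (ball c r)) T f" "openin T W"
  shows "open {x \<in> ball c r. f x \<in> W}"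
  using openin_continuous_map_preimage[OF assms]
  by (simp add: openin_open_eq)

lemma ball_in_preimage:
  assumes "continuous_map (top_of_set (ball c r)) T f" "openin T W" "x \<in> ball c r" "f x \<in> W"
  obtains e where "0 < e" "ball x e \<subseteq> ball c r" "f ` ball x e \<subseteq> W"
proof -
  obtain e where "0 < e" "ball x e \<subseteq> {x \<in> ball c r. f x \<in> W}"
    using open_preimage_ball[OF assms(1,2)] assms(3,4) open_contains_ball by blast
  then show ?thesis using that by blast
qed

lemma chart_inj:
  assumes "riemann_surface X" "(V, \<phi>) \<in> charts X"
  shows "openin (topol X) V" "inj_on \<phi> V" "open (\<phi> ` V)"
    "homeomorphic_map (subtopology (topol X) V) (top_of_set (\<phi> ` V)) \<phi>"
proof -
  show V: "openin (topol X) V" and "open (\<phi> ` V)"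
    and h: "homeomorphic_map (subtopology (topol X) V) (top_of_set (\<phi> ` V)) \<phi>"
    using assms unfolding riemann_surface_def by blast+
  have "V \<subseteq> points X" using V by (rule openin_subset)
  then show "inj_on \<phi> V"
    using homeomorphic_imp_injective_map[OF h] by (simp add: Int_absorb1)
qed

lemma chart_at:
  assumes "riemann_surface X" "p \<in> points X"
  obtains V \<phi> where "(V, \<phi>) \<in> charts X" "p \<in> V"
  using assms unfolding riemann_surface_def by blast

lemma surface_Hausdorff: "riemann_surface X \<Longrightarrow> Hausdorff_space (topol X)"
  by (simp add: riemann_surface_def)

lemma disc_coverD:
  assumes "disc_cover X \<nu> \<pi>"
  shows "continuous_map (top_of_set (ball 0 1)) (topol X) \<pi>"
    "\<And>x. x \<in> ball 0 1 \<Longrightarrow> \<pi> x \<in> points X"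
proof -
  show c: "continuous_map (top_of_set (ball 0 1)) (topol X) \<pi>"
    using assms by (simp add: disc_cover_def)
  show "\<And>x. x \<in> ball 0 1 \<Longrightarrow> \<pi> x \<in> points X"
    using continuous_map_funspace[OF c] by auto
qed

lemma disc_cover_normal_form:
  assumes "disc_cover X \<nu> \<pi>" "x \<in> ball 0 1" "(V, \<phi>) \<in> charts X" "\<pi> x \<in> V"
  obtains e \<xi> where "0 < \<nu> (\<pi> x)" "0 < e" "ball x e \<subseteq> ball 0 1" "\<pi> ` ball x e \<subseteq> V"
    "\<xi> holomorphic_on ball x e" "inj_on \<xi> (ball x e)" "\<xi> x = 0"
    "\<forall>w\<in>ball x e. \<phi> (\<pi> w) = \<phi> (\<pi> x) + \<xi> w ^ \<nu> (\<pi> x)"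
proof -
  have "0 < \<nu> (\<pi> x) \<and> (\<exists>e>0. \<exists>\<xi>. ball x e \<subseteq> ball 0 1 \<and> \<pi> ` ball x e \<subseteq> V \<and> \<xi> holomorphic_on ball x e \<and>
      inj_on \<xi> (ball x e) \<and> \<xi> x = 0 \<and> (\<forall>w\<in>ball x e. \<phi> (\<pi> w) = \<phi> (\<pi> x) + \<xi> w ^ \<nu> (\<pi> x)))"
    using assms(1)[unfolded disc_cover_def, THEN conjunct2, THEN conjunct1, rule_format, OF assms(2,3)] assms(4)
    by simp
  then show ?thesis by (elim exE conjE) (rule that)
qed

lemma disc_cover_bounded_lifts:
  assumes "disc_cover X \<nu> \<pi>" "p \<in> \<pi> ` ball 0 1"
  obtains U where "openin (topol X) U" "p \<in> U"
    "\<forall>A. connected A \<longrightarrow> A \<subseteq> ball 0 1 \<longrightarrow> \<pi> ` A \<subseteq> U \<longrightarrow> (\<exists>r<1. A \<subseteq> cball 0 r)"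
proof -
  have "\<exists>U. openin (topol X) U \<and> p \<in> U \<and>
      (\<forall>A. connected A \<longrightarrow> A \<subseteq> ball 0 1 \<longrightarrow> \<pi> ` A \<subseteq> U \<longrightarrow> (\<exists>r<1. A \<subseteq> cball 0 r))"
    using assms unfolding disc_cover_def by (elim conjE) (rule bspec)
  then obtain U where "openin (topol X) U" "p \<in> U"
      "\<forall>A. connected A \<longrightarrow> A \<subseteq> ball 0 1 \<longrightarrow> \<pi> ` A \<subseteq> U \<longrightarrow> (\<exists>r<1. A \<subseteq> cball 0 r)"
    by (elim exE conjE)
  then show ?thesis by (rule that)
qed

text \<open>The hypothesis \<open>power\<close> excludes the local obstruction at ramified points:
  in a chart, \<open>f\<close> minus its value at \<open>x\<close> must be a
  \<open>\<nu> (f x)\<close>-th power. The radius \<open>s\<close> is kept general, as the lift for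
  the upper bound exists only on a smaller disc.\<close>

locale lifting_problem =
  fixes X :: "('a, 'm) surface_scheme" and \<nu> :: "'a \<Rightarrow> nat" and \<pi> f :: "complex \<Rightarrow> 'a" and s :: real
  assumes X: "riemann_surface X" and cover: "disc_cover X \<nu> \<pi>" and s: "0 < s"
    and f: "continuous_map (top_of_set (ball 0 s)) (topol X) f" "f ` ball 0 s \<subseteq> \<pi> ` ball 0 1"
    and power: "\<And>x. x \<in> ball 0 s \<Longrightarrow> \<exists>V \<phi> e G. (V, \<phi>) \<in> charts X \<and> f x \<in> V \<and> 0 < e \<and>
      ball x e \<subseteq> ball 0 s \<and> f ` ball x e \<subseteq> V \<and> G holomorphic_on ball x e \<and>
      (\<forall>w\<in>ball x e. \<phi> (f w) = \<phi> (f x) + G w ^ \<nu> (f x))"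
begin

definition lift_at :: "complex \<Rightarrow> complex \<Rightarrow> bool" where
  "lift_at w v \<longleftrightarrow> v \<in> ball 0 1 \<and> \<pi> v = f w"

text \<open>
  In local coordinates lifting \<open>f\<close> through \<open>\<pi>\<close> means solving \<open>\<xi> (h w) ^ n = G w ^ n\<close>, so that the
  local lifts near a point over \<open>f x\<close> are exactly the maps \<open>\<xi>\<inverse> (\<omega> G w)\<close> with \<open>\<omega> ^ n = 1\<close>.
\<close>

lemma local_lift:
  assumes x: "x \<in> ball 0 s" and q: "lift_at x q"
  obtains d e where "0 < d" "cball q d \<subseteq> ball 0 1" "\<forall>w\<in>cball q d. \<pi> w = f x \<longrightarrow> w = q"
    "0 < e" "ball x e \<subseteq> ball 0 s"
    "\<exists>k. k holomorphic_on ball x e \<and> k x = q \<and> (\<forall>w\<in>ball x e. lift_at w (k w))"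
    "\<forall>S h. open S \<longrightarrow> connected S \<longrightarrow> S \<subseteq> ball x e \<longrightarrow> h holomorphic_on S \<longrightarrow> h ` S \<subseteq> ball q d \<longrightarrow>
      (\<forall>w\<in>S. lift_at w (h w)) \<longrightarrow>
      (\<exists>k. k holomorphic_on ball x e \<and> (\<forall>w\<in>ball x e. lift_at w (k w)) \<and> (\<forall>w\<in>S. k w = h w))"
proof -
  have q1: "q \<in> ball 0 1" and \<pi>q: "\<pi> q = f x" using q by (auto simp: lift_at_def)
  obtain V \<phi> e1 G where V: "(V, \<phi>) \<in> charts X" "f x \<in> V" and e1: "0 < e1" "ball x e1 \<subseteq> ball 0 s"
    "f ` ball x e1 \<subseteq> V" and G: "G holomorphic_on ball x e1"
    and fG': "\<forall>w\<in>ball x e1. \<phi> (f w) = \<phi> (f x) + G w ^ \<nu> (f x)"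
    using power[OF x] by (elim exE conjE) (rule that)
  note fG = bspec[OF fG']
  note inj = chart_inj(2)[OF X V(1)]
  have \<pi>V: "\<pi> q \<in> V" using \<pi>q V by simp
  obtain e2 \<xi> where n: "0 < \<nu> (\<pi> q)" and e2: "0 < e2" "ball q e2 \<subseteq> ball 0 1" "\<pi> ` ball q e2 \<subseteq> V"
    and \<xi>: "\<xi> holomorphic_on ball q e2" "inj_on \<xi> (ball q e2)" "\<xi> q = 0"
    and \<pi>\<xi>': "\<forall>w\<in>ball q e2. \<phi> (\<pi> w) = \<phi> (\<pi> q) + \<xi> w ^ \<nu> (\<pi> q)"
    by (rule disc_cover_normal_form[OF cover q1 V(1) \<pi>V]) (rule that)
  note \<pi>\<xi> = bspec[OF \<pi>\<xi>']
  define n where "n = \<nu> (f x)"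
  have n0: "0 < n" using n \<pi>q by (simp add: n_def)
  obtain g where g: "g holomorphic_on \<xi> ` ball q e2" "\<And>z. z \<in> ball q e2 \<Longrightarrow> g (\<xi> z) = z"
    using holomorphic_has_inverse[OF \<xi>(1) open_ball \<xi>(2)] by metis
  have op: "open (\<xi> ` ball q e2)" by (rule open_mapping_thm3[OF \<xi>(1) open_ball \<xi>(2)])
  have "0 \<in> \<xi> ` ball q e2" using \<xi>(3) e2(1) by (metis centre_in_ball imageI)
  then obtain d2 where d2: "0 < d2" "ball 0 d2 \<subseteq> \<xi> ` ball q e2"
    using op open_contains_ball by blast
  have "G x ^ n = 0" using fG[of x] e1(1) by (simp add: n_def)
  then have Gx: "G x = 0" by simp
  have "continuous_on (ball x e1) G" using G by (rule holomorphic_on_imp_continuous_on)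
  then have "open (ball x e1 \<inter> G -` ball 0 d2)" by (intro continuous_open_preimage) auto
  moreover have "x \<in> ball x e1 \<inter> G -` ball 0 d2" using Gx e1 d2 by auto
  ultimately obtain e where e: "0 < e" "ball x e \<subseteq> ball x e1 \<inter> G -` ball 0 d2"
    using open_contains_ball by blast
  \<comment> \<open>All local lifts at once, one for each root of unity. Since
    \<open>\<omega>\<close> has modulus 1, the smallness of \<open>G\<close> on
    \<open>ball x e\<close> keeps \<open>\<omega> * G w\<close> in the domain of the local inverse
    \<open>g\<close> of \<open>\<xi>\<close>.\<close>
  define K where "K \<omega> w = g (\<omega> * G w)" for \<omega> w
  have \<omega>G: "\<omega> * G w \<in> \<xi> ` ball q e2" if "\<omega> ^ n = 1" "w \<in> ball x e" for \<omega> w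
  proof -
    have "cmod \<omega> ^ n = 1" using that(1) by (simp flip: norm_power)
    then have "cmod \<omega> = 1" using n0 power_eq_imp_eq_base[of "cmod \<omega>" n 1] by simp
    moreover have "cmod (G w) < d2" using e(2) that(2) by auto
    ultimately have "\<omega> * G w \<in> ball 0 d2" by (simp add: norm_mult)
    then show ?thesis using d2(2) by blast
  qed
  have Khol: "K \<omega> holomorphic_on ball x e" if "\<omega> ^ n = 1" for \<omega>
  proof -
    have "(\<lambda>w. \<omega> * G w) holomorphic_on ball x e"
      using e(2) by (intro holomorphic_intros holomorphic_on_subset[OF G]) auto
    then have "g \<circ> (\<lambda>w. \<omega> * G w) holomorphic_on ball x e"
      by (rule holomorphic_on_compose_gen[OF _ g(1)]) (use \<omega>G[OF that] in blast)
    then show ?thesis by (simp add: K_def[abs_def] o_def)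
  qed
  have Klift: "lift_at w (K \<omega> w)" if \<omega>: "\<omega> ^ n = 1" and w: "w \<in> ball x e" for \<omega> w
  proof -
    obtain z where z: "z \<in> ball q e2" "\<omega> * G w = \<xi> z" using \<omega>G[OF \<omega> w] by blast
    have Kz: "K \<omega> w = z" unfolding K_def z(2) by (rule g(2)[OF z(1)])
    have w1: "w \<in> ball x e1" using e(2) w by blast
    have "\<phi> (\<pi> z) = \<phi> (f x) + (\<omega> * G w) ^ n" using \<pi>\<xi>[OF z(1)] \<pi>q z(2) by (simp add: n_def)
    also have "\<dots> = \<phi> (f w)" using fG[OF w1] \<omega> by (simp add: n_def power_mult_distrib)
    finally have "\<phi> (\<pi> z) = \<phi> (f w)" .
    moreover have "\<pi> z \<in> V" "f w \<in> V" using e2(3) z(1) e1(3) w1 by blast+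
    ultimately have "\<pi> z = f w" using inj by (meson inj_onD)
    then show ?thesis using Kz z(1) e2(2) by (auto simp: lift_at_def)
  qed
  \<comment> \<open>Half the radius, so that the closed disc, including its boundary circle, lies
    where \<open>\<xi>\<close> is injective and \<open>q\<close> is the only point over
    \<open>f x\<close>.\<close>
  define d where "d = e2 / 2"
  have d: "0 < d" "cball q d \<subseteq> ball q e2" using e2(1) by (auto simp: d_def)
  show ?thesis
  proof (rule that[of d e])
    show "0 < d" "cball q d \<subseteq> ball 0 1" using d e2(2) by auto
    show "\<forall>w\<in>cball q d. \<pi> w = f x \<longrightarrow> w = q"
    proof (intro ballI impI)
      fix w assume that: "w \<in> cball q d" "\<pi> w = f x"
      have w: "w \<in> ball q e2" using that d by blast
      have "\<xi> w ^ \<nu> (\<pi> q) = 0" using \<pi>\<xi>[OF w] that(2) \<pi>q by simp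
      then have "\<xi> w = \<xi> q" using \<xi>(3) by simp
      then show "w = q" using \<xi>(2) w e2(1) by (meson centre_in_ball inj_onD)
    qed
    show "0 < e" "ball x e \<subseteq> ball 0 s" using e e1 by auto
    have "K 1 x = q" using g(2)[of q] e2(1) \<xi>(3) by (simp add: K_def Gx)
    then show "\<exists>k. k holomorphic_on ball x e \<and> k x = q \<and> (\<forall>w\<in>ball x e. lift_at w (k w))"
      using Khol[of 1] Klift[of 1] by (intro exI[of _ "K 1"]) auto
  next
    show "\<forall>S h. open S \<longrightarrow> connected S \<longrightarrow> S \<subseteq> ball x e \<longrightarrow> h holomorphic_on S \<longrightarrow> h ` S \<subseteq> ball q d \<longrightarrow>
      (\<forall>w\<in>S. lift_at w (h w)) \<longrightarrow>
      (\<exists>k. k holomorphic_on ball x e \<and> (\<forall>w\<in>ball x e. lift_at w (k w)) \<and> (\<forall>w\<in>S. k w = h w))"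
    proof (intro allI impI)
    fix S h
    assume S: "open S" "connected S" "S \<subseteq> ball x e" and h: "h holomorphic_on S" "h ` S \<subseteq> ball q d"
      "\<forall>w\<in>S. lift_at w (h w)"
    have hB: "h w \<in> ball q e2" if "w \<in> S" for w
    proof -
      have "h w \<in> ball q d" using h(2) that by blast
      then show ?thesis using d(2) ball_subset_cball by blast
    qed
    have \<xi>h: "\<xi> \<circ> h holomorphic_on S"
      by (rule holomorphic_on_compose_gen[OF h(1) \<xi>(1)]) (use hB in blast)
    have GS: "G holomorphic_on S" by (rule holomorphic_on_subset[OF G]) (use S(3) e(2) in blast)
    have eq: "(\<xi> \<circ> h) z ^ n = G z ^ n" if z: "z \<in> S" for z
    proof -
      have z1: "z \<in> ball x e1" using z S(3) e(2) by blast
      have "\<pi> (h z) = f z" using h(3) z by (simp add: lift_at_def)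
      then show ?thesis
        using \<pi>\<xi>[OF hB[OF z]] fG[OF z1] \<pi>q by (simp add: n_def)
    qed
    obtain \<omega> where \<omega>: "\<omega> ^ n = 1" "\<And>z. z \<in> S \<Longrightarrow> (\<xi> \<circ> h) z = \<omega> * G z"
        using equal_powers_imp_proportional[OF S(1,2) GS \<xi>h n0 eq] by blast
    have "K \<omega> w = h w" if "w \<in> S" for w
      using \<omega>(2)[OF that] g(2)[OF hB[OF that]] by (simp add: K_def)
    then show "\<exists>k. k holomorphic_on ball x e \<and> (\<forall>w\<in>ball x e. lift_at w (k w)) \<and> (\<forall>w\<in>S. k w = h w)"
      using Khol[OF \<omega>(1)] Klift[OF \<omega>(1)] by blast
    qed
  qed
qed

text \<open>By the substitute for properness, \<open>h\<close> stays in a compact subdisc near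
  \<open>x\<close>, so it has a cluster value \<open>q\<close> at \<open>x\<close>, and
  \<open>q\<close> lies over \<open>f x\<close>. Near \<open>x\<close> all values of
  \<open>h\<close> turn out to lie close to \<open>q\<close>, where \<open>local_lift\<close>
  recognises \<open>h\<close> as the restriction of a lift defined around \<open>x\<close>.\<close>

lemma boundary_lift:
  assumes r: "0 < r" "r < s" and h: "h holomorphic_on ball 0 r" "\<forall>w\<in>ball 0 r. lift_at w (h w)"
    and x: "cmod x = r"
  shows "\<exists>e>0. \<exists>k. k holomorphic_on ball x e \<and> (\<forall>w\<in>ball x e. lift_at w (k w)) \<and>
    (\<forall>w\<in>ball x e \<inter> ball 0 r. k w = h w)"
proof -
  have xs: "x \<in> ball 0 s" using x r by simp
  have fx: "f x \<in> \<pi> ` ball 0 1" using f(2) xs by blast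
  obtain U where U: "openin (topol X) U" "f x \<in> U"
    "\<forall>A. connected A \<longrightarrow> A \<subseteq> ball 0 1 \<longrightarrow> \<pi> ` A \<subseteq> U \<longrightarrow> (\<exists>r<1. A \<subseteq> cball 0 r)"
    by (rule disc_cover_bounded_lifts[OF cover fx]) (rule that)
  obtain e2 where e2: "0 < e2" "ball x e2 \<subseteq> ball 0 s" "f ` ball x e2 \<subseteq> U"
    by (rule ball_in_preimage[OF f(1) U(1) xs U(2)])
  have conn: "connected (ball x a \<inter> ball 0 r)" for a
    by (intro convex_connected convex_Int convex_ball)
  have hc: "continuous_on (ball 0 r) h" using h(1) by (rule holomorphic_on_imp_continuous_on)
  have hconn: "connected (h ` (ball x a \<inter> ball 0 r))" for a
    by (rule connected_continuous_image[OF continuous_on_subset[OF hc] conn]) auto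
  have "\<exists>r1<1. h ` (ball x e2 \<inter> ball 0 r) \<subseteq> cball 0 r1"
  proof (rule U(3)[rule_format, OF hconn])
    show "h ` (ball x e2 \<inter> ball 0 r) \<subseteq> ball 0 1" using h(2) by (auto simp: lift_at_def)
    show "\<pi> ` h ` (ball x e2 \<inter> ball 0 r) \<subseteq> U"
    proof clarify
      fix w assume w: "w \<in> ball x e2" "w \<in> ball 0 r"
      have "\<pi> (h w) = f w" using h(2) w(2) by (simp add: lift_at_def)
      then show "\<pi> (h w) \<in> U" using e2(3) w(1) by auto
    qed
  qed
  then obtain r1 where r1: "r1 < 1" "h ` (ball x e2 \<inter> ball 0 r) \<subseteq> cball 0 r1" by blast
  \<comment> \<open>Points on the radius that tend to \<open>x\<close> from inside; compactness of
    the closed subdisc provides the cluster point \<open>q\<close> of their images.\<close>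
  define wn where "wn n = (1 - inverse (real (Suc n))) *\<^sub>R x" for n
  have wn_r: "wn n \<in> ball 0 r" for n
  proof -
    have "\<bar>1 - inverse (real (Suc n))\<bar> < 1" by (auto simp: inverse_eq_divide abs_if divide_le_eq_1)
    then have "\<bar>1 - inverse (real (Suc n))\<bar> * r < 1 * r" using r by (intro mult_strict_right_mono) auto
    then show ?thesis using x by (simp add: wn_def)
  qed
  have "(\<lambda>n. (1 - inverse (real (Suc n))) *\<^sub>R x) \<longlonglongrightarrow> (1 - 0) *\<^sub>R x"
    by (intro tendsto_intros LIMSEQ_inverse_real_of_nat)
  then have wn_lim: "wn \<longlonglongrightarrow> x" by (simp add: wn_def[abs_def])
  have ev: "\<forall>\<^sub>F n in sequentially. wn n \<in> ball x a" if "0 < a" for a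
    using tendstoD[OF wn_lim that] by (simp add: dist_commute)
  obtain N where N: "\<And>n. N \<le> n \<Longrightarrow> wn n \<in> ball x e2"
    using ev[OF e2(1)] unfolding eventually_sequentially by blast
  have "\<forall>n. h (wn (n + N)) \<in> cball 0 r1"
  proof
    fix n
    have "wn (n + N) \<in> ball x e2 \<inter> ball 0 r" using N[of "n + N"] wn_r[of "n + N"] by simp
    then show "h (wn (n + N)) \<in> cball 0 r1" using r1(2) by blast
  qed
  then obtain q \<sigma> where q: "q \<in> cball 0 r1" "strict_mono \<sigma>" "((\<lambda>n. h (wn (n + N))) \<circ> \<sigma>) \<longlonglongrightarrow> q"
    using compact_cball[of "0::complex" r1, unfolded compact_def, rule_format, of "\<lambda>n. h (wn (n + N))"] by blast
  have q1: "q \<in> ball 0 1" using q(1) r1(1) by auto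
  define un where "un n = wn (\<sigma> n + N)" for n
  have un_r: "un n \<in> ball 0 r" for n using wn_r[of "\<sigma> n + N"] by (simp only: un_def)
  have un_lim: "un \<longlonglongrightarrow> x"
  proof -
    have "strict_mono (\<lambda>n. \<sigma> n + N)" using q(2) by (simp add: strict_mono_def)
    from LIMSEQ_subseq_LIMSEQ[OF wn_lim this] show ?thesis by (simp add: un_def[abs_def] o_def)
  qed
  have hun_lim: "(\<lambda>n. h (un n)) \<longlonglongrightarrow> q" using q(3) by (simp add: un_def[abs_def] o_def)
  \<comment> \<open>Otherwise disjoint neighbourhoods of the two points would share the point
    \<open>\<pi> (h (un n)) = f (un n)\<close> for large \<open>n\<close>.\<close>
  have "\<pi> q = f x"
  proof (rule ccontr)
    assume "\<pi> q \<noteq> f x"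
    moreover have "\<pi> q \<in> points X" "f x \<in> points X"
      using disc_coverD(2)[OF cover] q1 fx by auto
    ultimately obtain W1 W2 where W: "openin (topol X) W1" "openin (topol X) W2" "\<pi> q \<in> W1" "f x \<in> W2" "disjnt W1 W2"
      using surface_Hausdorff[OF X] unfolding Hausdorff_space_def by blast
    obtain a1 where a1: "0 < a1" "ball q a1 \<subseteq> ball 0 1" "\<pi> ` ball q a1 \<subseteq> W1"
      by (rule ball_in_preimage[OF disc_coverD(1)[OF cover] W(1) q1 W(3)])
    obtain a2 where a2: "0 < a2" "ball x a2 \<subseteq> ball 0 s" "f ` ball x a2 \<subseteq> W2"
      by (rule ball_in_preimage[OF f(1) W(2) xs W(4)])
    have "\<forall>\<^sub>F n in sequentially. dist (h (un n)) q < a1 \<and> dist (un n) x < a2"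
      by (intro eventually_conj tendstoD[OF hun_lim a1(1)] tendstoD[OF un_lim a2(1)])
    then obtain n where n: "dist (h (un n)) q < a1" "dist (un n) x < a2"
      by (auto simp: eventually_sequentially)
    have "\<pi> (h (un n)) \<in> W1" using a1(3) n(1) by (auto simp: dist_commute)
    moreover have "f (un n) \<in> W2" using a2(3) n(2) by (auto simp: dist_commute)
    moreover have "\<pi> (h (un n)) = f (un n)" using h(2) un_r by (simp add: lift_at_def del: mem_ball)
    ultimately show False using W(5) by (auto simp: disjnt_def)
  qed
  then have "lift_at x q" using q1 by (simp add: lift_at_def)
  obtain d e where d: "0 < d" "cball q d \<subseteq> ball 0 1" "\<forall>w\<in>cball q d. \<pi> w = f x \<longrightarrow> w = q"
    and e: "0 < e" "ball x e \<subseteq> ball 0 s"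
    and "\<exists>k. k holomorphic_on ball x e \<and> k x = q \<and> (\<forall>w\<in>ball x e. lift_at w (k w))"
    and ext: "\<forall>S h. open S \<longrightarrow> connected S \<longrightarrow> S \<subseteq> ball x e \<longrightarrow> h holomorphic_on S \<longrightarrow> h ` S \<subseteq> ball q d \<longrightarrow>
      (\<forall>w\<in>S. lift_at w (h w)) \<longrightarrow>
      (\<exists>k. k holomorphic_on ball x e \<and> (\<forall>w\<in>ball x e. lift_at w (k w)) \<and> (\<forall>w\<in>S. k w = h w))"
    by (rule local_lift[OF xs \<open>lift_at x q\<close>]) (rule that)
  \<comment> \<open>The image of this circle is closed and misses \<open>f x\<close>, so
    \<open>h\<close> takes no value on the circle near \<open>x\<close>. Its values on a connected
    set, some of which are inside the circle, therefore all are.\<close>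
  have "compactin (top_of_set (ball 0 1)) (sphere q d)"
    using d(2) by (auto simp: compactin_subtopology sphere_cball)
  then have "compactin (topol X) (\<pi> ` sphere q d)"
    using image_compactin disc_coverD(1)[OF cover] by metis
  then have "closedin (topol X) (\<pi> ` sphere q d)"
    by (rule compactin_imp_closedin[OF surface_Hausdorff[OF X]])
  then have W: "openin (topol X) (points X - \<pi> ` sphere q d)" by (rule openin_diff[OF openin_topspace])
  have "f x \<notin> \<pi> ` sphere q d"
  proof
    assume "f x \<in> \<pi> ` sphere q d"
    then obtain w where "w \<in> sphere q d" "\<pi> w = f x" by auto
    then show False using d(3)[rule_format, of w] d(1) by auto
  qed
  then have fxW: "f x \<in> points X - \<pi> ` sphere q d" using fx disc_coverD(2)[OF cover] by auto
  obtain e3 where e3: "0 < e3" "ball x e3 \<subseteq> ball 0 s" "f ` ball x e3 \<subseteq> points X - \<pi> ` sphere q d"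
    by (rule ball_in_preimage[OF f(1) W xs fxW])
  define b where "b = min e e3"
  have b: "0 < b" "ball x b \<subseteq> ball x e" "ball x b \<subseteq> ball x e3" using e e3 by (auto simp: b_def)
  let ?S = "ball x b \<inter> ball 0 r"
  have "h ` ?S \<inter> sphere q d = {}"
  proof -
    have False if "w \<in> ?S" "h w \<in> sphere q d" for w
    proof -
      have "\<pi> (h w) = f w" using h(2) that(1) by (simp add: lift_at_def)
      moreover have "f w \<notin> \<pi> ` sphere q d" using e3(3) b(3) that(1) by blast
      ultimately show False using that(2) by (metis imageI)
    qed
    then show ?thesis by blast
  qed
  moreover have "h ` ?S \<inter> ball q d \<noteq> {}"
  proof -
    have "\<forall>\<^sub>F n in sequentially. dist (h (un n)) q < d \<and> dist (un n) x < b"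
      by (intro eventually_conj tendstoD[OF hun_lim d(1)] tendstoD[OF un_lim b(1)])
    then obtain n where "dist (h (un n)) q < d" "dist (un n) x < b"
      by (auto simp: eventually_sequentially)
    then have "h (un n) \<in> h ` ?S \<inter> ball q d" using un_r[of n] by (auto simp: dist_commute)
    then show ?thesis by blast
  qed
  ultimately have hS: "h ` ?S \<subseteq> ball q d"
    using connected_Int_frontier[OF hconn[of b], of "ball q d"] d(1) by (auto simp: frontier_ball)
  have "\<exists>k. k holomorphic_on ball x e \<and> (\<forall>w\<in>ball x e. lift_at w (k w)) \<and> (\<forall>w\<in>?S. k w = h w)"
  proof (rule ext[rule_format, OF _ conn _ _ hS])
    show "?S \<subseteq> ball x e" using b by blast
    show "h holomorphic_on ?S" by (rule holomorphic_on_subset[OF h(1)]) auto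
    show "lift_at w (h w)" if "w \<in> ?S" for w using h(2) that by blast
  qed auto
  then obtain k where k: "k holomorphic_on ball x e" "\<forall>w\<in>ball x e. lift_at w (k w)" "\<forall>w\<in>?S. k w = h w" by blast
  show ?thesis
  proof (rule exI[of _ b], rule conjI[OF b(1)], rule exI[of _ k], intro conjI)
    show "k holomorphic_on ball x b" by (rule holomorphic_on_subset[OF k(1) b(2)])
    show "\<forall>w\<in>ball x b. lift_at w (k w)" using k(2) b(2) by blast
  qed (rule k(3))
qed

lemma lift_exists:
  assumes "y0 \<in> ball 0 1" "\<pi> y0 = f 0"
  obtains h where "h holomorphic_on ball 0 s" "h 0 = y0" "\<And>w. w \<in> ball 0 s \<Longrightarrow> h w \<in> ball 0 1"
    "\<And>w. w \<in> ball 0 s \<Longrightarrow> \<pi> (h w) = f w"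
proof -
  have base: "0 \<in> ball 0 s" "lift_at 0 y0" using s assms by (auto simp: lift_at_def)
  have "\<exists>e k. 0 < e \<and> k holomorphic_on ball 0 e \<and> k 0 = y0 \<and> (\<forall>w\<in>ball 0 e. lift_at w (k w))"
    by (rule local_lift[OF base]) blast
  then obtain e k where e: "0 < e" and
    k: "k holomorphic_on ball 0 e" "k 0 = y0" "\<forall>w\<in>ball 0 e. lift_at w (k w)" by blast
  have start: "\<exists>e>0. e \<le> s \<and> (\<exists>h. h holomorphic_on ball 0 e \<and> h 0 = y0 \<and> (\<forall>w\<in>ball 0 e. lift_at w (h w)))"
  proof (intro exI[of _ "min e s"] conjI exI[of _ k])
    show "k holomorphic_on ball 0 (min e s)" by (rule holomorphic_on_subset[OF k(1)]) auto
    show "\<forall>w\<in>ball 0 (min e s). lift_at w (k w)" using k(3) by simp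
  qed (use e(1) s k(2) in auto)
  obtain h where h: "h holomorphic_on ball 0 s" "h 0 = y0" "\<And>w. w \<in> ball 0 s \<Longrightarrow> lift_at w (h w)"
    using disc_continuation[OF s start boundary_lift] by blast
  show ?thesis
    using that[of h] h unfolding lift_at_def by blast
qed

end


section \<open>Inclusions of Riemann surfaces\<close>

lemma chart_inverse:
  assumes "riemann_surface X" "(V, \<phi>) \<in> charts X"
  shows "continuous_map (top_of_set (\<phi> ` V)) (topol X) (inv_into V \<phi>)"
    "continuous_map (subtopology (topol X) V) (top_of_set (\<phi> ` V)) \<phi>"
proof -
  note c = chart_inj[OF assms]
  have V: "topspace (subtopology (topol X) V) = V" using openin_subset[OF c(1)] by auto
  obtain g where g: "homeomorphic_maps (subtopology (topol X) V) (top_of_set (\<phi> ` V)) \<phi> g"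
    using c(4) homeomorphic_map_maps by blast
  then show "continuous_map (subtopology (topol X) V) (top_of_set (\<phi> ` V)) \<phi>"
    by (simp add: homeomorphic_maps_def)
  have "continuous_map (top_of_set (\<phi> ` V)) (topol X) g"
    using g by (auto simp: homeomorphic_maps_def continuous_map_in_subtopology)
  moreover have "g w = inv_into V \<phi> w" if w: "w \<in> topspace (top_of_set (\<phi> ` V))" for w
  proof -
    obtain v where v: "v \<in> V" "w = \<phi> v" using w by auto
    have "g (\<phi> v) = v" using g v(1) V by (simp add: homeomorphic_maps_def)
    then show ?thesis using v c(2) by (simp add: inv_into_f_f)
  qed
  ultimately show "continuous_map (top_of_set (\<phi> ` V)) (topol X) (inv_into V \<phi>)"
    by (rule continuous_map_eq)
qed

lemma chart_preimage_open:
  assumes "riemann_surface X" "(V, \<phi>) \<in> charts X" "open B"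
  shows "openin (topol X) {v \<in> V. \<phi> v \<in> B}"
proof -
  note c = chart_inj[OF assms(1,2)]
  have V: "topspace (subtopology (topol X) V) = V" using openin_subset[OF c(1)] by auto
  have "openin (subtopology (topol X) V) {v \<in> topspace (subtopology (topol X) V). \<phi> v \<in> \<phi> ` V \<inter> B}"
    by (rule openin_continuous_map_preimage[OF chart_inverse(2)[OF assms(1,2)]])
       (use assms(3) in \<open>auto intro: openin_open_Int\<close>)
  moreover have "{v \<in> topspace (subtopology (topol X) V). \<phi> v \<in> \<phi> ` V \<inter> B} = {v \<in> V. \<phi> v \<in> B}"
    using V by auto
  ultimately show ?thesis
    using openin_trans_full[OF _ c(1)] by simp
qed

lemma chart_image_open:
  assumes "riemann_surface X" "(V, \<phi>) \<in> charts X" "openin (topol X) W" "W \<subseteq> V"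
  shows "open (\<phi> ` W)"
proof -
  note c = chart_inj[OF assms(1,2)]
  have "openin (subtopology (topol X) V) W"
    using assms(3,4) by (metis openin_subtopology inf.absorb1)
  then have "openin (top_of_set (\<phi> ` V)) (\<phi> ` W)"
    using homeomorphic_imp_open_map[OF c(4)] by (simp add: open_map_def)
  then show ?thesis using c(3) by (rule openin_open_trans)
qed

text \<open>
  A holomorphic inclusion is an open map by the open mapping theorem, so that it does not matter
  with respect to which of the two surfaces topological notions are understood.
\<close>

locale included_surface =
  fixes X' X :: "'a orbifold"
  assumes X': "riemann_surface X'" and X: "riemann_surface X"
    and incl: "holomorphic_inclusion X' X"
begin

lemma subset: "points X' \<subseteq> points X"
  using incl by (simp add: holomorphic_inclusion_def)

lemma incl_continuous: "continuous_map (topol X') (topol X) (\<lambda>z. z)"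
  using incl by (simp add: holomorphic_inclusion_def holomorphic_map_def)

lemma transition_holomorphic:
  assumes "(U, \<psi>) \<in> charts X'" "(V, \<phi>) \<in> charts X"
  shows "(\<lambda>w. \<phi> (inv_into U \<psi> w)) holomorphic_on \<psi> ` (U \<inter> V)"
proof -
  have "U \<inter> V = {x \<in> U. x \<in> V}" by auto
  then show ?thesis
    using incl assms unfolding holomorphic_inclusion_def holomorphic_map_def by fastforce
qed

lemma openin_restrict:
  assumes "openin (topol X) V"
  shows "openin (topol X') (V \<inter> points X')"
proof -
  have "openin (topol X') {x \<in> points X'. x \<in> V}"
    by (rule openin_continuous_map_preimage[OF incl_continuous assms])
  moreover have "{x \<in> points X'. x \<in> V} = V \<inter> points X'" by auto
  ultimately show ?thesis by simp
qed

lemma transition_image: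
  assumes "(U, \<psi>) \<in> charts X'" "(V, \<phi>) \<in> charts X" "W \<subseteq> U \<inter> V"
  shows "(\<lambda>w. \<phi> (inv_into U \<psi> w)) ` \<psi> ` W = \<phi> ` W" "inj_on (\<lambda>w. \<phi> (inv_into U \<psi> w)) (\<psi> ` W)"
proof -
  have inv: "inv_into U \<psi> (\<psi> x) = x" if "x \<in> W" for x
    using that assms chart_inj(2)[OF X' assms(1)] by (auto intro: inv_into_f_f)
  then show "(\<lambda>w. \<phi> (inv_into U \<psi> w)) ` \<psi> ` W = \<phi> ` W"
    by (force simp: image_image)
  show "inj_on (\<lambda>w. \<phi> (inv_into U \<psi> w)) (\<psi> ` W)"
  proof (rule inj_onI)
    fix a b assume "a \<in> \<psi> ` W" "b \<in> \<psi> ` W" and eq: "\<phi> (inv_into U \<psi> a) = \<phi> (inv_into U \<psi> b)"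
    then obtain x y where xy: "x \<in> W" "y \<in> W" "a = \<psi> x" "b = \<psi> y" by blast
    have "\<phi> x = \<phi> y" using eq xy inv by simp
    then have "x = y" using chart_inj(2)[OF X assms(2)] xy(1,2) assms(3) by (auto dest: inj_onD)
    then show "a = b" using xy by simp
  qed
qed

lemma incl_open:
  assumes W: "openin (topol X') W"
  shows "openin (topol X) W"
proof (subst openin_subopen, rule ballI)
  fix p assume p: "p \<in> W"
  then have pX': "p \<in> points X'" using openin_subset[OF W] by auto
  obtain U \<psi> where U: "(U, \<psi>) \<in> charts X'" "p \<in> U" by (rule chart_at[OF X' pX'])
  have pX: "p \<in> points X" using pX' subset by blast
  obtain V \<phi> where V: "(V, \<phi>) \<in> charts X" "p \<in> V" by (rule chart_at[OF X pX])
  define O' where "O' = W \<inter> U \<inter> (V \<inter> points X')"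
  have O': "openin (topol X') O'" "O' \<subseteq> U \<inter> V" "p \<in> O'" "O' \<subseteq> W"
    unfolding O'_def using W chart_inj(1)[OF X' U(1)] openin_restrict[OF chart_inj(1)[OF X V(1)]] p U V pX'
    by (auto intro!: openin_Int)
  have op: "open (\<psi> ` O')" by (rule chart_image_open[OF X' U(1) O'(1)]) (use O'(2) in blast)
  have "(\<lambda>w. \<phi> (inv_into U \<psi> w)) holomorphic_on \<psi> ` O'"
    by (rule holomorphic_on_subset[OF transition_holomorphic[OF U(1) V(1)]]) (use O'(2) in blast)
  from open_mapping_thm3[OF this op transition_image(2)[OF U(1) V(1) O'(2)]]
  have "open (\<phi> ` O')" by (simp only: transition_image(1)[OF U(1) V(1) O'(2)])
  then have "openin (topol X) {v \<in> V. \<phi> v \<in> \<phi> ` O'}" by (rule chart_preimage_open[OF X V(1)])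
  moreover have "{v \<in> V. \<phi> v \<in> \<phi> ` O'} = O'"
    using chart_inj(2)[OF X V(1)] O'(2) by (auto dest: inj_onD)
  ultimately show "\<exists>T. openin (topol X) T \<and> p \<in> T \<and> T \<subseteq> W" using O' by auto
qed

lemma points_open: "openin (topol X) (points X')"
  by (rule incl_open) simp

end

text \<open>With it, what is shown for \<open>X'\<close> inside \<open>X\<close> also covers the
  orbifold \<open>X\<close> itself.\<close>

lemma included_surface_refl:
  assumes "riemann_surface X"
  shows "included_surface X X"
proof
  show "holomorphic_inclusion X X"
    unfolding holomorphic_inclusion_def holomorphic_map_def
  proof (intro conjI)
    show "continuous_map (topol X) (topol X) (\<lambda>z. z)" by (rule continuous_map_id[unfolded id_def])
    show "\<forall>(U, \<phi>)\<in>charts X. \<forall>(V, \<psi>)\<in>charts X.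
        (\<lambda>w. \<psi> (inv_into U \<phi> w)) holomorphic_on \<phi> ` {x \<in> U. x \<in> V}"
      using assms by (simp add: riemann_surface_def Int_def)
  qed auto
qed (use assms in auto)

text \<open>Surfaces are locally connected: a round disc in a chart around a point of a component is
  connected and hence inside the component.\<close>

lemma component_open:
  assumes "riemann_surface X" "C \<in> connected_components_of (topol X)"
  shows "openin (topol X) C"
proof (subst openin_subopen, rule ballI)
  fix p assume p: "p \<in> C"
  have "C \<subseteq> points X" using assms(2) by (rule connected_components_of_subset)
  with p have pX: "p \<in> points X" by blast
  obtain V \<phi> where V: "(V, \<phi>) \<in> charts X" "p \<in> V" by (rule chart_at[OF assms(1) pX])
  note c = chart_inj[OF assms(1) V(1)]
  obtain e where e: "0 < e" "ball (\<phi> p) e \<subseteq> \<phi> ` V"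
    using c(3) V(2) open_contains_ball by blast
  let ?B = "{v \<in> V. \<phi> v \<in> ball (\<phi> p) e}"
  have "?B = inv_into V \<phi> ` ball (\<phi> p) e"
  proof
    show "?B \<subseteq> inv_into V \<phi> ` ball (\<phi> p) e"
    proof
      fix v assume v: "v \<in> ?B"
      then have "v = inv_into V \<phi> (\<phi> v)" using c(2) by simp
      then show "v \<in> inv_into V \<phi> ` ball (\<phi> p) e" using v by blast
    qed
    show "inv_into V \<phi> ` ball (\<phi> p) e \<subseteq> ?B"
      using e(2) by (auto simp: f_inv_into_f inv_into_into subset_iff)
  qed
  moreover have "connectedin (topol X) (inv_into V \<phi> ` ball (\<phi> p) e)"
    by (rule connectedin_continuous_map_image[OF chart_inverse(1)[OF assms(1) V(1)]])
       (use e(2) in \<open>auto simp: connectedin_subtopology\<close>)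
  ultimately have "connectedin (topol X) ?B" by simp
  moreover have "p \<in> ?B" using V(2) e(1) by simp
  moreover from this have "\<not> disjnt C ?B" using p unfolding disjnt_def by blast
  ultimately have "?B \<subseteq> C"
    using connected_components_of_maximal[OF assms(2)] by blast
  moreover have "openin (topol X) ?B" by (rule chart_preimage_open[OF assms(1) V(1)]) simp
  ultimately show "\<exists>T. openin (topol X) T \<and> p \<in> T \<and> T \<subseteq> C" using \<open>p \<in> ?B\<close> by blast
qed


section \<open>Orbifold coverings by the disc\<close>

lemma zorder_injective:
  assumes "\<tau> holomorphic_on B" "open B" "inj_on \<tau> B" "c \<in> B"
  shows "zorder (\<lambda>u. \<tau> u - \<tau> c) c = 1"
proof (rule zorder_zero_eqI[of _ B])
  show "(\<lambda>u. \<tau> u - \<tau> c) holomorphic_on B" using assms(1) by (intro holomorphic_intros)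
  have "(\<tau> has_field_derivative deriv \<tau> c) (at c)"
    using assms(1,2,4) by (rule holomorphic_derivI)
  then have "((\<lambda>u. \<tau> u - \<tau> c) has_field_derivative deriv \<tau> c) (at c)"
    by (auto intro!: derivative_eq_intros)
  then have "deriv (\<lambda>u. \<tau> u - \<tau> c) c = deriv \<tau> c" by (rule DERIV_imp_deriv)
  moreover have "deriv \<tau> c \<noteq> 0"
    using assms by (intro holomorphic_injective_imp_regular)
  ultimately show "(deriv ^^ nat 1) (\<lambda>u. \<tau> u - \<tau> c) c \<noteq> 0" by simp
qed (use assms in auto)

text \<open>Orders multiply under composition, and an injective map takes each value to order 1.
  This makes the local degree independent of the chart in the target.\<close>

lemma zorder_injective_compose:
  assumes \<tau>: "\<tau> holomorphic_on B" "open B" "inj_on \<tau> B" and g: "g holomorphic_on S" "open S" "connected S" "x \<in> S"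
    and gB: "g ` S \<subseteq> B" and nc: "\<exists>w\<in>S. g w \<noteq> g x"
  shows "zorder (\<lambda>w. \<tau> (g w) - \<tau> (g x)) x = zorder (\<lambda>w. g w - g x) x"
proof -
  have c: "g x \<in> B" using gB g(4) by blast
  have hol: "(\<lambda>u. \<tau> u - \<tau> (g x)) holomorphic_on B" using \<tau>(1) by (intro holomorphic_intros)
  then have an: "(\<lambda>u. \<tau> u - \<tau> (g x)) analytic_on {g x}"
    using \<tau>(2) c by (meson analytic_on_open analytic_on_subset empty_subsetI insert_subset)
  have gan: "g analytic_on {x}"
    using g(1,2,4) by (meson analytic_on_open analytic_on_subset empty_subsetI insert_subset)
  have "zorder ((\<lambda>u. \<tau> u - \<tau> (g x)) \<circ> g) x = zorder (\<lambda>u. \<tau> u - \<tau> (g x)) (g x) * zorder (\<lambda>w. g w - g x) x"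
  proof (rule zorder_compose')
    show "isolated_singularity_at (\<lambda>u. \<tau> u - \<tau> (g x)) (g x)"
      using an by (rule isolated_singularity_at_analytic)
    show "not_essential (\<lambda>u. \<tau> u - \<tau> (g x)) (g x)"
      using an by (rule not_essential_analytic)
    have "eventually (\<lambda>u. u \<in> B) (at (g x))" using \<tau>(2) c by (rule eventually_at_in_open')
    then show "eventually (\<lambda>u. \<tau> u - \<tau> (g x) \<noteq> 0) (at (g x))"
      using eventually_neq_at_within[of "g x" "g x" UNIV]
      by eventually_elim (use \<tau>(3) c in \<open>auto dest: inj_onD\<close>)
    have "eventually (\<lambda>w. g w - g x \<noteq> 0) (at x)"
    proof -
      obtain w where w: "w \<in> S" "g w - g x \<noteq> 0" using nc by auto
      have "(\<lambda>w. g w - g x) holomorphic_on S" using g(1) by (intro holomorphic_intros)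
      then have "\<forall>\<^sub>F z in at x. g z - g x \<noteq> 0 \<and> z \<in> S"
        using non_zero_neighbour_alt[of "\<lambda>w. g w - g x" S x w] g w by blast
      then show ?thesis by eventually_elim auto
    qed
    then show "eventually (\<lambda>w. g w \<noteq> g x) (at x)" by eventually_elim auto
  qed (rule gan)
  then show ?thesis
    using zorder_injective[OF \<tau> c] by (simp add: o_def)
qed

text \<open>A covering of one component of \<open>X'\<close>, to be described in terms of the
  topology and the charts of the ambient surface \<open>X\<close>.\<close>

locale covered_component = included_surface +
  fixes C :: "'a set" and \<pi> :: "complex \<Rightarrow> 'a"
  assumes C: "C \<in> connected_components_of (topol X')"
    and ramif_pos: "\<And>p. p \<in> points X' \<Longrightarrow> 1 \<le> ramif X' p"
    and covering: "orbifold_covering_map unit_disc (surface_restrict X' C) \<pi>"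
begin

abbreviation "Y \<equiv> surface_restrict X' C"

lemma C_subset: "C \<subseteq> points X'"
  using C by (rule connected_components_of_subset)

lemma C_open: "openin (topol X') C"
  by (rule component_open[OF X' C])

lemma points_Y: "points Y = C"
  using C_subset by (auto simp: surface_restrict_def)

lemma topol_Y: "topol Y = subtopology (topol X') C"
  by (simp add: surface_restrict_def)

lemma branched: "branched_covering_map unit_disc Y \<pi>"
  using covering by (simp add: orbifold_covering_map_def)

lemma \<pi>_continuous_Y: "continuous_map (top_of_set (ball 0 1)) (subtopology (topol X') C) \<pi>"
  using branched by (simp add: branched_covering_map_def holomorphic_map_def unit_disc_def topol_Y)

lemma \<pi>_continuous': "continuous_map (top_of_set (ball 0 1)) (topol X') \<pi>"
  using \<pi>_continuous_Y by (simp add: continuous_map_in_subtopology)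

lemma \<pi>_continuous: "continuous_map (top_of_set (ball 0 1)) (topol X) \<pi>"
  using continuous_map_compose[OF \<pi>_continuous' incl_continuous] by (simp add: o_def)

lemma \<pi>_in_C: "x \<in> ball 0 1 \<Longrightarrow> \<pi> x \<in> C"
  using \<pi>_continuous_Y by (auto simp: continuous_map_in_subtopology)

lemma open_Y: "openin (topol Y) U \<Longrightarrow> openin (topol X) U"
  using incl_open openin_trans_full[OF _ C_open] by (simp add: topol_Y)

text \<open>The neighbourhood from the definition of a branched covering, transferred from
  \<open>Y\<close> to \<open>X\<close>. On an open subset of \<open>X'\<close> both surfaces induce
  the same topology, because the inclusion is continuous and open, so properness is
  preserved.\<close>

lemma covered_nhd:
  assumes "p \<in> C"
  obtains U where "openin (topol X) U" "p \<in> U" "U \<subseteq> C"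
    "\<forall>D\<in>connected_components_of (top_of_set {x \<in> ball 0 1. \<pi> x \<in> U}).
       \<pi> ` D = U \<and> proper_map (top_of_set D) (subtopology (topol X) U) \<pi>"
proof -
  have "p \<in> points Y" using assms points_Y by simp
  have "\<forall>z\<in>points Y. \<exists>U. openin (topol Y) U \<and> z \<in> U \<and> connectedin (topol Y) U \<and>
      (\<forall>D\<in>connected_components_of (subtopology (topol unit_disc) {x \<in> points unit_disc. \<pi> x \<in> U}).
         \<pi> ` D = U \<and> proper_map (subtopology (topol unit_disc) D) (subtopology (topol Y) U) \<pi>)"
    using branched unfolding branched_covering_map_def by (rule conjunct2)
  from bspec[OF this \<open>p \<in> points Y\<close>] obtain U where U: "openin (topol Y) U" "p \<in> U"
    "\<forall>D\<in>connected_components_of (subtopology (topol unit_disc) {x \<in> points unit_disc. \<pi> x \<in> U}).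
       \<pi> ` D = U \<and> proper_map (subtopology (topol unit_disc) D) (subtopology (topol Y) U) \<pi>"
    by (elim exE conjE)
  have UC: "U \<subseteq> C" using openin_subset[OF U(1)] points_Y by simp
  have ud: "topol unit_disc = top_of_set (ball 0 1)" by (simp add: unit_disc_def)
  have "ball 0 1 \<inter> {x \<in> ball 0 1. \<pi> x \<in> U} = {x \<in> ball 0 1. \<pi> x \<in> U}" by blast
  then have eq: "subtopology (topol unit_disc) {x \<in> points unit_disc. \<pi> x \<in> U} = top_of_set {x \<in> ball 0 1. \<pi> x \<in> U}"
    by (simp only: ud subtopology_subtopology topspace_euclidean_subtopology)
  show ?thesis
  proof (rule that[of U])
    show "openin (topol X) U" by (rule open_Y[OF U(1)])
    show "\<forall>D\<in>connected_components_of (top_of_set {x \<in> ball 0 1. \<pi> x \<in> U}).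
       \<pi> ` D = U \<and> proper_map (top_of_set D) (subtopology (topol X) U) \<pi>"
    proof
      fix D assume D: "D \<in> connected_components_of (top_of_set {x \<in> ball 0 1. \<pi> x \<in> U})"
      then have "D \<subseteq> ball 0 1" using connected_components_of_subset[OF D] by auto
      then have 1: "subtopology (topol unit_disc) D = top_of_set D"
        unfolding ud subtopology_subtopology by (simp only: Int_absorb1)
      have p: "\<pi> ` D = U" "proper_map (top_of_set D) (subtopology (topol Y) U) \<pi>"
        using bspec[OF U(3)[unfolded eq] D] unfolding 1 by (rule conjunct1, rule conjunct2)
      have 2: "subtopology (topol Y) U = subtopology (topol X') U"
        using UC by (simp add: topol_Y subtopology_subtopology Int_absorb1)
      have UX: "openin (topol X') U" using U(1) openin_trans_full[OF _ C_open] by (simp add: topol_Y)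
      have "subtopology (topol X') U = subtopology (topol X) U"
      proof (rule topology_eq[THEN iffD2], rule allI)
        fix T
        show "openin (subtopology (topol X') U) T = openin (subtopology (topol X) U) T"
        proof
          assume "openin (subtopology (topol X') U) T"
          then have "openin (topol X') T" "T \<subseteq> U"
            using openin_trans_full[OF _ UX] openin_subset[of "subtopology (topol X') U" T] by auto
          then show "openin (subtopology (topol X) U) T"
            using incl_open by (metis inf.absorb1 openin_subtopology)
        next
          assume "openin (subtopology (topol X) U) T"
          then have T: "openin (topol X) T" "T \<subseteq> U"
            using openin_trans_full[OF _ open_Y[OF U(1)]] openin_subset[of "subtopology (topol X) U" T] by auto
          have "openin (topol X') (T \<inter> points X')" by (rule openin_restrict[OF T(1)])
          moreover have "T \<inter> points X' = T" using T(2) UC C_subset by blast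
          ultimately show "openin (subtopology (topol X') U) T"
            using T(2) by (metis inf.absorb1 openin_subtopology)
        qed
      qed
      with p 2 show "\<pi> ` D = U \<and> proper_map (top_of_set D) (subtopology (topol X) U) \<pi>" by simp
    qed
  qed (use U(2) UC in auto)
qed

lemma nhd_in_image:
  assumes "p \<in> C"
  obtains U where "openin (topol X) U" "p \<in> U" "U \<subseteq> \<pi> ` ball 0 1 \<or> U \<inter> \<pi> ` ball 0 1 = {}"
proof -
  obtain U where U: "openin (topol X) U" "p \<in> U"
    "\<forall>D\<in>connected_components_of (top_of_set {x \<in> ball 0 1. \<pi> x \<in> U}).
       \<pi> ` D = U \<and> proper_map (top_of_set D) (subtopology (topol X) U) \<pi>"
    by (rule covered_nhd[OF assms]) (rule that)
  show ?thesis
  proof (cases "connected_components_of (top_of_set {x \<in> ball 0 1. \<pi> x \<in> U}) = {}")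
    case True
    then have "topspace (top_of_set {x \<in> ball 0 1. \<pi> x \<in> U}) = {}"
      unfolding null_topspace_iff_trivial connected_components_of_eq_empty .
    then have "{x \<in> ball 0 1. \<pi> x \<in> U} = {}" by simp
    then have "U \<inter> \<pi> ` ball 0 1 = {}" by auto
    then show ?thesis using that U by blast
  next
    case False
    then obtain D where D: "D \<in> connected_components_of (top_of_set {x \<in> ball 0 1. \<pi> x \<in> U})" by blast
    then have "D \<subseteq> ball 0 1" using connected_components_of_subset[OF D] by auto
    moreover have "\<pi> ` D = U" using U(3) D by blast
    ultimately show ?thesis using that U by blast
  qed
qed

text \<open>The condition on a branched covering is vacuous over a point without preimages, so
  surjectivity has to be shown. By \<open>nhd_in_image\<close> both the image and its complement in
  \<open>C\<close> are open, and \<open>C\<close> is connected.\<close>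

lemma image_\<pi>: "\<pi> ` ball 0 1 = C"
proof -
  have op: "openin (topol X) (\<pi> ` ball 0 1)"
  proof (subst openin_subopen, rule ballI)
    fix p assume p: "p \<in> \<pi> ` ball 0 1"
    then have pC: "p \<in> C" using \<pi>_in_C by blast
    obtain U where "openin (topol X) U" "p \<in> U" "U \<subseteq> \<pi> ` ball 0 1 \<or> U \<inter> \<pi> ` ball 0 1 = {}"
      by (rule nhd_in_image[OF pC]) (rule that)
    then show "\<exists>T. openin (topol X) T \<and> p \<in> T \<and> T \<subseteq> \<pi> ` ball 0 1" using p by blast
  qed
  have cl: "openin (topol X) (C - \<pi> ` ball 0 1)"
  proof (subst openin_subopen, rule ballI)
    fix p assume p: "p \<in> C - \<pi> ` ball 0 1"
    then have pC: "p \<in> C" by blast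
    obtain U where U: "openin (topol X) U" "p \<in> U" "U \<subseteq> \<pi> ` ball 0 1 \<or> U \<inter> \<pi> ` ball 0 1 = {}"
      by (rule nhd_in_image[OF pC]) (rule that)
    have "openin (topol X) (U \<inter> C)" using U(1) incl_open[OF C_open] by (rule openin_Int)
    moreover have "U \<inter> C \<subseteq> C - \<pi> ` ball 0 1" using U p by blast
    ultimately show "\<exists>T. openin (topol X) T \<and> p \<in> T \<and> T \<subseteq> C - \<pi> ` ball 0 1" using U(2) pC by blast
  qed
  have conn: "connectedin (topol X) C"
  proof -
    have "connectedin (topol X') C" using C by (rule connectedin_connected_components_of)
    then have "connectedin (topol X) ((\<lambda>z. z) ` C)"
      by (rule connectedin_continuous_map_image[OF incl_continuous])
    then show ?thesis by simp
  qed
  have "\<pi> 0 \<in> C" "\<pi> 0 \<in> \<pi> ` ball 0 1" by (auto intro: \<pi>_in_C)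
  moreover have "\<pi> ` ball 0 1 \<inter> (C - \<pi> ` ball 0 1) \<inter> C = {}" "C \<subseteq> \<pi> ` ball 0 1 \<union> (C - \<pi> ` ball 0 1)" by auto
  ultimately have "(C - \<pi> ` ball 0 1) \<inter> C = {}"
    using conn op cl unfolding connectedin by blast
  then show ?thesis using \<pi>_in_C by blast
qed

section \<open>Holomorphy and local degree of a covering in charts of the larger surface\<close>

lemma chart_holomorphic':
  assumes "(U, \<psi>) \<in> charts X'"
  shows "(\<lambda>w. \<psi> (\<pi> w)) holomorphic_on {x \<in> ball 0 1. \<pi> x \<in> U}"
proof -
  have "(U \<inter> C, \<psi>) \<in> charts Y" using assms by (force simp: surface_restrict_def)
  moreover have "(ball 0 1, \<lambda>z. z) \<in> charts unit_disc" by (simp add: unit_disc_def)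
  ultimately have "(\<lambda>w. \<psi> (\<pi> (inv_into (ball 0 1) (\<lambda>z. z) w))) holomorphic_on (\<lambda>z. z) ` {x \<in> ball 0 1. \<pi> x \<in> U \<inter> C}"
    using branched unfolding branched_covering_map_def holomorphic_map_def by fastforce
  then have hol: "(\<lambda>w. \<psi> (\<pi> (inv_into (ball 0 1) (\<lambda>z. z) w))) holomorphic_on {x \<in> ball 0 1. \<pi> x \<in> U \<inter> C}"
    by simp
  have inv: "inv_into (ball 0 1) (\<lambda>z. z) w = w" if "w \<in> ball 0 1" for w :: complex
    using inv_into_f_f[of "\<lambda>z. z" "ball 0 1" w] that by (simp add: inj_on_def)
  have "(\<lambda>w. \<psi> (\<pi> w)) holomorphic_on {x \<in> ball 0 1. \<pi> x \<in> U \<inter> C}"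
    by (rule holomorphic_transform[OF hol]) (simp add: inv)
  moreover have "{x \<in> ball 0 1. \<pi> x \<in> U \<inter> C} = {x \<in> ball 0 1. \<pi> x \<in> U}" using \<pi>_in_C by auto
  ultimately show ?thesis by simp
qed

text \<open>\<open>\<tau>\<close> is the change of coordinate from a chart of \<open>X'\<close> to
  one of \<open>X\<close>; being holomorphic and injective, it transports holomorphy and orders of
  \<pi>.\<close>

lemma common_disc:
  assumes "x \<in> ball 0 1" "(U, \<psi>) \<in> charts X'" "\<pi> x \<in> U" "(V, \<phi>) \<in> charts X" "\<pi> x \<in> V"
  obtains e B \<tau> where "0 < e" "ball x e \<subseteq> ball 0 1" "\<pi> ` ball x e \<subseteq> U \<inter> V"
    "(\<lambda>w. \<psi> (\<pi> w)) holomorphic_on ball x e" "(\<lambda>w. \<psi> (\<pi> w)) ` ball x e \<subseteq> B"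
    "open B" "\<tau> holomorphic_on B" "inj_on \<tau> B" "\<forall>w\<in>ball x e. \<tau> (\<psi> (\<pi> w)) = \<phi> (\<pi> w)"
proof -
  let ?W = "U \<inter> (V \<inter> points X')"
  have W: "openin (topol X') ?W"
    using chart_inj(1)[OF X' assms(2)] openin_restrict[OF chart_inj(1)[OF X assms(4)]] by (rule openin_Int)
  have xW: "\<pi> x \<in> ?W" using assms \<pi>_in_C C_subset by blast
  obtain e where e: "0 < e" "ball x e \<subseteq> ball 0 1" "\<pi> ` ball x e \<subseteq> ?W"
    by (rule ball_in_preimage[OF \<pi>_continuous' W assms(1) xW])
  define \<tau> where "\<tau> = (\<lambda>w. \<phi> (inv_into U \<psi> w))"
  have sub: "?W \<subseteq> U \<inter> V" by auto
  show ?thesis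
  proof (rule that[of e "\<psi> ` ?W" \<tau>])
    show "(\<lambda>w. \<psi> (\<pi> w)) holomorphic_on ball x e"
      by (rule holomorphic_on_subset[OF chart_holomorphic'[OF assms(2)]]) (use e in blast)
    show "open (\<psi> ` ?W)" by (rule chart_image_open[OF X' assms(2) W]) auto
    show "\<tau> holomorphic_on \<psi> ` ?W" unfolding \<tau>_def
      by (rule holomorphic_on_subset[OF transition_holomorphic[OF assms(2,4)]]) auto
    show "inj_on \<tau> (\<psi> ` ?W)" unfolding \<tau>_def by (rule transition_image(2)[OF assms(2,4) sub])
    show "\<forall>w\<in>ball x e. \<tau> (\<psi> (\<pi> w)) = \<phi> (\<pi> w)"
    proof
      fix w assume "w \<in> ball x e"
      then have "\<pi> w \<in> U" using e(3) by blast
      then show "\<tau> (\<psi> (\<pi> w)) = \<phi> (\<pi> w)"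
        unfolding \<tau>_def using chart_inj(2)[OF X' assms(2)] by simp
    qed
  qed (use e in blast)+
qed

lemma chart_holomorphic:
  assumes "(V, \<phi>) \<in> charts X"
  shows "(\<lambda>w. \<phi> (\<pi> w)) holomorphic_on {x \<in> ball 0 1. \<pi> x \<in> V}"
proof (rule analytic_imp_holomorphic)
  show "(\<lambda>w. \<phi> (\<pi> w)) analytic_on {x \<in> ball 0 1. \<pi> x \<in> V}"
    unfolding analytic_on_def
  proof
    fix x assume "x \<in> {x \<in> ball 0 1. \<pi> x \<in> V}"
    then have x: "x \<in> ball 0 1" "\<pi> x \<in> V" by auto
    have pX': "\<pi> x \<in> points X'" using \<pi>_in_C[OF x(1)] C_subset by blast
    obtain U \<psi> where U: "(U, \<psi>) \<in> charts X'" "\<pi> x \<in> U" by (rule chart_at[OF X' pX'])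
    obtain e B \<tau> where e: "0 < e" "ball x e \<subseteq> ball 0 1" "\<pi> ` ball x e \<subseteq> U \<inter> V"
      "(\<lambda>w. \<psi> (\<pi> w)) holomorphic_on ball x e" "(\<lambda>w. \<psi> (\<pi> w)) ` ball x e \<subseteq> B"
      "open B" "\<tau> holomorphic_on B" "inj_on \<tau> B" "\<forall>w\<in>ball x e. \<tau> (\<psi> (\<pi> w)) = \<phi> (\<pi> w)"
      by (rule common_disc[OF x(1) U assms x(2)]) (rule that)
    have "\<tau> \<circ> (\<lambda>w. \<psi> (\<pi> w)) holomorphic_on ball x e"
      by (rule holomorphic_on_compose_gen[OF e(4,7,5)])
    then have "(\<lambda>w. \<phi> (\<pi> w)) holomorphic_on ball x e"
      by (rule holomorphic_transform) (use e(9) in simp)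
    then show "\<exists>e>0. (\<lambda>w. \<phi> (\<pi> w)) holomorphic_on ball x e" using e(1) by blast
  qed
qed

text \<open>The set of points near which \<pi> has the constant value \<open>\<pi> x\<close> is
  open, and by the identity theorem also relatively closed in the disc. If nonempty, it is the whole
  disc and \<open>C\<close> is a single point; but \<open>C\<close> is open and a singleton is not
  open in a chart.\<close>

lemma not_constant:
  assumes x: "x \<in> ball 0 1" and V: "(V, \<phi>) \<in> charts X" and e: "0 < e" "\<pi> ` ball x e \<subseteq> V"
  shows "\<exists>w\<in>ball x e. \<phi> (\<pi> w) \<noteq> \<phi> (\<pi> x)"
proof (rule ccontr)
  assume neg: "\<not> ?thesis"
  have xV: "\<pi> x \<in> V" using e by (metis centre_in_ball image_subset_iff)
  have const: "\<pi> w = \<pi> x" if "w \<in> ball x e" for w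
  proof (rule inj_onD[OF chart_inj(2)[OF X V]])
    show "\<phi> (\<pi> w) = \<phi> (\<pi> x)" using neg that by blast
  qed (use that e(2) xV in auto)
  define A where "A = {y \<in> ball 0 1. \<exists>d>0. ball y d \<subseteq> ball 0 1 \<and> (\<forall>w\<in>ball y d. \<pi> w = \<pi> x)}"
  have opA: "open A"
    unfolding open_contains_ball
  proof
    fix y assume "y \<in> A"
    then obtain d where d: "0 < d" "ball y d \<subseteq> ball 0 1" "\<forall>w\<in>ball y d. \<pi> w = \<pi> x" unfolding A_def by blast
    have "ball y d \<subseteq> A"
    proof
      fix w assume w: "w \<in> ball y d"
      obtain d' where d': "0 < d'" "ball w d' \<subseteq> ball y d" by (rule openE[OF open_ball w])
      then have "ball w d' \<subseteq> ball 0 1" "\<forall>u\<in>ball w d'. \<pi> u = \<pi> x" using d by blast+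
      moreover have "w \<in> ball 0 1" using w d(2) by blast
      ultimately show "w \<in> A" unfolding A_def using d'(1) by blast
    qed
    then show "\<exists>d>0. ball y d \<subseteq> A" using d(1) by blast
  qed
  have opB: "open (ball 0 1 - A)"
    unfolding open_contains_ball
  proof
    fix y assume y: "y \<in> ball 0 1 - A"
    then have y1: "y \<in> ball 0 1" by blast
    have "\<pi> y \<in> points X" using \<pi>_in_C[OF y1] C_subset subset by blast
    then obtain V' \<phi>' where V': "(V', \<phi>') \<in> charts X" "\<pi> y \<in> V'" by (rule chart_at[OF X])
    obtain d where d: "0 < d" "ball y d \<subseteq> ball 0 1" "\<pi> ` ball y d \<subseteq> V'"
      by (rule ball_in_preimage[OF \<pi>_continuous chart_inj(1)[OF X V'(1)] y1 V'(2)])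
    have hol: "(\<lambda>w. \<phi>' (\<pi> w)) holomorphic_on ball y d"
      by (rule holomorphic_on_subset[OF chart_holomorphic[OF V'(1)]]) (use d in blast)
    have "ball y d \<inter> A = {}"
    proof (rule ccontr)
      assume "ball y d \<inter> A \<noteq> {}"
      then obtain a where a: "a \<in> ball y d" "a \<in> A" by blast
      then obtain b where b: "0 < b" "\<forall>w\<in>ball a b. \<pi> w = \<pi> x" unfolding A_def by blast
      have xV': "\<pi> x \<in> V'"
      proof -
        have "\<pi> a = \<pi> x" using b by simp
        moreover have "\<pi> a \<in> V'" using a(1) d(3) by blast
        ultimately show ?thesis by simp
      qed
      have "\<pi> w = \<pi> x" if w: "w \<in> ball y d" for w
      proof (rule inj_onD[OF chart_inj(2)[OF X V'(1)]])
        show "\<phi>' (\<pi> w) = \<phi>' (\<pi> x)"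
        proof (rule analytic_continuation_open[of "ball a b \<inter> ball y d" "ball y d" "\<lambda>w. \<phi>' (\<pi> w)" "\<lambda>_. \<phi>' (\<pi> x)"])
          show "ball a b \<inter> ball y d \<noteq> {}" using a b(1) by (metis IntI centre_in_ball empty_iff)
          show "\<phi>' (\<pi> u) = \<phi>' (\<pi> x)" if "u \<in> ball a b \<inter> ball y d" for u
            using bspec[OF b(2), of u] that by simp
        qed (use w hol in auto)
      qed (use w d(3) xV' in auto)
      then have "y \<in> A" unfolding A_def using y1 d(1,2) by blast
      then show False using y by blast
    qed
    then show "\<exists>d>0. ball y d \<subseteq> ball 0 1 - A" using d by blast
  qed
  have xA: "x \<in> A"
  proof -
    obtain d where d: "0 < d" "ball x d \<subseteq> ball 0 1" by (rule openE[OF open_ball x])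
    have "ball x (min d e) \<subseteq> ball 0 1" using d by auto
    moreover have "\<forall>w\<in>ball x (min d e). \<pi> w = \<pi> x" using const by simp
    moreover have "0 < min d e" using d(1) e(1) by simp
    ultimately show ?thesis unfolding A_def using x by blast
  qed
  have "A \<inter> ball 0 1 = {} \<or> (ball 0 1 - A) \<inter> ball 0 1 = {}"
    by (rule connectedD[OF connected_ball opA opB]) auto
  then have sub: "ball 0 1 \<subseteq> A" using xA x by blast
  have all: "\<pi> w = \<pi> x" if w: "w \<in> ball 0 1" for w
  proof -
    have "w \<in> A" using sub w by blast
    then obtain d where "0 < d" "\<forall>u\<in>ball w d. \<pi> u = \<pi> x" unfolding A_def by blast
    then show ?thesis by (metis centre_in_ball)
  qed
  then have "C = {\<pi> x}" using image_\<pi> x by (metis (no_types, lifting) equals0D image_cong image_constant_conv)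
  then have "openin (topol X) {\<pi> x}" using incl_open[OF C_open] by simp
  then have "open (\<phi> ` {\<pi> x})" by (rule chart_image_open[OF X V]) (use xV in simp)
  then show False using not_open_singleton[of "\<phi> (\<pi> x)"] by simp
qed

text \<open>As the disc has ramification 1, the covering condition says that
  \<open>ramif X' (\<pi> x)\<close> is the local degree. The latter is a definite description over
  the charts of \<open>Y\<close>; it is meaningful because each of them yields the order
  \<open>N\<close> computed in a chart of \<open>X\<close>.\<close>

lemma zorder_chart:
  assumes x: "x \<in> ball 0 1" and V: "(V, \<phi>) \<in> charts X" "\<pi> x \<in> V"
  shows "zorder (\<lambda>w. \<phi> (\<pi> w) - \<phi> (\<pi> x)) x = int (ramif X' (\<pi> x))"
proof -
  define N where "N = zorder (\<lambda>w. \<phi> (\<pi> w) - \<phi> (\<pi> x)) x"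
  obtain e where e: "0 < e" "ball x e \<subseteq> ball 0 1" "\<pi> ` ball x e \<subseteq> V"
    by (rule ball_in_preimage[OF \<pi>_continuous chart_inj(1)[OF X V(1)] x V(2)])
  have hol: "(\<lambda>w. \<phi> (\<pi> w) - \<phi> (\<pi> x)) holomorphic_on ball x e"
    by (intro holomorphic_intros holomorphic_on_subset[OF chart_holomorphic[OF V(1)]]) (use e in blast)
  have "\<exists>w\<in>ball x e. \<phi> (\<pi> w) - \<phi> (\<pi> x) \<noteq> 0"
    using not_constant[OF x V(1) e(1,3)] by auto
  from zorder_exist_zero[OF hol open_ball connected_ball _ this] e(1) have "0 < N"
    by (simp add: N_def)
  have eq: "zorder (\<lambda>w. \<psi> (\<pi> w) - \<psi> (\<pi> x)) x = N" if U: "(U, \<psi>) \<in> charts X'" "\<pi> x \<in> U" for U \<psi>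
  proof -
    obtain e B \<tau> where e: "0 < e" "ball x e \<subseteq> ball 0 1" "\<pi> ` ball x e \<subseteq> U \<inter> V"
      "(\<lambda>w. \<psi> (\<pi> w)) holomorphic_on ball x e" "(\<lambda>w. \<psi> (\<pi> w)) ` ball x e \<subseteq> B"
      "open B" "\<tau> holomorphic_on B" "inj_on \<tau> B" "\<forall>w\<in>ball x e. \<tau> (\<psi> (\<pi> w)) = \<phi> (\<pi> w)"
      by (rule common_disc[OF x U V]) (rule that)
    have eV: "\<pi> ` ball x e \<subseteq> V" using e(3) by blast
    have xe: "x \<in> ball x e" using e(1) by simp
    have nc: "\<exists>w\<in>ball x e. \<psi> (\<pi> w) \<noteq> \<psi> (\<pi> x)"
    proof -
      obtain w where w: "w \<in> ball x e" "\<phi> (\<pi> w) \<noteq> \<phi> (\<pi> x)" using not_constant[OF x V(1) e(1) eV] by blast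
      then have "\<psi> (\<pi> w) \<noteq> \<psi> (\<pi> x)" using bspec[OF e(9) w(1)] bspec[OF e(9) xe] by metis
      then show ?thesis using w(1) by blast
    qed
    have "zorder (\<lambda>w. \<tau> (\<psi> (\<pi> w)) - \<tau> (\<psi> (\<pi> x))) x = zorder (\<lambda>w. \<psi> (\<pi> w) - \<psi> (\<pi> x)) x"
      by (rule zorder_injective_compose[OF e(7,6,8,4) open_ball connected_ball xe e(5) nc])
    moreover have "zorder (\<lambda>w. \<tau> (\<psi> (\<pi> w)) - \<tau> (\<psi> (\<pi> x))) x = N"
      unfolding N_def
    proof (rule zorder_cong)
      have "eventually (\<lambda>w. w \<in> ball x e) (at x)" using open_ball xe by (rule eventually_at_in_open')
      then show "eventually (\<lambda>w. \<tau> (\<psi> (\<pi> w)) - \<tau> (\<psi> (\<pi> x)) = \<phi> (\<pi> w) - \<phi> (\<pi> x)) (at x)"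
        by eventually_elim (use bspec[OF e(9)] xe in simp)
    qed simp
    ultimately show ?thesis by simp
  qed
  have xU: "\<pi> x \<in> C" by (rule \<pi>_in_C[OF x])
  have inv: "inv_into (ball 0 1) (\<lambda>z. z) w = w" if "w \<in> ball 0 1" for w :: complex
    using inv_into_f_f[of "\<lambda>z. z" "ball 0 1" w] that by (simp add: inj_on_def)
  have zid: "zorder (\<lambda>w. \<psi> (\<pi> (inv_into (ball 0 1) (\<lambda>z. z) w)) - \<psi> (\<pi> x)) x = zorder (\<lambda>w. \<psi> (\<pi> w) - \<psi> (\<pi> x)) x"
    for \<psi> :: "'a \<Rightarrow> complex"
  proof (rule zorder_cong)
    have "eventually (\<lambda>w. w \<in> ball 0 1) (at x)" using open_ball x by (rule eventually_at_in_open')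
    then show "eventually (\<lambda>w. \<psi> (\<pi> (inv_into (ball 0 1) (\<lambda>z. z) w)) - \<psi> (\<pi> x) = \<psi> (\<pi> w) - \<psi> (\<pi> x)) (at x)"
      by eventually_elim (simp add: inv)
  qed simp
  have "local_degree unit_disc Y \<pi> x = nat N"
    unfolding local_degree_def
  proof (rule the_equality)
    have "\<pi> x \<in> points X'" using xU C_subset by blast
    then obtain U \<psi> where U: "(U, \<psi>) \<in> charts X'" "\<pi> x \<in> U" by (rule chart_at[OF X'])
    have "(U \<inter> C, \<psi>) \<in> charts Y" using U(1) by (force simp: surface_restrict_def)
    moreover have "int (nat N) = zorder (\<lambda>w. \<psi> (\<pi> (inv_into (ball 0 1) (\<lambda>z. z) w)) - \<psi> (\<pi> x)) x"
      using \<open>0 < N\<close> eq[OF U] zid by simp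
    ultimately show "\<exists>U \<phi> V \<psi>. (U, \<phi>) \<in> charts unit_disc \<and> x \<in> U \<and> (V, \<psi>) \<in> charts Y \<and> \<pi> x \<in> V \<and>
        int (nat N) = zorder (\<lambda>w. \<psi> (\<pi> (inv_into U \<phi> w)) - \<psi> (\<pi> x)) (\<phi> x)"
      using U(2) xU x
      by (intro exI[of _ "ball 0 1"] exI[of _ "\<lambda>z. z"] exI[of _ "U \<inter> C"] exI[of _ \<psi>]) (simp add: unit_disc_def)
  next
    fix n
    assume "\<exists>U \<phi> V \<psi>. (U, \<phi>) \<in> charts unit_disc \<and> x \<in> U \<and> (V, \<psi>) \<in> charts Y \<and> \<pi> x \<in> V \<and>
        int n = zorder (\<lambda>w. \<psi> (\<pi> (inv_into U \<phi> w)) - \<psi> (\<pi> x)) (\<phi> x)"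
    then obtain U \<phi>0 V0 \<psi> where *: "(U, \<phi>0) \<in> charts unit_disc" "(V0, \<psi>) \<in> charts Y" "\<pi> x \<in> V0"
        "int n = zorder (\<lambda>w. \<psi> (\<pi> (inv_into U \<phi>0 w)) - \<psi> (\<pi> x)) (\<phi>0 x)" by blast
    have U: "U = ball 0 1" "\<phi>0 = (\<lambda>z. z)" using *(1) by (auto simp: unit_disc_def)
    obtain U' where U': "(U', \<psi>) \<in> charts X'" "V0 = U' \<inter> C" using *(2) by (auto simp: surface_restrict_def)
    have "int n = N" using *(3,4) eq[OF U'(1)] U'(2) zid[of \<psi>] unfolding U by simp
    then show "n = nat N" by simp
  qed
  moreover have "ramif Y (\<pi> x) = local_degree unit_disc Y \<pi> x * ramif unit_disc x"
    using covering x by (simp add: orbifold_covering_map_def unit_disc_def)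
  ultimately have "ramif X' (\<pi> x) = nat N" by (simp add: surface_restrict_def unit_disc_def)
  then show ?thesis using \<open>0 < N\<close> by (simp add: N_def)
qed

text \<open>A connected set over the small coordinate disc \<open>U0\<close> lies in one component
  \<open>D\<close> of the preimage of \<open>U\<close>. Since \<pi> is proper on \<open>D\<close>,
  the points of \<open>D\<close> over the compact closed coordinate disc \<open>L\<close> form a
  compact subset of the unit disc.\<close>

lemma bounded_lifts:
  assumes p: "p \<in> C"
  shows "\<exists>U. openin (topol X) U \<and> p \<in> U \<and>
    (\<forall>A. connected A \<longrightarrow> A \<subseteq> ball 0 1 \<longrightarrow> \<pi> ` A \<subseteq> U \<longrightarrow> (\<exists>r<1. A \<subseteq> cball 0 r))"
proof -
  obtain U where U: "openin (topol X) U" "p \<in> U" "U \<subseteq> C"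
    "\<forall>D\<in>connected_components_of (top_of_set {x \<in> ball 0 1. \<pi> x \<in> U}).
       \<pi> ` D = U \<and> proper_map (top_of_set D) (subtopology (topol X) U) \<pi>"
    by (rule covered_nhd[OF p]) (rule that)
  have "p \<in> points X" using p C_subset subset by blast
  then obtain V \<phi> where V: "(V, \<phi>) \<in> charts X" "p \<in> V" by (rule chart_at[OF X])
  note inj = chart_inj[OF X V(1)]
  have "openin (topol X) (U \<inter> V)" using U(1) inj(1) by (rule openin_Int)
  then have "open (\<phi> ` (U \<inter> V))" by (rule chart_image_open[OF X V(1)]) auto
  moreover have "\<phi> p \<in> \<phi> ` (U \<inter> V)" using U(2) V(2) by blast
  ultimately obtain e where e: "0 < e" "cball (\<phi> p) e \<subseteq> \<phi> ` (U \<inter> V)"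
    using open_contains_cball by blast
  define L where "L = inv_into V \<phi> ` cball (\<phi> p) e"
  have eV: "cball (\<phi> p) e \<subseteq> \<phi> ` V" using e(2) by blast
  have "compactin (top_of_set (\<phi> ` V)) (cball (\<phi> p) e)"
    using eV by (simp add: compactin_subtopology)
  then have L: "compactin (topol X) L"
    unfolding L_def by (rule image_compactin[OF _ chart_inverse(1)[OF X V(1)]])
  have LU: "L \<subseteq> U"
  proof
    fix y assume "y \<in> L"
    then obtain c where c: "c \<in> cball (\<phi> p) e" "y = inv_into V \<phi> c" unfolding L_def by blast
    then obtain v where v: "v \<in> U \<inter> V" "c = \<phi> v" using e(2) by blast
    then show "y \<in> U" using c(2) inj(2) by simp
  qed
  define U0 where "U0 = {v \<in> V. \<phi> v \<in> ball (\<phi> p) e}"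
  have U0L: "U0 \<subseteq> L"
  proof
    fix v assume v: "v \<in> U0"
    then have "v = inv_into V \<phi> (\<phi> v)" using inj(2) by (simp add: U0_def)
    moreover have "\<phi> v \<in> cball (\<phi> p) e" using v by (simp add: U0_def)
    ultimately show "v \<in> L" unfolding L_def by (rule image_eqI)
  qed
  show ?thesis
  proof (intro exI[of _ U0] conjI allI impI)
    show "openin (topol X) U0" unfolding U0_def by (rule chart_preimage_open[OF X V(1)]) simp
    show "p \<in> U0" using V(2) e(1) by (simp add: U0_def)
    fix A :: "complex set" assume A: "connected A" "A \<subseteq> ball 0 1" "\<pi> ` A \<subseteq> U0"
    show "\<exists>r<1. A \<subseteq> cball 0 r"
    proof (cases "A = {}")
      case True
      then show ?thesis by (intro exI[of _ 0]) auto
    next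
      case False
      then obtain a where a: "a \<in> A" by blast
      let ?P = "{x \<in> ball 0 1. \<pi> x \<in> U}"
      have AP: "A \<subseteq> ?P"
      proof
        fix b assume b: "b \<in> A"
        then have "\<pi> b \<in> U0" using A(3) by (rule subsetD[OF _ imageI, rotated])
        then have "\<pi> b \<in> U" using U0L LU by (meson subsetD)
        then show "b \<in> ?P" using b A(2) by simp (meson mem_ball_0 subsetD)
      qed
      have conA: "connectedin (top_of_set ?P) A" using A(1) AP by (simp add: connectedin_subtopology)
      define D where "D = connected_component_of_set (top_of_set ?P) a"
      have aP: "a \<in> topspace (top_of_set ?P)" using a AP by auto
      have D: "D \<in> connected_components_of (top_of_set ?P)"
        unfolding D_def connected_components_of_def using aP by blast
      have AD: "A \<subseteq> D" unfolding D_def by (rule connected_component_of_maximal[OF conA a])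
      have pm: "proper_map (top_of_set D) (subtopology (topol X) U) \<pi>" using bspec[OF U(4) D] by (rule conjunct2)
      have "compactin (subtopology (topol X) U) L" using L LU by (simp add: compactin_subtopology)
      from compactin_proper_map_preimage[OF pm this]
      have "compactin (top_of_set D) {x \<in> topspace (top_of_set D). \<pi> x \<in> L}" .
      then have K: "compact {x \<in> D. \<pi> x \<in> L}" by (simp add: compactin_subtopology)
      have AK: "A \<subseteq> {x \<in> D. \<pi> x \<in> L}"
      proof
        fix b assume b: "b \<in> A"
        then have "\<pi> b \<in> U0" using A(3) by (rule subsetD[OF _ imageI, rotated])
        then show "b \<in> {x \<in> D. \<pi> x \<in> L}" using b AD U0L by (simp add: subsetD)
      qed
      have "continuous_on {x \<in> D. \<pi> x \<in> L} cmod" by (intro continuous_intros)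
      then obtain m where m: "m \<in> {x \<in> D. \<pi> x \<in> L}" "\<forall>y\<in>{x \<in> D. \<pi> x \<in> L}. cmod y \<le> cmod m"
        using continuous_attains_sup[OF K _ \<open>continuous_on _ cmod\<close>] subsetD[OF AK a] by (metis (no_types, lifting) empty_iff)
      have "D \<subseteq> ball 0 1" using connected_components_of_subset[OF D] by auto
      then have "cmod m < 1" using m(1) by auto
      moreover have "A \<subseteq> cball 0 (cmod m)"
      proof
        fix b assume "b \<in> A"
        then show "b \<in> cball 0 (cmod m)" using bspec[OF m(2) subsetD[OF AK]] by simp
      qed
      ultimately show ?thesis by blast
    qed
  qed
qed

lemma disc_cover: "disc_cover X (ramif X') \<pi>"
  unfolding disc_cover_def
proof (intro conjI ballI)
  show "continuous_map (top_of_set (ball 0 1)) (topol X) \<pi>" by (rule \<pi>_continuous)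
  show "\<exists>U. openin (topol X) U \<and> p \<in> U \<and>
    (\<forall>A. connected A \<longrightarrow> A \<subseteq> ball 0 1 \<longrightarrow> \<pi> ` A \<subseteq> U \<longrightarrow> (\<exists>r<1. A \<subseteq> cball 0 r))" if "p \<in> \<pi> ` ball 0 1" for p
  proof (rule bounded_lifts)
    show "p \<in> C" using that by (simp only: image_\<pi>)
  qed
  fix x :: complex and c assume x: "x \<in> ball 0 1" and c: "c \<in> charts X"
  obtain V \<phi> where Vc: "c = (V, \<phi>)" by (metis surj_pair)
  have "0 < ramif X' (\<pi> x) \<and> (\<exists>e>0. \<exists>\<xi>. ball x e \<subseteq> ball 0 1 \<and> \<pi> ` ball x e \<subseteq> V \<and> \<xi> holomorphic_on ball x e \<and>
           inj_on \<xi> (ball x e) \<and> \<xi> x = 0 \<and> (\<forall>w\<in>ball x e. \<phi> (\<pi> w) = \<phi> (\<pi> x) + \<xi> w ^ ramif X' (\<pi> x)))"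
    if xV: "\<pi> x \<in> V"
  proof -
    have V: "(V, \<phi>) \<in> charts X" using c Vc by simp
    obtain e where e: "0 < e" "ball x e \<subseteq> ball 0 1" "\<pi> ` ball x e \<subseteq> V"
      by (rule ball_in_preimage[OF \<pi>_continuous chart_inj(1)[OF X V(1)] x xV])
    have hol: "(\<lambda>w. \<phi> (\<pi> w)) holomorphic_on ball x e"
      by (rule holomorphic_on_subset[OF chart_holomorphic[OF V(1)]]) (use e in blast)
    have xe: "x \<in> ball x e" using e(1) by simp
    show ?thesis
    proof (rule local_power_form[OF hol open_ball connected_ball xe not_constant[OF x V e(1,3)] zorder_chart[OF x V xV]])
      fix d \<xi>
      assume d: "0 < ramif X' (\<pi> x)" "0 < d" "ball x d \<subseteq> ball x e" "\<xi> holomorphic_on ball x d" "inj_on \<xi> (ball x d)"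
        "\<xi> x = 0" and eq: "\<And>w. w \<in> ball x d \<Longrightarrow> \<phi> (\<pi> w) = \<phi> (\<pi> x) + \<xi> w ^ ramif X' (\<pi> x)"
      have "ball x d \<subseteq> ball 0 1" "\<pi> ` ball x d \<subseteq> V" using d(3) e(2,3) by blast+
      then show ?thesis using d eq by blast
    qed
  qed
  then show "case c of (V, \<phi>) \<Rightarrow> \<pi> x \<in> V \<longrightarrow> 0 < ramif X' (\<pi> x) \<and>
        (\<exists>e>0. \<exists>\<xi>. ball x e \<subseteq> ball 0 1 \<and> \<pi> ` ball x e \<subseteq> V \<and> \<xi> holomorphic_on ball x e \<and>
           inj_on \<xi> (ball x e) \<and> \<xi> x = 0 \<and> (\<forall>w\<in>ball x e. \<phi> (\<pi> w) = \<phi> (\<pi> x) + \<xi> w ^ ramif X' (\<pi> x)))"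
    unfolding Vc by simp
qed

end


section \<open>The density of a covering\<close>

lemma compact_in_disc:
  assumes "compact K" "K \<subseteq> ball (0::complex) 1"
  obtains r where "0 \<le> r" "r < 1" "K \<subseteq> cball 0 r"
proof (cases "K = {}")
  case True
  then show ?thesis using that[of 0] by simp
next
  case False
  have "continuous_on K cmod" by (intro continuous_intros)
  from continuous_attains_sup[OF assms(1) False this] obtain m where m: "m \<in> K" "\<forall>y\<in>K. cmod y \<le> cmod m"
    by blast
  have "cmod m < 1" using m(1) assms(2) by auto
  moreover have "K \<subseteq> cball 0 (cmod m)" using m(2) by auto
  ultimately show ?thesis using that[of "cmod m"] by simp
qed

section \<open>Automorphisms of the disc and change of base point\<close>

lemma Moebius_in_disc: "cmod a < 1 \<Longrightarrow> w \<in> ball 0 1 \<Longrightarrow> Moebius_function 0 a w \<in> ball 0 1"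
  using Moebius_function_norm_lt_1 by simp

lemma Moebius_inverse:
  assumes "cmod a < 1" "w \<in> ball 0 1"
  shows "Moebius_function 0 (- a) (Moebius_function 0 a w) = w" "Moebius_function 0 a (Moebius_function 0 (- a) w) = w"
  using Moebius_function_compose[of "- a" a w] Moebius_function_compose[of a "- a" w] assms by auto

lemma Moebius_image:
  assumes "cmod a < 1"
  shows "Moebius_function 0 a ` ball 0 1 = ball 0 1"
proof
  show "Moebius_function 0 a ` ball 0 1 \<subseteq> ball 0 1" using Moebius_in_disc[OF assms] by blast
  show "ball 0 1 \<subseteq> Moebius_function 0 a ` ball 0 1"
  proof
    fix w :: complex assume w: "w \<in> ball 0 1"
    have "Moebius_function 0 (- a) w \<in> ball 0 1" by (rule Moebius_in_disc) (use assms w in auto)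
    then show "w \<in> Moebius_function 0 a ` ball 0 1"
      using Moebius_inverse(2)[OF assms w] by (metis imageI)
  qed
qed

lemma Moebius_continuous: "cmod a < 1 \<Longrightarrow> continuous_on (ball 0 1) (Moebius_function 0 a)"
  by (intro holomorphic_on_imp_continuous_on Moebius_function_holomorphic)

text \<open>Precomposition with an automorphism puts a prescribed fibre point at \<open>0\<close>,
  so that Schwarz lemmas and continuation from the centre apply.\<close>

lemma disc_cover_Moebius:
  assumes cov: "disc_cover X \<nu> \<pi>" and a: "cmod a < 1"
  shows "disc_cover X \<nu> (\<lambda>w. \<pi> (Moebius_function 0 a w))"
    "(\<lambda>w. \<pi> (Moebius_function 0 a w)) ` ball 0 1 = \<pi> ` ball 0 1"
proof -
  let ?M = "Moebius_function 0 a"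
  show im: "(\<lambda>w. \<pi> (?M w)) ` ball 0 1 = \<pi> ` ball 0 1"
    using Moebius_image[OF a] by (simp add: image_image[symmetric])
  have Mc: "continuous_map (top_of_set (ball 0 1)) (top_of_set (ball 0 1)) ?M"
    using Moebius_continuous[OF a] Moebius_in_disc[OF a] by (simp add: continuous_map_in_subtopology Pi_iff)
  have Minj: "inj_on ?M (ball 0 1)" using Moebius_inverse(1)[OF a] by (rule inj_on_inverseI)
  show "disc_cover X \<nu> (\<lambda>w. \<pi> (?M w))"
    unfolding disc_cover_def im
  proof (intro conjI ballI)
    show "continuous_map (top_of_set (ball 0 1)) (topol X) (\<lambda>w. \<pi> (?M w))"
      using continuous_map_compose[OF Mc disc_coverD(1)[OF cov]] by (simp add: o_def)
  next
    fix x :: complex and c assume x: "x \<in> ball 0 1" and c: "c \<in> charts X"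
    obtain V \<phi> where Vc: "c = (V, \<phi>)" by (metis surj_pair)
    have "0 < \<nu> (\<pi> (?M x)) \<and> (\<exists>e>0. \<exists>\<xi>. ball x e \<subseteq> ball 0 1 \<and> (\<lambda>w. \<pi> (?M w)) ` ball x e \<subseteq> V \<and> \<xi> holomorphic_on ball x e \<and>
       inj_on \<xi> (ball x e) \<and> \<xi> x = 0 \<and> (\<forall>w\<in>ball x e. \<phi> (\<pi> (?M w)) = \<phi> (\<pi> (?M x)) + \<xi> w ^ \<nu> (\<pi> (?M x))))"
      if xV: "\<pi> (?M x) \<in> V"
    proof -
      have V: "(V, \<phi>) \<in> charts X" using c Vc by simp
      obtain e \<xi> where n: "0 < \<nu> (\<pi> (?M x))" and e: "0 < e" "ball (?M x) e \<subseteq> ball 0 1" "\<pi> ` ball (?M x) e \<subseteq> V"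
        and \<xi>: "\<xi> holomorphic_on ball (?M x) e" "inj_on \<xi> (ball (?M x) e)" "\<xi> (?M x) = 0"
        "\<forall>w\<in>ball (?M x) e. \<phi> (\<pi> w) = \<phi> (\<pi> (?M x)) + \<xi> w ^ \<nu> (\<pi> (?M x))"
        by (rule disc_cover_normal_form[OF cov Moebius_in_disc[OF a x] V xV]) (rule that)
      have "open (ball 0 1 \<inter> ?M -` ball (?M x) e)"
        by (intro continuous_open_preimage Moebius_continuous a) auto
      moreover have "x \<in> ball 0 1 \<inter> ?M -` ball (?M x) e" using x e(1) by simp
      ultimately obtain d where d: "0 < d" "ball x d \<subseteq> ball 0 1 \<inter> ?M -` ball (?M x) e" by (rule openE)
      have Md: "?M w \<in> ball (?M x) e" if "w \<in> ball x d" for w using d(2) that by blast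
      have d1: "ball x d \<subseteq> ball 0 1" using d(2) by blast
      show ?thesis
      proof (rule conjI[OF n], rule exI[of _ d], rule conjI[OF d(1)], rule exI[of _ "\<lambda>w. \<xi> (?M w)"], intro conjI)
        show "(\<lambda>w. \<pi> (?M w)) ` ball x d \<subseteq> V" using Md e(3) by blast
        have "\<xi> \<circ> ?M holomorphic_on ball x d"
        proof (rule holomorphic_on_compose_gen[OF _ \<xi>(1)])
          show "?M holomorphic_on ball x d" by (rule holomorphic_on_subset[OF Moebius_function_holomorphic[OF a] d1])
          show "?M ` ball x d \<subseteq> ball (?M x) e" using Md by blast
        qed
        then show "(\<lambda>w. \<xi> (?M w)) holomorphic_on ball x d" by (simp add: o_def)
        show "inj_on (\<lambda>w. \<xi> (?M w)) (ball x d)"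
        proof (rule inj_onI)
          fix u v assume uv: "u \<in> ball x d" "v \<in> ball x d" "\<xi> (?M u) = \<xi> (?M v)"
          have "?M u = ?M v" by (rule inj_onD[OF \<xi>(2) uv(3) Md[OF uv(1)] Md[OF uv(2)]])
          then show "u = v" by (rule inj_onD[OF Minj]) (use uv d1 in blast)+
        qed
        show "\<forall>w\<in>ball x d. \<phi> (\<pi> (?M w)) = \<phi> (\<pi> (?M x)) + \<xi> (?M w) ^ \<nu> (\<pi> (?M x))"
          using bspec[OF \<xi>(4) Md] by blast
      qed (use d1 \<xi>(3) in auto)
    qed
    then show "case c of (V, \<phi>) \<Rightarrow> \<pi> (?M x) \<in> V \<longrightarrow> 0 < \<nu> (\<pi> (?M x)) \<and> (\<exists>e>0. \<exists>\<xi>. ball x e \<subseteq> ball 0 1 \<and> (\<lambda>w. \<pi> (?M w)) ` ball x e \<subseteq> V \<and> \<xi> holomorphic_on ball x e \<and>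
       inj_on \<xi> (ball x e) \<and> \<xi> x = 0 \<and> (\<forall>w\<in>ball x e. \<phi> (\<pi> (?M w)) = \<phi> (\<pi> (?M x)) + \<xi> w ^ \<nu> (\<pi> (?M x))))"
      unfolding Vc by simp
  next
    fix p assume p: "p \<in> \<pi> ` ball 0 1"
    obtain U where U: "openin (topol X) U" "p \<in> U"
      "\<forall>A. connected A \<longrightarrow> A \<subseteq> ball 0 1 \<longrightarrow> \<pi> ` A \<subseteq> U \<longrightarrow> (\<exists>r<1. A \<subseteq> cball 0 r)"
      by (rule disc_cover_bounded_lifts[OF cov p]) (rule that)
    show "\<exists>U. openin (topol X) U \<and> p \<in> U \<and>
        (\<forall>A. connected A \<longrightarrow> A \<subseteq> ball 0 1 \<longrightarrow> (\<lambda>w. \<pi> (?M w)) ` A \<subseteq> U \<longrightarrow> (\<exists>r<1. A \<subseteq> cball 0 r))"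
    proof (intro exI[of _ U] conjI allI impI U(1,2))
      fix A assume A: "connected A" "A \<subseteq> ball 0 1" "(\<lambda>w. \<pi> (?M w)) ` A \<subseteq> U"
      have "connected (?M ` A)"
        by (rule connected_continuous_image[OF continuous_on_subset[OF Moebius_continuous[OF a] A(2)] A(1)])
      moreover have "?M ` A \<subseteq> ball 0 1" using Moebius_in_disc[OF a] A(2) by blast
      moreover have "\<pi> ` ?M ` A \<subseteq> U" using A(3) by (simp add: image_image)
      ultimately obtain r where r: "r < 1" "?M ` A \<subseteq> cball 0 r" using U(3) by blast
      \<comment> \<open>The inverse automorphism carries the bound back: the image of the closed
        subdisc is a compact subset of the open disc.\<close>
      let ?N = "Moebius_function 0 (- a)"
      have ma: "cmod (- a) < 1" using a by simp
      have cb: "cball 0 r \<subseteq> ball (0::complex) 1" using r(1) by auto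
      have "compact (?N ` cball 0 r)"
        by (intro compact_continuous_image continuous_on_subset[OF Moebius_continuous[OF ma] cb]) simp
      moreover have "?N ` cball 0 r \<subseteq> ball 0 1" using Moebius_in_disc[OF ma] cb by blast
      ultimately obtain r' where r': "0 \<le> r'" "r' < 1" "?N ` cball 0 r \<subseteq> cball 0 r'" by (rule compact_in_disc)
      have "A \<subseteq> cball 0 r'"
      proof
        fix w assume w: "w \<in> A"
        then have "w = ?N (?M w)" using Moebius_inverse(1)[OF a] A(2) by (metis subsetD)
        moreover have "?M w \<in> cball 0 r" using r(2) w by blast
        ultimately show "w \<in> cball 0 r'" using r'(3) by (metis imageI subsetD)
      qed
      then show "\<exists>r<1. A \<subseteq> cball 0 r" using r'(2) by blast
    qed
  qed
qed

context
  fixes X :: "('a, 'm) surface_scheme" and \<nu> :: "'a \<Rightarrow> nat" and \<pi> :: "complex \<Rightarrow> 'a"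
  assumes X: "riemann_surface X" and cov: "disc_cover X \<nu> \<pi>"
begin

section \<open>Derivatives and openness of a covering\<close>

lemma cover_holomorphic:
  assumes "x \<in> ball 0 1" "(V, \<phi>) \<in> charts X" "\<pi> x \<in> V"
  obtains e where "0 < e" "ball x e \<subseteq> ball 0 1" "\<pi> ` ball x e \<subseteq> V" "(\<lambda>w. \<phi> (\<pi> w)) holomorphic_on ball x e"
proof -
  obtain e \<xi> where n: "0 < \<nu> (\<pi> x)" and e: "0 < e" "ball x e \<subseteq> ball 0 1" "\<pi> ` ball x e \<subseteq> V"
    and \<xi>: "\<xi> holomorphic_on ball x e" "inj_on \<xi> (ball x e)" "\<xi> x = 0"
    "\<forall>w\<in>ball x e. \<phi> (\<pi> w) = \<phi> (\<pi> x) + \<xi> w ^ \<nu> (\<pi> x)"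
    by (rule disc_cover_normal_form[OF cov assms]) (rule that)
  have "(\<lambda>w. \<phi> (\<pi> x) + \<xi> w ^ \<nu> (\<pi> x)) holomorphic_on ball x e"
    using \<xi>(1) by (intro holomorphic_intros)
  then have "(\<lambda>w. \<phi> (\<pi> w)) holomorphic_on ball x e"
    by (rule holomorphic_transform) (use \<xi>(4) in simp)
  with e show ?thesis by (rule that)
qed

lemma cover_has_derivative:
  assumes "x \<in> ball 0 1" "(V, \<phi>) \<in> charts X" "\<pi> x \<in> V"
  shows "((\<lambda>w. \<phi> (\<pi> w)) has_field_derivative deriv (\<lambda>w. \<phi> (\<pi> w)) x) (at x)"
proof -
  obtain e where "0 < e" "(\<lambda>w. \<phi> (\<pi> w)) holomorphic_on ball x e"
    by (rule cover_holomorphic[OF assms]) (rule that)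
  then show ?thesis by (intro holomorphic_derivI) auto
qed

text \<open>The derivative of the normal form is \<open>\<nu> \<xi>^(\<nu>-1) \<xi>'\<close> with
  \<open>\<xi> x = 0\<close>, and \<open>\<xi>' \<noteq> 0\<close> since \<open>\<xi>\<close> is
  injective.\<close>

lemma cover_deriv_nonzero_iff:
  assumes "x \<in> ball 0 1" "(V, \<phi>) \<in> charts X" "\<pi> x \<in> V"
  shows "deriv (\<lambda>w. \<phi> (\<pi> w)) x \<noteq> 0 \<longleftrightarrow> \<nu> (\<pi> x) = 1"
proof -
  obtain e \<xi> where n: "0 < \<nu> (\<pi> x)" and e: "0 < e" "ball x e \<subseteq> ball 0 1" "\<pi> ` ball x e \<subseteq> V"
    and \<xi>: "\<xi> holomorphic_on ball x e" "inj_on \<xi> (ball x e)" "\<xi> x = 0"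
    "\<forall>w\<in>ball x e. \<phi> (\<pi> w) = \<phi> (\<pi> x) + \<xi> w ^ \<nu> (\<pi> x)"
    by (rule disc_cover_normal_form[OF cov assms]) (rule that)
  have xe: "x \<in> ball x e" using e(1) by simp
  have "(\<xi> has_field_derivative deriv \<xi> x) (at x)" by (rule holomorphic_derivI[OF \<xi>(1) open_ball xe])
  then have "((\<lambda>w. \<phi> (\<pi> x) + \<xi> w ^ \<nu> (\<pi> x)) has_field_derivative (of_nat (\<nu> (\<pi> x)) * \<xi> x ^ (\<nu> (\<pi> x) - 1) * deriv \<xi> x)) (at x)"
    by (auto intro!: derivative_eq_intros)
  then have "((\<lambda>w. \<phi> (\<pi> w)) has_field_derivative (of_nat (\<nu> (\<pi> x)) * \<xi> x ^ (\<nu> (\<pi> x) - 1) * deriv \<xi> x)) (at x)"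
    by (rule has_field_derivative_transform_within_open[OF _ open_ball xe]) (use \<xi>(4) in simp)
  then have eq: "deriv (\<lambda>w. \<phi> (\<pi> w)) x = of_nat (\<nu> (\<pi> x)) * \<xi> x ^ (\<nu> (\<pi> x) - 1) * deriv \<xi> x"
    by (rule DERIV_imp_deriv)
  have "deriv \<xi> x \<noteq> 0" by (rule holomorphic_injective_imp_regular[OF \<xi>(1) open_ball \<xi>(2) xe])
  then show ?thesis using n unfolding eq \<xi>(3) by (auto simp: power_0_left)
qed

lemma cover_open_map:
  assumes "open B" "B \<subseteq> ball 0 1"
  shows "openin (topol X) (\<pi> ` B)"
proof (subst openin_subopen, rule ballI)
  fix p assume "p \<in> \<pi> ` B"
  then obtain x where x: "x \<in> B" "p = \<pi> x" by blast
  have x1: "x \<in> ball 0 1" using x(1) assms(2) by blast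
  obtain V \<phi> where V: "(V, \<phi>) \<in> charts X" "\<pi> x \<in> V" by (rule chart_at[OF X disc_coverD(2)[OF cov x1]])
  obtain e \<xi> where n: "0 < \<nu> (\<pi> x)" and e: "0 < e" "ball x e \<subseteq> ball 0 1" "\<pi> ` ball x e \<subseteq> V"
    and \<xi>: "\<xi> holomorphic_on ball x e" "inj_on \<xi> (ball x e)" "\<xi> x = 0"
    "\<forall>w\<in>ball x e. \<phi> (\<pi> w) = \<phi> (\<pi> x) + \<xi> w ^ \<nu> (\<pi> x)"
    by (rule disc_cover_normal_form[OF cov x1 V]) (rule that)
  obtain d0 where d0: "0 < d0" "ball x d0 \<subseteq> B" by (rule openE[OF assms(1) x(1)])
  define d where "d = min d0 e"
  have d: "0 < d" "ball x d \<subseteq> B" "ball x d \<subseteq> ball x e" using d0 e(1) by (auto simp: d_def)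
  let ?F = "\<lambda>w. \<phi> (\<pi> x) + \<xi> w ^ \<nu> (\<pi> x)"
  have "open (?F ` ball x d)"
  proof (rule open_mapping_thm[OF _ open_ball connected_ball open_ball order.refl])
    show "?F holomorphic_on ball x d"
      using holomorphic_on_subset[OF \<xi>(1) d(3)] by (intro holomorphic_intros)
    show "\<not> ?F constant_on ball x d"
    proof
      assume "?F constant_on ball x d"
      then obtain c where c: "\<forall>w\<in>ball x d. ?F w = c" unfolding constant_on_def by blast
      let ?u = "x + of_real (d/2)"
      have u: "?u \<in> ball x d" "?u \<noteq> x" using d(1) by (auto simp: dist_norm)
      have "?F ?u = ?F x" using c u(1) d(1) by (metis centre_in_ball)
      then have "\<xi> ?u = \<xi> x" using \<xi>(3) n by (simp add: zero_power)
      then show False using inj_onD[OF \<xi>(2), of ?u x] u d(3) e(1) by auto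
    qed
  qed
  moreover have "?F ` ball x d = \<phi> ` \<pi> ` ball x d"
    unfolding image_image using \<xi>(4) d(3) by (intro image_cong) auto
  ultimately have "openin (topol X) {v \<in> V. \<phi> v \<in> \<phi> ` \<pi> ` ball x d}"
    using chart_preimage_open[OF X V(1)] by simp
  moreover have "{v \<in> V. \<phi> v \<in> \<phi> ` \<pi> ` ball x d} = \<pi> ` ball x d"
  proof -
    have "\<pi> ` ball x d \<subseteq> V" using d(3) e(3) by blast
    then show ?thesis using inj_on_image_mem_iff[OF chart_inj(2)[OF X V(1)]] by blast
  qed
  moreover have "p \<in> \<pi> ` ball x d" using x(2) d(1) by auto
  moreover have "\<pi> ` ball x d \<subseteq> \<pi> ` B" using d(2) by blast
  ultimately show "\<exists>T. openin (topol X) T \<and> p \<in> T \<and> T \<subseteq> \<pi> ` B" by metis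
qed

end

text \<open>If \<open>\<nu>1 = k \<nu>2\<close> at a point, then the \<open>\<nu>1\<close>-th power
  of \<open>\<xi>\<close> is the \<open>\<nu>2\<close>-th power of \<open>\<xi>^k\<close>:
  divisibility of the ramification is exactly what lifting requires locally.\<close>

lemma cover_lift:
  assumes X: "riemann_surface X" and c1: "disc_cover X \<nu>1 \<pi>1" and c2: "disc_cover X \<nu>2 \<pi>2"
    and s: "0 < s" "s \<le> 1" and im: "\<pi>1 ` ball 0 s \<subseteq> \<pi>2 ` ball 0 1"
    and dv: "\<And>x. x \<in> ball 0 s \<Longrightarrow> \<nu>2 (\<pi>1 x) dvd \<nu>1 (\<pi>1 x)"
    and y0: "y0 \<in> ball 0 1" "\<pi>2 y0 = \<pi>1 0"
  obtains h where "h holomorphic_on ball 0 s" "h 0 = y0" "\<And>w. w \<in> ball 0 s \<Longrightarrow> h w \<in> ball 0 1"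
    "\<And>w. w \<in> ball 0 s \<Longrightarrow> \<pi>2 (h w) = \<pi>1 w"
proof -
  have s1: "ball 0 s \<subseteq> ball (0::complex) 1" using s(2) by auto
  interpret lifting_problem X \<nu>2 \<pi>2 \<pi>1 s
  proof
    show "continuous_map (top_of_set (ball 0 s)) (topol X) \<pi>1"
      using continuous_map_from_subtopology_mono[OF disc_coverD(1)[OF c1] s1] .
    fix x :: complex assume xs: "x \<in> ball 0 s"
    then have x: "x \<in> ball 0 1" using s1 by blast
    obtain V \<phi> where V: "(V, \<phi>) \<in> charts X" "\<pi>1 x \<in> V" by (rule chart_at[OF X disc_coverD(2)[OF c1 x]])
    obtain e \<xi> where n: "0 < \<nu>1 (\<pi>1 x)" and e: "0 < e" "ball x e \<subseteq> ball 0 1" "\<pi>1 ` ball x e \<subseteq> V"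
      and \<xi>: "\<xi> holomorphic_on ball x e" "inj_on \<xi> (ball x e)" "\<xi> x = 0"
      "\<forall>w\<in>ball x e. \<phi> (\<pi>1 w) = \<phi> (\<pi>1 x) + \<xi> w ^ \<nu>1 (\<pi>1 x)"
      by (rule disc_cover_normal_form[OF c1 x V]) (rule that)
    obtain k where k: "\<nu>1 (\<pi>1 x) = k * \<nu>2 (\<pi>1 x)" using dv[OF xs] by (metis dvd_div_mult_self)
    obtain d0 where d0: "0 < d0" "ball x d0 \<subseteq> ball 0 s" by (rule openE[OF open_ball xs])
    define d where "d = min d0 e"
    have d: "0 < d" "ball x d \<subseteq> ball 0 s" "ball x d \<subseteq> ball x e" using d0 e(1) by (auto simp: d_def)
    show "\<exists>V \<phi> e G. (V, \<phi>) \<in> charts X \<and> \<pi>1 x \<in> V \<and> 0 < e \<and> ball x e \<subseteq> ball 0 s \<and> \<pi>1 ` ball x e \<subseteq> V \<and>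
        G holomorphic_on ball x e \<and> (\<forall>w\<in>ball x e. \<phi> (\<pi>1 w) = \<phi> (\<pi>1 x) + G w ^ \<nu>2 (\<pi>1 x))"
    proof (intro exI conjI)
      show "(\<lambda>w. \<xi> w ^ k) holomorphic_on ball x d"
        using holomorphic_on_subset[OF \<xi>(1) d(3)] by (intro holomorphic_intros)
      show "\<forall>w\<in>ball x d. \<phi> (\<pi>1 w) = \<phi> (\<pi>1 x) + (\<xi> w ^ k) ^ \<nu>2 (\<pi>1 x)"
        using \<xi>(4) d(3) unfolding k by (auto simp: power_mult)
      show "\<pi>1 ` ball x d \<subseteq> V" using e(3) d(3) by blast
    qed (use V d in auto)
  qed (fact X c2 s(1) im)+
  show ?thesis using lift_exists[OF y0] that by blast
qed

lemma cover_lift_deriv: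
  assumes X: "riemann_surface X" and c1: "disc_cover X \<nu>1 \<pi>1" and c2: "disc_cover X \<nu>2 \<pi>2"
    and h: "h holomorphic_on ball 0 s" "x \<in> ball 0 s" "ball 0 s \<subseteq> ball (0::complex) 1" "\<And>w. w \<in> ball 0 s \<Longrightarrow> h w \<in> ball 0 1"
      "\<And>w. w \<in> ball 0 s \<Longrightarrow> \<pi>2 (h w) = \<pi>1 w"
    and V: "(V, \<phi>) \<in> charts X" "\<pi>1 x \<in> V"
  shows "deriv (\<lambda>w. \<phi> (\<pi>1 w)) x = deriv (\<lambda>w. \<phi> (\<pi>2 w)) (h x) * deriv h x"
proof -
  have V2: "\<pi>2 (h x) \<in> V" using V(2) h(5)[OF h(2)] by simp
  have "((\<lambda>w. \<phi> (\<pi>2 w)) has_field_derivative deriv (\<lambda>w. \<phi> (\<pi>2 w)) (h x)) (at (h x))"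
    by (rule cover_has_derivative[OF X c2 h(4)[OF h(2)] V(1) V2])
  moreover have "(h has_field_derivative deriv h x) (at x)" by (rule holomorphic_derivI[OF h(1) open_ball h(2)])
  ultimately have "((\<lambda>w. \<phi> (\<pi>2 (h w))) has_field_derivative deriv (\<lambda>w. \<phi> (\<pi>2 w)) (h x) * deriv h x) (at x)"
    by (rule DERIV_chain2)
  then have "((\<lambda>w. \<phi> (\<pi>1 w)) has_field_derivative deriv (\<lambda>w. \<phi> (\<pi>2 w)) (h x) * deriv h x) (at x)"
    by (rule has_field_derivative_transform_within_open[OF _ open_ball h(2)]) (simp add: h(5))
  then show ?thesis by (rule DERIV_imp_deriv)
qed

text \<open>The value in \<open>orbifold_density\<close> for one choice of the covering and of the
  point in the fibre.\<close>

definition cover_density :: "('a \<Rightarrow> complex) \<Rightarrow> (complex \<Rightarrow> 'a) \<Rightarrow> complex \<Rightarrow> ennreal" where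
  "cover_density \<phi> \<pi> x = ennreal (disc_density x) / ennreal (cmod (deriv (\<lambda>y. \<phi> (\<pi> y)) x))"

text \<open>Recentre \<open>\<pi>1\<close> at \<open>x1\<close>, lift it through
  \<open>\<pi>2\<close> to a self-map of the disc sending \<open>0\<close> to \<open>x2\<close>, and
  apply Schwarz-Pick at \<open>0\<close>. Exchanging the roles gives the opposite
  inequality.\<close>

lemma cover_deriv_le:
  assumes X: "riemann_surface X" and c: "disc_cover X \<nu> \<pi>1" "disc_cover X \<nu> \<pi>2"
    and im: "\<pi>1 ` ball 0 1 = \<pi>2 ` ball 0 1" and x: "x1 \<in> ball 0 1" "x2 \<in> ball 0 1" "\<pi>1 x1 = \<pi>2 x2"
    and V: "(V, \<phi>) \<in> charts X" "\<pi>1 x1 \<in> V"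
  shows "cmod (deriv (\<lambda>w. \<phi> (\<pi>1 w)) x1) * (1 - (cmod x1)\<^sup>2) \<le> cmod (deriv (\<lambda>w. \<phi> (\<pi>2 w)) x2) * (1 - (cmod x2)\<^sup>2)"
proof -
  let ?M = "Moebius_function 0 (- x1)"
  have x1: "cmod (- x1) < 1" "cmod x1 < 1" using x(1) by auto
  have M0: "?M 0 = x1" by (simp add: Moebius_function_of_zero)
  note cM = disc_cover_Moebius[OF c(1) x1(1)]
  have im': "(\<lambda>w. \<pi>1 (?M w)) ` ball 0 1 \<subseteq> \<pi>2 ` ball 0 1" unfolding cM(2) im by blast
  have "\<pi>2 x2 = \<pi>1 (?M 0)" using x(3) M0 by simp
  then obtain h where h: "h holomorphic_on ball 0 1" "h 0 = x2" "\<And>w. w \<in> ball 0 1 \<Longrightarrow> h w \<in> ball 0 1"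
    "\<And>w. w \<in> ball 0 1 \<Longrightarrow> \<pi>2 (h w) = \<pi>1 (?M w)"
    using cover_lift[OF X cM(1) c(2) zero_less_one order.refl im' dvd_refl x(2)] by blast
  have V': "\<pi>1 (?M 0) \<in> V" using V(2) M0 by simp
  have 0: "0 \<in> ball (0::complex) 1" by simp
  have e1: "deriv (\<lambda>w. \<phi> (\<pi>1 (?M w))) 0 = deriv (\<lambda>w. \<phi> (\<pi>2 w)) x2 * deriv h 0"
    using cover_lift_deriv[OF X cM(1) c(2) h(1) 0 order.refl h(3,4) V(1) V'] by (simp add: h(2))
  have "((\<lambda>w. \<phi> (\<pi>1 w)) has_field_derivative deriv (\<lambda>w. \<phi> (\<pi>1 w)) x1) (at (?M 0))"
    unfolding M0 by (rule cover_has_derivative[OF X c(1) x(1) V])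
  moreover have "(?M has_field_derivative (1 - (cmod x1)\<^sup>2)) (at 0)"
    using Moebius_has_field_derivative[of "- x1" 0] x1 by simp
  ultimately have "((\<lambda>w. \<phi> (\<pi>1 (?M w))) has_field_derivative deriv (\<lambda>w. \<phi> (\<pi>1 w)) x1 * (1 - (cmod x1)\<^sup>2)) (at 0)"
    by (rule DERIV_chain2)
  then have e2: "deriv (\<lambda>w. \<phi> (\<pi>1 (?M w))) 0 = deriv (\<lambda>w. \<phi> (\<pi>1 w)) x1 * complex_of_real (1 - (cmod x1)\<^sup>2)"
    by (simp add: DERIV_imp_deriv)
  have pos: "0 \<le> 1 - (cmod x1)\<^sup>2" using x1(2) by (simp add: abs_square_le_1)
  have "cmod (deriv (\<lambda>w. \<phi> (\<pi>1 w)) x1) * (1 - (cmod x1)\<^sup>2) = cmod (deriv (\<lambda>w. \<phi> (\<pi>1 (?M w))) 0)"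
    unfolding e2 norm_mult norm_of_real using pos by simp
  also have "\<dots> = cmod (deriv (\<lambda>w. \<phi> (\<pi>2 w)) x2) * cmod (deriv h 0)"
    unfolding e1 norm_mult ..
  also have "\<dots> \<le> cmod (deriv (\<lambda>w. \<phi> (\<pi>2 w)) x2) * (1 - (cmod x2)\<^sup>2)"
    using Schwarz_Pick[OF h(1) _ 0] h(2,3) by (intro mult_left_mono) auto
  finally show ?thesis .
qed

text \<open>\<open>cover_deriv_le\<close> in both directions. If one derivative vanishes, so does
  the other, and both quotients are infinite.\<close>

lemma cover_density_unique:
  assumes X: "riemann_surface X" and c: "disc_cover X \<nu> \<pi>1" "disc_cover X \<nu> \<pi>2"
    and im: "\<pi>1 ` ball 0 1 = \<pi>2 ` ball 0 1" and x: "x1 \<in> ball 0 1" "x2 \<in> ball 0 1" "\<pi>1 x1 = \<pi>2 x2"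
    and V: "(V, \<phi>) \<in> charts X" "\<pi>1 x1 \<in> V"
  shows "cover_density \<phi> \<pi>1 x1 = cover_density \<phi> \<pi>2 x2"
proof -
  define a b where "a = cmod (deriv (\<lambda>w. \<phi> (\<pi>1 w)) x1)" and "b = cmod (deriv (\<lambda>w. \<phi> (\<pi>2 w)) x2)"
  have V2: "\<pi>2 x2 \<in> V" using V(2) x(3) by simp
  have eq: "a * (1 - (cmod x1)\<^sup>2) = b * (1 - (cmod x2)\<^sup>2)"
    using cover_deriv_le[OF X c im x V] cover_deriv_le[OF X c(2,1) im[symmetric] x(2,1) x(3)[symmetric] V(1) V2]
    by (simp add: a_def b_def)
  have pos: "0 < 1 - (cmod x1)\<^sup>2" "0 < 1 - (cmod x2)\<^sup>2" using x(1,2) by (auto simp: abs_square_less_1)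
  have ab: "0 \<le> a" "0 \<le> b" by (auto simp: a_def b_def)
  have "ennreal (disc_density x1) / ennreal a = ennreal (disc_density x2) / ennreal b"
  proof (cases "a = 0")
    case True
    then have "b = 0" using eq pos by auto
    then show ?thesis using True x(1,2) disc_density_pos[of x1] disc_density_pos[of x2]
      by (simp add: ennreal_divide_zero)
  next
    case False
    then have "b \<noteq> 0" using eq pos by auto
    then have "0 < a" "0 < b" using False ab by auto
    moreover from this have "disc_density x1 / a = disc_density x2 / b"
      using eq pos by (simp add: disc_density_def field_simps)
    ultimately show ?thesis using x(1,2) disc_density_pos[of x1] disc_density_pos[of x2]
      by (simp add: divide_ennreal less_imp_le)
  qed
  then show ?thesis by (simp add: cover_density_def a_def b_def)
qed

lemma (in included_surface) orbifold_density_eq: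
  assumes hyp: "hyperbolic_orbifold X'" and C: "C \<in> connected_components_of (topol X')"
    and cov: "disc_cover X (ramif X') \<pi>" "\<pi> ` ball 0 1 = C" and x: "x \<in> ball 0 1"
    and V: "(V, \<phi>) \<in> charts X" "\<pi> x \<in> V"
  shows "orbifold_density X' \<phi> (\<pi> x) = cover_density \<phi> \<pi> x"
proof -
  have pos: "\<And>p. p \<in> points X' \<Longrightarrow> 1 \<le> ramif X' p"
    using hyp by (simp add: hyperbolic_orbifold_def riemann_orbifold_def)
  have key: "ennreal (disc_density y) / ennreal (cmod (deriv (\<lambda>y. \<phi> (\<pi>1 y)) y)) = cover_density \<phi> \<pi> x"
    if "C1 \<in> connected_components_of (topol X')" "orbifold_covering_map unit_disc (surface_restrict X' C1) \<pi>1"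
      "y \<in> ball 0 1" "\<pi>1 y = \<pi> x" for C1 \<pi>1 y
  proof -
    interpret cc: covered_component X' X C1 \<pi>1
      by unfold_locales (use that pos in auto)
    have "\<pi> x \<in> C" "\<pi> x \<in> C1" using cov(2) x cc.\<pi>_in_C[OF that(3)] that(4) by auto
    then have "C1 = C" using connected_components_of_disjoint[OF that(1) C] by (auto simp: disjnt_def)
    then have im: "\<pi>1 ` ball 0 1 = \<pi> ` ball 0 1" using cc.image_\<pi> cov(2) by simp
    have V1: "\<pi>1 y \<in> V" using V(2) that(4) by simp
    show ?thesis
      using cover_density_unique[OF X cc.disc_cover cov(1) im that(3) x that(4) V(1) V1]
      by (simp add: cover_density_def)
  qed
  obtain \<pi>0 where \<pi>0: "orbifold_covering_map unit_disc (surface_restrict X' C) \<pi>0"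
    using hyp C by (auto simp: hyperbolic_orbifold_def)
  interpret c0: covered_component X' X C \<pi>0
    by unfold_locales (use \<pi>0 C pos in auto)
  have "\<pi> x \<in> \<pi>0 ` ball 0 1" using c0.image_\<pi> cov(2) x by blast
  then obtain y where y: "y \<in> ball 0 1" "\<pi>0 y = \<pi> x" by (metis imageE)
  show ?thesis
    unfolding orbifold_density_def
  proof (rule the_equality)
    show "\<exists>C\<in>connected_components_of (topol X'). \<exists>\<pi>1 xa. orbifold_covering_map unit_disc (surface_restrict X' C) \<pi>1 \<and>
        xa \<in> ball 0 1 \<and> \<pi>1 xa = \<pi> x \<and>
        cover_density \<phi> \<pi> x = ennreal (disc_density xa) / ennreal (cmod (deriv (\<lambda>y. \<phi> (\<pi>1 y)) xa))"
      using C \<pi>0 y key[OF C \<pi>0 y] by (metis (no_types))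
  next
    fix r
    assume "\<exists>C\<in>connected_components_of (topol X'). \<exists>\<pi>1 xa. orbifold_covering_map unit_disc (surface_restrict X' C) \<pi>1 \<and>
        xa \<in> ball 0 1 \<and> \<pi>1 xa = \<pi> x \<and> r = ennreal (disc_density xa) / ennreal (cmod (deriv (\<lambda>y. \<phi> (\<pi>1 y)) xa))"
    then show "r = cover_density \<phi> \<pi> x" using key by blast
  qed
qed


section \<open>The distance of a fibre to the centre of the disc\<close>

text \<open>The hyperbolic distance from \<open>0\<close> to a point of modulus \<open>r\<close>,
  that is, the integral of \<open>2 / (1 - t^2)\<close> over \<open>{0..r}\<close>; its inverse is
  \<open>tanh (t/2)\<close>.\<close>

definition hyp_radius :: "real \<Rightarrow> real" where
  "hyp_radius r = ln ((1 + r) / (1 - r))"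

lemma hyp_radius_eq: "0 \<le> r \<Longrightarrow> r < 1 \<Longrightarrow> hyp_radius r = ln (1 + r) - ln (1 - r)"
  by (simp add: hyp_radius_def ln_div)

lemma hyp_radius_mono: "0 \<le> r \<Longrightarrow> r \<le> s \<Longrightarrow> s < 1 \<Longrightarrow> hyp_radius r \<le> hyp_radius s"
  by (simp add: hyp_radius_eq) (smt (verit) ln_le_cancel_iff)

lemma hyp_radius_0 [simp]: "hyp_radius 0 = 0"
  by (simp add: hyp_radius_def)

lemma hyp_radius_nonneg: "0 \<le> r \<Longrightarrow> r < 1 \<Longrightarrow> 0 \<le> hyp_radius r"
  using hyp_radius_mono[of 0 r] by simp

lemma continuous_on_hyp_radius: "continuous_on {0..<1} hyp_radius"
  unfolding hyp_radius_def by (intro continuous_intros) auto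

lemma exp_hyp_radius: "0 \<le> r \<Longrightarrow> r < 1 \<Longrightarrow> exp (hyp_radius r) = (1 + r) / (1 - r)"
  by (simp add: hyp_radius_def)

text \<open>
  The hyperbolic distance to \<open>0\<close> is not smooth at \<open>0\<close>, but it is the maximum over \<open>\<bar>c\<bar> = 1\<close> of the smooth
  functions \<open>y \<mapsto> Re (Ln ((1 + c y) / (1 - c y)))\<close>, whose gradients are bounded by the density.
\<close>

lemma hyp_radius_lipschitz:
  assumes \<tau>: "\<tau> holomorphic_on ball 0 r" "\<And>w. w \<in> ball 0 r \<Longrightarrow> \<tau> w \<in> ball 0 1"
    and K: "\<And>w. w \<in> ball 0 r \<Longrightarrow> disc_density (\<tau> w) * cmod (deriv \<tau> w) \<le> K" and w: "w \<in> ball 0 r"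
  shows "hyp_radius (cmod (\<tau> w)) - hyp_radius (cmod (\<tau> 0)) \<le> K * cmod w"
proof -
  have w0: "0 \<in> ball (0::complex) r"
  proof -
    have "0 \<le> cmod w" "cmod w < r" using w by auto
    then have "0 < r" by linarith
    then show ?thesis by simp
  qed
  have \<tau>1: "cmod (\<tau> u) < 1" if "u \<in> ball 0 r" for u using \<tau>(2)[OF that] by simp
  have K0: "0 \<le> K"
    using K[OF w] disc_density_pos[OF \<tau>1[OF w]] by (smt (verit) mult_nonneg_nonneg norm_ge_zero)
  show ?thesis
  proof (cases "\<tau> w = 0")
    case True
    have "0 \<le> hyp_radius (cmod (\<tau> 0))" using \<tau>1[OF w0] by (simp add: hyp_radius_nonneg)
    then show ?thesis using True K0 by (simp add: order_trans[of _ 0])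
  next
    case False
    \<comment> \<open>The rotation that takes \<open>\<tau> w\<close> to the positive real axis.
      There the real part of the logarithm is the hyperbolic radius itself, while at
      \<open>\<tau> 0\<close> it is at most the hyperbolic radius; both facts have the direction
      needed.\<close>
    define c where "c = cnj (\<tau> w) / complex_of_real (cmod (\<tau> w))"
    have c1: "cmod c = 1" using False by (simp add: c_def norm_divide)
    have cw: "c * \<tau> w = complex_of_real (cmod (\<tau> w))"
      using False complex_norm_square[of "\<tau> w"] by (simp add: c_def power2_eq_square field_simps)
    have cu: "cmod (c * \<tau> u) < 1" if "u \<in> ball 0 r" for u using \<tau>1[OF that] c1 by (simp add: norm_mult)
    define \<Lambda> where "\<Lambda> u = Ln (1 + c * \<tau> u) - Ln (1 - c * \<tau> u)" for u
    have re: "0 < Re (1 + v)" "0 < Re (1 - v)" if "cmod v < 1" for v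
      using abs_Re_le_cmod[of v] that by auto
    have nz: "1 + v \<noteq> 0" "1 - v \<noteq> 0" "1 + v \<notin> \<real>\<^sub>\<le>\<^sub>0" "1 - v \<notin> \<real>\<^sub>\<le>\<^sub>0" if "cmod v < 1" for v
      using re[OF that] by (auto simp: complex_nonpos_Reals_iff complex_eq_iff)
    define \<Lambda>' where "\<Lambda>' u = (c * deriv \<tau> u) / (1 + c * \<tau> u) - (- (c * deriv \<tau> u)) / (1 - c * \<tau> u)" for u
    have der: "(\<Lambda> has_field_derivative \<Lambda>' u) (at u within ball 0 r)" if u: "u \<in> ball 0 r" for u
    proof -
      have t: "(\<tau> has_field_derivative deriv \<tau> u) (at u)" by (rule holomorphic_derivI[OF \<tau>(1) open_ball u])
      have "((\<lambda>u. 1 + c * \<tau> u) has_field_derivative c * deriv \<tau> u) (at u)"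
        "((\<lambda>u. 1 - c * \<tau> u) has_field_derivative - (c * deriv \<tau> u)) (at u)"
        using t by (auto intro!: derivative_eq_intros)
      then have "(\<Lambda> has_field_derivative inverse (1 + c * \<tau> u) * (c * deriv \<tau> u) - inverse (1 - c * \<tau> u) * (- (c * deriv \<tau> u))) (at u)"
        unfolding \<Lambda>_def[abs_def]
        by (intro DERIV_diff DERIV_chain2[OF has_field_derivative_Ln]) (use nz[OF cu[OF u]] in auto)
      then have "(\<Lambda> has_field_derivative \<Lambda>' u) (at u)"
        by (simp add: \<Lambda>'_def divide_inverse mult.commute)
      then show ?thesis by (rule has_field_derivative_at_within)
    qed
    have bound: "cmod (\<Lambda>' u) \<le> K" if u: "u \<in> ball 0 r" for u
    proof -
      let ?v = "c * \<tau> u"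
      have "\<Lambda>' u = 2 * (c * deriv \<tau> u) / (1 - ?v\<^sup>2)"
      proof -
        have n: "1 + ?v \<noteq> 0" "1 - ?v \<noteq> 0" using nz[OF cu[OF u]] by auto
        have "1 - ?v\<^sup>2 = (1 + ?v) * (1 - ?v)" by (simp add: power2_eq_square algebra_simps)
        then show ?thesis using n by (simp add: \<Lambda>'_def add_frac_eq) (simp add: algebra_simps)
      qed
      then have "cmod (\<Lambda>' u) = 2 * cmod (deriv \<tau> u) / cmod (1 - ?v\<^sup>2)"
        by (simp add: norm_divide norm_mult c1)
      also have "\<dots> \<le> 2 * cmod (deriv \<tau> u) / (1 - (cmod (\<tau> u))\<^sup>2)"
      proof (rule divide_left_mono)
        have "cmod (?v\<^sup>2) = (cmod (\<tau> u))\<^sup>2" by (simp add: norm_power norm_mult c1)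
        then show "1 - (cmod (\<tau> u))\<^sup>2 \<le> cmod (1 - ?v\<^sup>2)" using norm_triangle_ineq2[of 1 "?v\<^sup>2"] by simp
        then show "0 < cmod (1 - ?v\<^sup>2) * (1 - (cmod (\<tau> u))\<^sup>2)"
          using \<tau>1[OF u] abs_square_less_1[of "cmod (\<tau> u)"] by (intro mult_pos_pos) auto
      qed simp
      also have "\<dots> = disc_density (\<tau> u) * cmod (deriv \<tau> u)" by (simp add: disc_density_def)
      also have "\<dots> \<le> K" by (rule K[OF u])
      finally show ?thesis .
    qed
    have "cmod (\<Lambda> w - \<Lambda> 0) \<le> K * cmod (w - 0)"
      by (rule field_differentiable_bound[OF convex_ball der bound w w0])
    moreover have "Re (\<Lambda> w) - Re (\<Lambda> 0) \<le> cmod (\<Lambda> w - \<Lambda> 0)" using complex_Re_le_cmod[of "\<Lambda> w - \<Lambda> 0"] by simp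
    moreover have Re\<Lambda>: "Re (\<Lambda> u) = ln (cmod (1 + c * \<tau> u)) - ln (cmod (1 - c * \<tau> u))" if "u \<in> ball 0 r" for u
      unfolding \<Lambda>_def using nz[OF cu[OF that]] by simp
    have "Re (\<Lambda> w) = hyp_radius (cmod (\<tau> w))"
    proof -
      have "cmod (1 + c * \<tau> w) = 1 + cmod (\<tau> w)" "cmod (1 - c * \<tau> w) = 1 - cmod (\<tau> w)"
        unfolding cw using \<tau>1[OF w] norm_of_real[of "1 + cmod (\<tau> w)", where 'a=complex] norm_of_real[of "1 - cmod (\<tau> w)", where 'a=complex]
        by auto
      then show ?thesis using Re\<Lambda>[OF w] \<tau>1[OF w] by (simp add: hyp_radius_eq)
    qed
    moreover have "Re (\<Lambda> 0) \<le> hyp_radius (cmod (\<tau> 0))"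
    proof -
      have n: "cmod (c * \<tau> 0) = cmod (\<tau> 0)" by (simp add: norm_mult c1)
      have "cmod (1 + c * \<tau> 0) \<le> 1 + cmod (\<tau> 0)" "1 - cmod (\<tau> 0) \<le> cmod (1 - c * \<tau> 0)"
        using norm_triangle_ineq[of 1 "c * \<tau> 0"] norm_triangle_ineq2[of 1 "c * \<tau> 0"] unfolding n by auto
      moreover have "0 < cmod (1 + c * \<tau> 0)" using nz[OF cu[OF w0]] by simp
      ultimately have "ln (cmod (1 + c * \<tau> 0)) \<le> ln (1 + cmod (\<tau> 0))" "ln (1 - cmod (\<tau> 0)) \<le> ln (cmod (1 - c * \<tau> 0))"
        using \<tau>1[OF w0] by (auto intro!: ln_mono)
      then show ?thesis using Re\<Lambda>[OF w0] \<tau>1[OF w0] by (simp add: hyp_radius_eq)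
    qed
    ultimately show ?thesis by simp
  qed
qed

definition fibre_radius :: "(complex \<Rightarrow> 'a) \<Rightarrow> 'a \<Rightarrow> real" where
  "fibre_radius \<pi> p = Inf (cmod ` {y \<in> ball 0 1. \<pi> y = p})"

context
  fixes X :: "('a, 'm) surface_scheme" and \<nu> :: "'a \<Rightarrow> nat" and \<pi> :: "complex \<Rightarrow> 'a"
  assumes X: "riemann_surface X" and cov: "disc_cover X \<nu> \<pi>"
begin

lemma fibre_radius_le: "y \<in> ball 0 1 \<Longrightarrow> fibre_radius \<pi> (\<pi> y) \<le> cmod y"
  unfolding fibre_radius_def by (rule cInf_lower) (auto intro: bdd_belowI[of _ 0])

text \<open>The fibre is relatively closed in the disc, so its part of modulus at most
  \<open>cmod y0\<close> is compact.\<close>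

lemma fibre_radius_attained:
  assumes "p \<in> \<pi> ` ball 0 1"
  obtains y where "y \<in> ball 0 1" "\<pi> y = p" "fibre_radius \<pi> p = cmod y"
proof -
  obtain y0 where y0: "y0 \<in> ball 0 1" "\<pi> y0 = p" using assms by blast
  have pX: "p \<in> points X" using disc_coverD(2)[OF cov y0(1)] y0(2) by simp
  have "closedin (topol X) {p}"
    using surface_Hausdorff[OF X] pX Hausdorff_imp_t1_space t1_space_closedin_singleton by metis
  then have "closedin (top_of_set (ball 0 1)) {x \<in> topspace (top_of_set (ball 0 1)). \<pi> x \<in> {p}}"
    by (rule closedin_continuous_map_preimage[OF disc_coverD(1)[OF cov]])
  then obtain T where T: "closed T" "{x \<in> ball 0 1. \<pi> x = p} = ball 0 1 \<inter> T"
    by (auto simp: closedin_closed)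
  let ?K = "cball 0 (cmod y0) \<inter> T"
  have sub: "cball 0 (cmod y0) \<subseteq> ball (0::complex) 1" using y0(1) by auto
  have "compact ?K" using T(1) by (simp add: compact_Int_closed)
  moreover have "y0 \<in> ?K" using y0 T(2) by auto
  ultimately obtain m where m: "m \<in> ?K" "\<forall>y\<in>?K. cmod m \<le> cmod y"
    using continuous_attains_inf[of ?K cmod] continuous_on_norm_id by blast
  have m1: "m \<in> ball 0 1" using m(1) sub by blast
  then have "m \<in> ball 0 1 \<inter> T" using m(1) by blast
  then have "m \<in> {x \<in> ball 0 1. \<pi> x = p}" using T(2) by blast
  then have mp: "\<pi> m = p" by simp
  have "cmod m \<le> cmod y" if y: "y \<in> ball 0 1" "\<pi> y = p" for y
  proof (cases "cmod y \<le> cmod y0")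
    case True
    have "y \<in> {x \<in> ball 0 1. \<pi> x = p}" using y by simp
    then have "y \<in> T" using T(2) by blast
    then show ?thesis using m(2) True by simp
  next
    case False
    then show ?thesis using m(1) by auto
  qed
  then have "cmod m \<le> fibre_radius \<pi> p"
    unfolding fibre_radius_def using y0 by (intro cInf_greatest) auto
  then show ?thesis using that[OF m1 mp] fibre_radius_le[OF m1] mp by simp
qed

lemma fibre_radius_bounds:
  assumes "p \<in> \<pi> ` ball 0 1"
  shows "0 \<le> fibre_radius \<pi> p" "fibre_radius \<pi> p < 1"
proof -
  obtain y where "y \<in> ball 0 1" "fibre_radius \<pi> p = cmod y" by (rule fibre_radius_attained[OF assms])
  then show "0 \<le> fibre_radius \<pi> p" "fibre_radius \<pi> p < 1" by auto
qed

text \<open>Upper semicontinuity holds because \<pi> is open: points near \<open>\<gamma> t0\<close>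
  have preimages near the minimising \<open>y\<close>. Lower semicontinuity holds because the image
  of a closed smaller disc is compact, hence closed, and misses \<open>\<gamma> t0\<close>.\<close>

lemma fibre_radius_continuous:
  assumes \<gamma>: "continuous_map (top_of_set {a..b::real}) (topol X) \<gamma>" and im: "\<gamma> ` {a..b} \<subseteq> \<pi> ` ball 0 1"
  shows "continuous_on {a..b} (\<lambda>t. fibre_radius \<pi> (\<gamma> t))"
  unfolding continuous_on_iff
proof (intro ballI allI impI)
  fix t0 and e :: real assume t0: "t0 \<in> {a..b}" and e: "0 < e"
  let ?r = "fibre_radius \<pi> (\<gamma> t0)"
  have S: "\<gamma> t0 \<in> \<pi> ` ball 0 1" using im t0 by blast
  obtain y where y: "y \<in> ball 0 1" "\<pi> y = \<gamma> t0" "?r = cmod y" by (rule fibre_radius_attained[OF S])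
  let ?W1 = "\<pi> ` (ball 0 (?r + e) \<inter> ball 0 1)"
  have W1: "openin (topol X) ?W1" by (rule cover_open_map[OF X cov]) auto
  \<comment> \<open>If \<open>e > ?r\<close>, this closed disc is empty and the lower bound is
    trivial.\<close>
  have sub: "cball 0 (?r - e) \<subseteq> ball (0::complex) 1" using y(1,3) e by auto
  have "compactin (top_of_set (ball 0 1)) (cball (0::complex) (?r - e))"
    using sub by (simp add: compactin_subtopology)
  then have "compactin (topol X) (\<pi> ` cball 0 (?r - e))"
    using image_compactin disc_coverD(1)[OF cov] by metis
  then have "closedin (topol X) (\<pi> ` cball 0 (?r - e))"
    by (rule compactin_imp_closedin[OF surface_Hausdorff[OF X]])
  then have W2: "openin (topol X) (points X - \<pi> ` cball 0 (?r - e))" by (rule openin_diff[OF openin_topspace])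
  let ?W = "?W1 \<inter> (points X - \<pi> ` cball 0 (?r - e))"
  have "y \<in> ball 0 (?r + e) \<inter> ball 0 1" using y(1,3) e by simp
  then have "\<gamma> t0 \<in> ?W1" unfolding y(2)[symmetric] by (rule imageI)
  moreover have "\<gamma> t0 \<notin> \<pi> ` cball 0 (?r - e)"
  proof
    assume "\<gamma> t0 \<in> \<pi> ` cball 0 (?r - e)"
    then obtain u where u: "u \<in> cball 0 (?r - e)" "\<gamma> t0 = \<pi> u" by blast
    then have "?r \<le> cmod u" using fibre_radius_le[of u] sub by (metis subsetD)
    then show False using u(1) e by simp
  qed
  moreover have "\<gamma> t0 \<in> points X" using disc_coverD(2)[OF cov y(1)] y(2) by simp
  ultimately have t0W: "t0 \<in> {t \<in> topspace (top_of_set {a..b}). \<gamma> t \<in> ?W}" using t0 by simp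
  have op: "openin (top_of_set {a..b}) {t \<in> topspace (top_of_set {a..b}). \<gamma> t \<in> ?W}"
    by (rule openin_continuous_map_preimage[OF \<gamma> openin_Int[OF W1 W2]])
  obtain d where d: "0 < d" "\<forall>t\<in>{a..b}. dist t t0 < d \<longrightarrow> t \<in> {t \<in> topspace (top_of_set {a..b}). \<gamma> t \<in> ?W}"
    using bspec[OF conjunct2[OF iffD1[OF openin_euclidean_subtopology_iff op]] t0W] by (elim exE conjE) (rule that)
  show "\<exists>d>0. \<forall>t\<in>{a..b}. dist t t0 < d \<longrightarrow> dist (fibre_radius \<pi> (\<gamma> t)) ?r < e"
  proof (intro exI[of _ d] conjI d(1) ballI impI)
    fix t assume t: "t \<in> {a..b}" "dist t t0 < d"
    have tW: "\<gamma> t \<in> ?W" using d(2) t by blast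
    then obtain u where u: "u \<in> ball 0 (?r + e)" "u \<in> ball 0 1" "\<gamma> t = \<pi> u" by blast
    have "fibre_radius \<pi> (\<gamma> t) < ?r + e" using fibre_radius_le[OF u(2)] u(1,3) by simp
    moreover have "?r - e < fibre_radius \<pi> (\<gamma> t)"
    proof -
      have "\<gamma> t \<in> \<pi> ` ball 0 1" using im t(1) by blast
      then obtain v where v: "v \<in> ball 0 1" "\<pi> v = \<gamma> t" "fibre_radius \<pi> (\<gamma> t) = cmod v" by (rule fibre_radius_attained)
      have "v \<notin> cball 0 (?r - e)"
      proof
        assume "v \<in> cball 0 (?r - e)"
        then have "\<gamma> t \<in> \<pi> ` cball 0 (?r - e)" unfolding v(2)[symmetric] by (rule imageI)
        then show False using tW by blast
      qed
      then show ?thesis using v(3) by simp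
    qed
    ultimately show "dist (fibre_radius \<pi> (\<gamma> t)) ?r < e" by (simp add: dist_real_def abs_less_iff)
  qed
qed

text \<open>In the normal form around \<open>x0\<close> the derivative at another point
  \<open>w\<close> is nonzero, because \<open>\<xi> w \<noteq> 0\<close>; so \<open>\<pi> w\<close>
  is unramified.\<close>

lemma ramified_isolated:
  assumes x0: "x0 \<in> ball 0 1"
  obtains U where "openin (topol X) U" "\<pi> x0 \<in> U" "\<And>q. q \<in> U \<Longrightarrow> q \<noteq> \<pi> x0 \<Longrightarrow> \<nu> q = 1"
proof -
  obtain V \<phi> where V: "(V, \<phi>) \<in> charts X" "\<pi> x0 \<in> V" by (rule chart_at[OF X disc_coverD(2)[OF cov x0]])
  obtain e \<xi> where n: "0 < \<nu> (\<pi> x0)" and e: "0 < e" "ball x0 e \<subseteq> ball 0 1" "\<pi> ` ball x0 e \<subseteq> V"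
    and \<xi>: "\<xi> holomorphic_on ball x0 e" "inj_on \<xi> (ball x0 e)" "\<xi> x0 = 0"
    "\<forall>w\<in>ball x0 e. \<phi> (\<pi> w) = \<phi> (\<pi> x0) + \<xi> w ^ \<nu> (\<pi> x0)"
    by (rule disc_cover_normal_form[OF cov x0 V]) (rule that)
  show ?thesis
  proof (rule that[of "\<pi> ` ball x0 e"])
    show "openin (topol X) (\<pi> ` ball x0 e)" by (rule cover_open_map[OF X cov open_ball e(2)])
    show "\<pi> x0 \<in> \<pi> ` ball x0 e" using e(1) by simp
    fix q assume "q \<in> \<pi> ` ball x0 e" "q \<noteq> \<pi> x0"
    then obtain w where w: "w \<in> ball x0 e" "q = \<pi> w" "w \<noteq> x0" by blast
    have "\<xi> w \<noteq> 0" using inj_onD[OF \<xi>(2), of w x0] w \<xi>(3) e(1) by auto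
    have "(\<xi> has_field_derivative deriv \<xi> w) (at w)" by (rule holomorphic_derivI[OF \<xi>(1) open_ball w(1)])
    then have "((\<lambda>u. \<phi> (\<pi> x0) + \<xi> u ^ \<nu> (\<pi> x0)) has_field_derivative
        (of_nat (\<nu> (\<pi> x0)) * \<xi> w ^ (\<nu> (\<pi> x0) - 1) * deriv \<xi> w)) (at w)"
      by (auto intro!: derivative_eq_intros)
    then have "((\<lambda>u. \<phi> (\<pi> u)) has_field_derivative (of_nat (\<nu> (\<pi> x0)) * \<xi> w ^ (\<nu> (\<pi> x0) - 1) * deriv \<xi> w)) (at w)"
      by (rule has_field_derivative_transform_within_open[OF _ open_ball w(1)]) (use \<xi>(4) in simp)
    then have "deriv (\<lambda>u. \<phi> (\<pi> u)) w = of_nat (\<nu> (\<pi> x0)) * \<xi> w ^ (\<nu> (\<pi> x0) - 1) * deriv \<xi> w"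
      by (rule DERIV_imp_deriv)
    moreover have "deriv \<xi> w \<noteq> 0" by (rule holomorphic_injective_imp_regular[OF \<xi>(1) open_ball \<xi>(2) w(1)])
    ultimately have "deriv (\<lambda>u. \<phi> (\<pi> u)) w \<noteq> 0" using n \<open>\<xi> w \<noteq> 0\<close> by simp
    moreover have "w \<in> ball 0 1" "\<pi> w \<in> V" using w(1) e by blast+
    ultimately show "\<nu> q = 1" using cover_deriv_nonzero_iff[OF X cov _ V(1)] w(2) by blast
  qed
qed

text \<open>
  Near an unramified point all branches of the inverse of \<open>\<pi>\<close> exist on a disc of fixed size, and they
  pull the density of the disc back to the same density. Hence the distance of a fibre to \<open>0\<close> has
  the expected local Lipschitz constant, no matter which point of the fibre is closest to \<open>0\<close>.
\<close>

lemma fibre_radius_local_lipschitz: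
  assumes x0: "x0 \<in> ball 0 1" and V: "(V, \<phi>) \<in> charts X" "\<pi> x0 \<in> V" and n1: "\<nu> (\<pi> x0) = 1" and \<eta>: "1 < \<eta>"
  obtains U \<rho> where "openin (topol X) U" "\<pi> x0 \<in> U" "0 < \<rho>"
    "\<And>x. x \<in> ball 0 1 \<Longrightarrow> \<pi> x \<in> U \<Longrightarrow> ennreal (\<rho> / \<eta>) \<le> cover_density \<phi> \<pi> x"
    "\<And>p q. p \<in> U \<Longrightarrow> q \<in> U \<Longrightarrow> hyp_radius (fibre_radius \<pi> q) - hyp_radius (fibre_radius \<pi> p) \<le> \<eta> * \<rho> * cmod (\<phi> q - \<phi> p)"
proof -
  note inj = chart_inj[OF X V(1)]
  obtain e \<xi> where e: "0 < e" "ball x0 e \<subseteq> ball 0 1" "\<pi> ` ball x0 e \<subseteq> V"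
    and \<xi>: "\<xi> holomorphic_on ball x0 e" "inj_on \<xi> (ball x0 e)" "\<xi> x0 = 0"
    "\<forall>w\<in>ball x0 e. \<phi> (\<pi> w) = \<phi> (\<pi> x0) + \<xi> w ^ \<nu> (\<pi> x0)"
    by (rule disc_cover_normal_form[OF cov x0 V]) (rule that)
  let ?F = "\<lambda>w. \<phi> (\<pi> w)"
  have F\<xi>: "?F w = \<phi> (\<pi> x0) + \<xi> w" if "w \<in> ball x0 e" for w using bspec[OF \<xi>(4) that] n1 by simp
  have "(\<lambda>w. \<phi> (\<pi> x0) + \<xi> w) holomorphic_on ball x0 e" using \<xi>(1) by (intro holomorphic_intros)
  then have Fhol: "?F holomorphic_on ball x0 e" by (rule holomorphic_transform) (simp add: F\<xi>)
  have Finj: "inj_on ?F (ball x0 e)"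
  proof (rule inj_onI)
    fix u v assume uv: "u \<in> ball x0 e" "v \<in> ball x0 e" "?F u = ?F v"
    have "\<xi> u = \<xi> v" using uv(3) F\<xi>[OF uv(1)] F\<xi>[OF uv(2)] by simp
    then show "u = v" by (rule inj_onD[OF \<xi>(2) _ uv(1,2)])
  qed
  obtain \<sigma> where \<sigma>: "\<sigma> holomorphic_on ?F ` ball x0 e"
    "\<And>z. z \<in> ball x0 e \<Longrightarrow> deriv ?F z * deriv \<sigma> (?F z) = 1" "\<And>z. z \<in> ball x0 e \<Longrightarrow> \<sigma> (?F z) = z"
    using holomorphic_has_inverse[OF Fhol open_ball Finj] by blast
  have opF: "open (?F ` ball x0 e)" by (rule open_mapping_thm3[OF Fhol open_ball Finj])
  define w0 where "w0 = \<phi> (\<pi> x0)"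
  have "w0 \<in> ?F ` ball x0 e" unfolding w0_def using e(1) by simp
  then obtain d1 where d1: "0 < d1" "ball w0 d1 \<subseteq> ?F ` ball x0 e" by (rule openE[OF opF])
  have \<sigma>ball: "\<sigma> w \<in> ball x0 e" "?F (\<sigma> w) = w" if w: "w \<in> ball w0 d1" for w
  proof -
    obtain z where z: "z \<in> ball x0 e" "w = ?F z" using w d1(2) by blast
    then show "\<sigma> w \<in> ball x0 e" "?F (\<sigma> w) = w" using \<sigma>(3)[OF z(1)] by auto
  qed
  have \<sigma>1: "\<sigma> w \<in> ball 0 1" if "w \<in> ball w0 d1" for w using \<sigma>ball(1)[OF that] e(2) by blast
  have unram: "\<nu> (\<pi> (\<sigma> w)) = 1" if w: "w \<in> ball w0 d1" for w
  proof -
    have "deriv ?F (\<sigma> w) \<noteq> 0" using \<sigma>(2)[OF \<sigma>ball(1)[OF w]] by auto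
    moreover have "\<pi> (\<sigma> w) \<in> V" using \<sigma>ball(1)[OF w] e(3) by blast
    ultimately show ?thesis using cover_deriv_nonzero_iff[OF X cov \<sigma>1[OF w] V(1)] by blast
  qed
  \<comment> \<open>The orbifold density as a function of the coordinate, read off from the local
    inverse \<open>\<sigma>\<close> of \<open>\<phi> \<circ> \<pi>\<close>.\<close>
  define R where "R w = disc_density (\<sigma> w) * cmod (deriv \<sigma> w)" for w
  have \<sigma>hol: "\<sigma> holomorphic_on ball w0 d1" by (rule holomorphic_on_subset[OF \<sigma>(1) d1(2)])
  have Rpos: "0 < R w" if w: "w \<in> ball w0 d1" for w
  proof -
    have "deriv ?F (\<sigma> w) * deriv \<sigma> w = 1" using \<sigma>(2)[OF \<sigma>ball(1)[OF w]] \<sigma>ball(2)[OF w] by simp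
    then have "deriv \<sigma> w \<noteq> 0" by auto
    then show ?thesis unfolding R_def using disc_density_pos[of "\<sigma> w"] \<sigma>1[OF w] by simp
  qed
  have Rcont: "continuous_on (ball w0 d1) R"
    unfolding R_def[abs_def] disc_density_def
  proof (intro continuous_intros ballI)
    show "continuous_on (ball w0 d1) \<sigma>" by (rule holomorphic_on_imp_continuous_on[OF \<sigma>hol])
    show "continuous_on (ball w0 d1) (deriv \<sigma>)"
      by (rule holomorphic_on_imp_continuous_on[OF holomorphic_deriv[OF \<sigma>hol open_ball]])
    fix w assume "w \<in> ball w0 d1"
    then have "(cmod (\<sigma> w))\<^sup>2 < 1" using \<sigma>1 by (simp add: abs_square_less_1)
    then show "1 - (cmod (\<sigma> w))\<^sup>2 \<noteq> 0" by simp
  qed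
  have dens: "cover_density \<phi> \<pi> x = ennreal (R w)"
    if x: "x \<in> ball 0 1" and w: "w \<in> ball w0 d1" and eq: "\<pi> x = \<pi> (\<sigma> w)" for x w
  proof -
    have V\<sigma>: "\<pi> (\<sigma> w) \<in> V" using \<sigma>ball(1)[OF w] e(3) by blast
    have "cover_density \<phi> \<pi> x = cover_density \<phi> \<pi> (\<sigma> w)"
      by (rule cover_density_unique[OF X cov cov refl x \<sigma>1[OF w] eq V(1)]) (use V\<sigma> eq in simp)
    also have "\<dots> = ennreal (R w)"
    proof -
      have "deriv ?F (\<sigma> w) * deriv \<sigma> w = 1" using \<sigma>(2)[OF \<sigma>ball(1)[OF w]] \<sigma>ball(2)[OF w] by simp
      then have m: "cmod (deriv ?F (\<sigma> w)) * cmod (deriv \<sigma> w) = 1" by (metis norm_mult norm_one)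
      then have pos: "0 < cmod (deriv ?F (\<sigma> w))" by (auto intro: ccontr)
      then have "cmod (deriv \<sigma> w) = 1 / cmod (deriv ?F (\<sigma> w))" using m by (simp add: field_simps)
      then show ?thesis
        using pos disc_density_pos[of "\<sigma> w"] \<sigma>1[OF w] by (simp add: cover_density_def R_def divide_ennreal less_imp_le)
    qed
    finally show ?thesis .
  qed
  \<comment> \<open>The density at \<open>\<pi> x0\<close>; by continuity it changes by less than
    the factor \<open>\<eta>\<close> in either direction on a smaller disc.\<close>
  define \<rho> where "\<rho> = R w0"
  have w0: "w0 \<in> ball w0 d1" using d1(1) by simp
  have \<rho>: "0 < \<rho>" unfolding \<rho>_def by (rule Rpos[OF w0])
  have lt: "\<rho> / \<eta> < \<rho>" "\<rho> < \<rho> * \<eta>" using \<rho> \<eta> by (auto simp: field_simps)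
  have "open (ball w0 d1 \<inter> R -` {\<rho> / \<eta><..<\<rho> * \<eta>})"
    by (rule continuous_open_preimage[OF Rcont]) auto
  moreover have "w0 \<in> ball w0 d1 \<inter> R -` {\<rho> / \<eta><..<\<rho> * \<eta>}" using w0 lt by (simp add: \<rho>_def)
  ultimately obtain d2 where d2: "0 < d2" "ball w0 d2 \<subseteq> ball w0 d1 \<inter> R -` {\<rho> / \<eta><..<\<rho> * \<eta>}" by (rule openE)
  have d21: "w \<in> ball w0 d1" "\<rho> / \<eta> < R w" "R w < \<rho> * \<eta>" if "w \<in> ball w0 d2" for w using d2(2) that by auto
  \<comment> \<open>A quarter of the radius: for \<open>p\<close> and \<open>q\<close> in
    \<open>U\<close>, the disc of radius \<open>d2 / 2\<close> around \<open>\<phi> p\<close>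
    contains \<open>\<phi> q\<close> and lies in \<open>ball w0 d2\<close>.\<close>
  define U where "U = {v \<in> V. \<phi> v \<in> ball w0 (d2 / 4)}"
  have U\<sigma>: "p = \<pi> (\<sigma> (\<phi> p))" "\<phi> p \<in> ball w0 d2" if "p \<in> U" for p
  proof -
    have pV: "p \<in> V" "dist w0 (\<phi> p) < d2 / 4" using that by (auto simp: U_def)
    show b: "\<phi> p \<in> ball w0 d2" using pV(2) d2(1) by simp
    note w = d21(1)[OF b]
    have "\<pi> (\<sigma> (\<phi> p)) \<in> V" using \<sigma>ball(1)[OF w] e(3) by blast
    then show "p = \<pi> (\<sigma> (\<phi> p))" using inj_onD[OF inj(2) _ pV(1)] \<sigma>ball(2)[OF w] by simp
  qed
  show ?thesis
  proof (rule that[of U \<rho>])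
    show "openin (topol X) U" unfolding U_def by (rule chart_preimage_open[OF X V(1)]) simp
    show "\<pi> x0 \<in> U" using V(2) d2(1) by (simp add: U_def w0_def)
    show "0 < \<rho>" by (rule \<rho>)
    show "ennreal (\<rho> / \<eta>) \<le> cover_density \<phi> \<pi> x" if x: "x \<in> ball 0 1" "\<pi> x \<in> U" for x
      using dens[OF x(1) d21(1)[OF U\<sigma>(2)[OF x(2)]] U\<sigma>(1)[OF x(2)]] d21(2)[OF U\<sigma>(2)[OF x(2)]]
      by (simp add: ennreal_leI less_imp_le)
    fix p q assume p: "p \<in> U" and q: "q \<in> U"
    let ?r = "d2 / 2"
    have r: "0 < ?r" using d2(1) by simp
    have pw: "\<phi> p + w \<in> ball w0 d2" if "w \<in> ball 0 ?r" for w
    proof -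
      have "dist w0 (\<phi> p + w) \<le> dist w0 (\<phi> p) + cmod w"
        using norm_triangle_ineq4[of "w0 - \<phi> p" w] by (simp add: dist_norm algebra_simps)
      moreover have "dist w0 (\<phi> p) < d2 / 4" using p by (simp add: U_def)
      ultimately show ?thesis using that r by simp
    qed
    \<comment> \<open>The inverse of the chart in a coordinate centred at \<open>p\<close>. It is
      lifted anew, starting at the point of the fibre over \<open>p\<close> closest to
      \<open>0\<close>, which need not be \<open>\<sigma> (\<phi> p)\<close>.\<close>
    define f where "f w = \<pi> (\<sigma> (\<phi> p + w))" for w
    have f0: "f 0 = p" using U\<sigma>(1)[OF p] by (simp add: f_def)
    have \<phi>f: "\<phi> (f w) = \<phi> p + w" if "w \<in> ball 0 ?r" for w
      unfolding f_def by (rule \<sigma>ball(2)[OF d21(1)[OF pw[OF that]]])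
    have fV: "f w \<in> V" if "w \<in> ball 0 ?r" for w
      unfolding f_def using \<sigma>ball(1)[OF d21(1)[OF pw[OF that]]] e(3) by blast
    interpret lifting_problem X \<nu> \<pi> f ?r
    proof
      have c1: "continuous_on (ball 0 ?r) (\<lambda>w. \<sigma> (\<phi> p + w))"
      proof (rule continuous_on_compose2[OF holomorphic_on_imp_continuous_on[OF \<sigma>hol]])
        show "continuous_on (ball 0 ?r) (\<lambda>w. \<phi> p + w)" by (intro continuous_intros)
        show "(\<lambda>w. \<phi> p + w) ` ball 0 ?r \<subseteq> ball w0 d1" using d21(1)[OF pw] by blast
      qed
      then have "continuous_map (top_of_set (ball 0 ?r)) (top_of_set (ball 0 1)) (\<lambda>w. \<sigma> (\<phi> p + w))"
        using \<sigma>1[OF d21(1)[OF pw]] by (simp add: continuous_map_in_subtopology Pi_iff image_subset_iff)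
      then have "continuous_map (top_of_set (ball 0 ?r)) (topol X) (\<pi> \<circ> (\<lambda>w. \<sigma> (\<phi> p + w)))"
        by (rule continuous_map_compose[OF _ disc_coverD(1)[OF cov]])
      then show "continuous_map (top_of_set (ball 0 ?r)) (topol X) f"
        by (simp add: o_def f_def[abs_def])
      show "f ` ball 0 ?r \<subseteq> \<pi> ` ball 0 1" unfolding f_def using \<sigma>1[OF d21(1)[OF pw]] by blast
      fix x :: complex assume x: "x \<in> ball 0 ?r"
      obtain d where d: "0 < d" "ball x d \<subseteq> ball 0 ?r" by (rule openE[OF open_ball x])
      show "\<exists>V \<phi> e G. (V, \<phi>) \<in> charts X \<and> f x \<in> V \<and> 0 < e \<and> ball x e \<subseteq> ball 0 ?r \<and> f ` ball x e \<subseteq> V \<and>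
          G holomorphic_on ball x e \<and> (\<forall>w\<in>ball x e. \<phi> (f w) = \<phi> (f x) + G w ^ \<nu> (f x))"
      proof (intro exI conjI)
        show "f ` ball x d \<subseteq> V" using fV d(2) by blast
        show "(\<lambda>w. w - x) holomorphic_on ball x d" by (intro holomorphic_intros)
        show "\<forall>w\<in>ball x d. \<phi> (f w) = \<phi> (f x) + (w - x) ^ \<nu> (f x)"
        proof
          fix w assume "w \<in> ball x d"
          then have w: "w \<in> ball 0 ?r" using d(2) by blast
          have "\<nu> (f x) = 1" unfolding f_def by (rule unram[OF d21(1)[OF pw[OF x]]])
          then show "\<phi> (f w) = \<phi> (f x) + (w - x) ^ \<nu> (f x)" using \<phi>f[OF w] \<phi>f[OF x] by simp
        qed
      qed (use V(1) fV[OF x] d in auto)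
    qed (fact X cov r)+
    have pS: "p \<in> \<pi> ` ball 0 1" using U\<sigma>(1)[OF p] \<sigma>1[OF d21(1)[OF U\<sigma>(2)[OF p]]] by blast
    obtain y where y: "y \<in> ball 0 1" "\<pi> y = p" "fibre_radius \<pi> p = cmod y" by (rule fibre_radius_attained[OF pS])
    have "\<pi> y = f 0" using y(2) f0 by simp
    then obtain \<tau> where \<tau>: "\<tau> holomorphic_on ball 0 ?r" "\<tau> 0 = y" "\<And>w. w \<in> ball 0 ?r \<Longrightarrow> \<tau> w \<in> ball 0 1"
      "\<And>w. w \<in> ball 0 ?r \<Longrightarrow> \<pi> (\<tau> w) = f w"
      using lift_exists[OF y(1)] by blast
    have K: "disc_density (\<tau> w) * cmod (deriv \<tau> w) \<le> \<eta> * \<rho>" if w: "w \<in> ball 0 ?r" for w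
    proof -
      have V\<tau>: "\<pi> (\<tau> w) \<in> V" using \<tau>(4)[OF w] fV[OF w] by simp
      have "((\<lambda>w. \<phi> (\<pi> w)) has_field_derivative deriv ?F (\<tau> w)) (at (\<tau> w))"
        by (rule cover_has_derivative[OF X cov \<tau>(3)[OF w] V(1) V\<tau>])
      then have "((\<lambda>w. \<phi> (\<pi> (\<tau> w))) has_field_derivative deriv ?F (\<tau> w) * deriv \<tau> w) (at w)"
        by (rule DERIV_chain2[OF _ holomorphic_derivI[OF \<tau>(1) open_ball w]])
      moreover have "((\<lambda>w. \<phi> p + w) has_field_derivative 1) (at w)" by (auto intro!: derivative_eq_intros)
      then have "((\<lambda>w. \<phi> (\<pi> (\<tau> w))) has_field_derivative 1) (at w)"
        by (rule has_field_derivative_transform_within_open[OF _ open_ball w]) (simp add: \<tau>(4) \<phi>f)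
      ultimately have "deriv ?F (\<tau> w) * deriv \<tau> w = 1" by (rule DERIV_unique)
      then have m: "cmod (deriv ?F (\<tau> w)) * cmod (deriv \<tau> w) = 1" by (metis norm_mult norm_one)
      then have pos: "0 < cmod (deriv ?F (\<tau> w))" by (auto intro: ccontr)
      then have c: "cmod (deriv \<tau> w) = 1 / cmod (deriv ?F (\<tau> w))" using m by (simp add: field_simps)
      have "ennreal (disc_density (\<tau> w) * cmod (deriv \<tau> w)) = cover_density \<phi> \<pi> (\<tau> w)"
        unfolding c using pos disc_density_pos[of "\<tau> w"] \<tau>(3)[OF w]
        by (simp add: cover_density_def divide_ennreal less_imp_le)
      also have "\<dots> = ennreal (R (\<phi> p + w))"
        by (rule dens[OF \<tau>(3)[OF w] d21(1)[OF pw[OF w]]]) (use \<tau>(4)[OF w] in \<open>simp add: f_def\<close>)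
      finally have "disc_density (\<tau> w) * cmod (deriv \<tau> w) = R (\<phi> p + w)"
        using disc_density_pos[of "\<tau> w"] \<tau>(3)[OF w] Rpos[OF d21(1)[OF pw[OF w]]] by (subst (asm) ennreal_inj) auto
      then show ?thesis using d21(3)[OF pw[OF w]] by (simp add: mult.commute)
    qed
    let ?w = "\<phi> q - \<phi> p"
    have wq: "?w \<in> ball 0 ?r"
    proof -
      have "dist w0 (\<phi> q) < d2 / 4" "dist w0 (\<phi> p) < d2 / 4" using p q by (auto simp: U_def)
      then have "dist (\<phi> q) (\<phi> p) < d2 / 2" using dist_triangle3[of "\<phi> q" "\<phi> p" w0] by simp
      then show ?thesis by (simp add: dist_norm norm_minus_commute)
    qed
    have "f ?w = q"
      by (rule inj_onD[OF inj(2)]) (use \<phi>f[OF wq] fV[OF wq] q in \<open>auto simp: U_def\<close>)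
    then have "fibre_radius \<pi> q \<le> cmod (\<tau> ?w)"
      using fibre_radius_le[OF \<tau>(3)[OF wq]] \<tau>(4)[OF wq] by simp
    moreover have "q \<in> \<pi> ` ball 0 1" using U\<sigma>(1)[OF q] \<sigma>1[OF d21(1)[OF U\<sigma>(2)[OF q]]] by blast
    ultimately have "hyp_radius (fibre_radius \<pi> q) \<le> hyp_radius (cmod (\<tau> ?w))"
      using fibre_radius_bounds(1) \<tau>(3)[OF wq] by (intro hyp_radius_mono) auto
    moreover have "hyp_radius (cmod (\<tau> ?w)) - hyp_radius (cmod (\<tau> 0)) \<le> \<eta> * \<rho> * cmod ?w"
      by (rule hyp_radius_lipschitz[OF \<tau>(1,3) K wq])
    ultimately show "hyp_radius (fibre_radius \<pi> q) - hyp_radius (fibre_radius \<pi> p) \<le> \<eta> * \<rho> * cmod (\<phi> q - \<phi> p)"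
      using y(3) \<tau>(2) by simp
  qed
qed

end

section \<open>Lengths of curves and the fibre radius\<close>

context
  fixes X :: "'a orbifold" and \<nu> :: "'a \<Rightarrow> nat" and \<pi> :: "complex \<Rightarrow> 'a"
  assumes X: "riemann_surface X" and cov: "disc_cover X \<nu> \<pi>"
begin

text \<open>By \<open>ramified_isolated\<close>, an unramified point of the image has a
  neighbourhood consisting of unramified points.\<close>

lemma closed_ramified_times:
  assumes \<gamma>: "continuous_map (top_of_set {a..b::real}) (topol X) \<gamma>" and im: "\<gamma> ` {a..b} \<subseteq> \<pi> ` ball 0 1"
  shows "closed {t \<in> {a..b}. \<nu> (\<gamma> t) \<noteq> 1}"
proof -
  define W where "W = \<Union>{U. openin (topol X) U \<and> (\<forall>q\<in>U. \<nu> q = 1)}"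
  have W: "openin (topol X) W" unfolding W_def by (rule openin_Union) blast
  have mem: "\<nu> (\<gamma> t) = 1 \<longleftrightarrow> \<gamma> t \<in> W" if t: "t \<in> {a..b}" for t
  proof
    show "\<nu> (\<gamma> t) = 1" if "\<gamma> t \<in> W" using that unfolding W_def by blast
    assume u: "\<nu> (\<gamma> t) = 1"
    obtain x where x: "x \<in> ball 0 1" "\<gamma> t = \<pi> x" using im t by blast
    obtain U where U: "openin (topol X) U" "\<pi> x \<in> U" "\<And>q. q \<in> U \<Longrightarrow> q \<noteq> \<pi> x \<Longrightarrow> \<nu> q = 1"
      using ramified_isolated[OF X cov x(1)] by blast
    have "\<forall>q\<in>U. \<nu> q = 1"
    proof
      fix q assume "q \<in> U"
      then show "\<nu> q = 1" using U(3)[of q] u x(2) by (cases "q = \<pi> x") auto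
    qed
    then show "\<gamma> t \<in> W" unfolding W_def using U(1,2) x(2) by auto
  qed
  have "openin (top_of_set {a..b}) {t \<in> topspace (top_of_set {a..b}). \<gamma> t \<in> W}"
    by (rule openin_continuous_map_preimage[OF \<gamma> W])
  then have "closedin (top_of_set {a..b}) ({a..b} - {t \<in> topspace (top_of_set {a..b}). \<gamma> t \<in> W})"
    using closedin_diff[OF closedin_topspace] by fastforce
  moreover have "{a..b} - {t \<in> topspace (top_of_set {a..b}). \<gamma> t \<in> W} = {t \<in> {a..b}. \<nu> (\<gamma> t) \<noteq> 1}"
    using mem by auto
  ultimately have "closedin (top_of_set {a..b}) {t \<in> {a..b}. \<nu> (\<gamma> t) \<noteq> 1}" by simp
  then show ?thesis by (rule closedin_closed_trans) simp
qed

lemma nearby_times: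
  assumes \<gamma>: "continuous_map (top_of_set {a..b::real}) (topol X) \<gamma>" and U: "openin (topol X) U"
    and t0: "t0 \<in> {a..b}" "\<gamma> t0 \<in> U"
  obtains d where "0 < d" "\<forall>t\<in>{a..b}. \<bar>t - t0\<bar> < d \<longrightarrow> \<gamma> t \<in> U"
proof -
  have op: "openin (top_of_set {a..b}) {t \<in> topspace (top_of_set {a..b}). \<gamma> t \<in> U}"
    by (rule openin_continuous_map_preimage[OF \<gamma> U])
  have t0W: "t0 \<in> {t \<in> topspace (top_of_set {a..b}). \<gamma> t \<in> U}" using t0 by simp
  obtain d where d: "0 < d" "\<forall>t\<in>{a..b}. dist t t0 < d \<longrightarrow> t \<in> {t \<in> topspace (top_of_set {a..b}). \<gamma> t \<in> U}"
    using bspec[OF conjunct2[OF iffD1[OF openin_euclidean_subtopology_iff op]] t0W] by (elim exE conjE) (rule that)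
  then show ?thesis using that[of d] by (simp add: dist_real_def)
qed

text \<open>An application of \<open>interval_bound_from_local\<close>. At unramified times the
  local Lipschitz bound is compared with arc length. The ramified times form the exceptional set:
  ramified points are isolated, so at ramified times close to \<open>t0\<close> the curve is again
  at \<open>\<gamma> t0\<close>.\<close>

lemma piece_length_ge:
  assumes ab: "a \<le> b" and V: "(V, \<phi>) \<in> charts X"
    and \<gamma>: "continuous_map (top_of_set {a..b::real}) (topol X) \<gamma>" and im: "\<gamma> ` {a..b} \<subseteq> \<pi> ` ball 0 1"
    and \<gamma>V: "\<gamma> ` {a..b} \<subseteq> V" and fin: "path_variation (\<phi> \<circ> \<gamma>) a b < \<infinity>"
    and h: "\<And>x s. x \<in> ball 0 1 \<Longrightarrow> s \<in> {a..b} \<Longrightarrow> \<pi> x = \<gamma> s \<Longrightarrow> h s = cover_density \<phi> \<pi> x"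
    and \<eta>: "1 < \<eta>"
  shows "ennreal (hyp_radius (fibre_radius \<pi> (\<gamma> b)) - hyp_radius (fibre_radius \<pi> (\<gamma> a)))
    \<le> ennreal (\<eta>\<^sup>2) * arc_length_integral (\<phi> \<circ> \<gamma>) a b h"
proof -
  let ?g = "\<phi> \<circ> \<gamma>"
  define \<mu> where "\<mu> = interval_measure (variation_function ?g a b)"
  define f where "f t = hyp_radius (fibre_radius \<pi> (\<gamma> t))" for t
  \<comment> \<open>Half-open intervals make adjacent pieces disjoint. One factor
    \<open>\<eta>\<close> pays for the Lipschitz constant \<open>\<eta> * \<rho>\<close>, the other
    for the lower bound \<open>\<rho> / \<eta>\<close> of the density.\<close>
  define N where "N s t = ennreal (\<eta>\<^sup>2) * (\<integral>\<^sup>+x\<in>{s<..t}. h x \<partial>\<mu>)" for s t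
  have gc: "continuous_on {a..b} ?g"
  proof -
    have "continuous_map (top_of_set {a..b}) (subtopology (topol X) V) \<gamma>"
      using \<gamma> \<gamma>V by (auto simp: continuous_map_in_subtopology)
    then have "continuous_map (top_of_set {a..b}) (top_of_set (\<phi> ` V)) ?g"
      by (rule continuous_map_compose[OF _ chart_inverse(2)[OF X V]])
    then show ?thesis by (simp add: continuous_map_in_subtopology)
  qed
  have S: "\<gamma> t \<in> \<pi> ` ball 0 1" if "t \<in> {a..b}" for t using im that by blast
  have "ennreal (f b - f a) \<le> N a b"
  proof (rule interval_bound_from_local[OF ab, where E="{t \<in> {a..b}. \<nu> (\<gamma> t) \<noteq> 1}"])
    show "continuous_on {a..b} f" unfolding f_def[abs_def]
      by (rule continuous_on_compose2[OF continuous_on_hyp_radius fibre_radius_continuous[OF X cov \<gamma> im]])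
         (use fibre_radius_bounds[OF X cov S] in auto)
    show "N s t + N t u \<le> N s u" if "s \<le> t" "t \<le> u" for s t u
      unfolding N_def distrib_left[symmetric]
      by (intro mult_left_mono set_nn_integral_Ioc_superadditive that) simp
    show "closed {t \<in> {a..b}. \<nu> (\<gamma> t) \<noteq> 1}" by (rule closed_ramified_times[OF \<gamma> im])
  next
    fix t0 assume "t0 \<in> {a..b} - {t \<in> {a..b}. \<nu> (\<gamma> t) \<noteq> 1}"
    then have t0: "t0 \<in> {a..b}" "\<nu> (\<gamma> t0) = 1" by auto
    obtain x0 where x0: "x0 \<in> ball 0 1" "\<gamma> t0 = \<pi> x0" using S[OF t0(1)] by blast
    have xV: "\<pi> x0 \<in> V" using \<gamma>V t0(1) x0(2) by (metis image_subset_iff)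
    have n1: "\<nu> (\<pi> x0) = 1" using t0(2) x0(2) by simp
    show "\<exists>d>0. \<forall>s t. a \<le> s \<longrightarrow> s \<le> t0 \<longrightarrow> t0 \<le> t \<longrightarrow> t \<le> b \<longrightarrow> t - s < d \<longrightarrow> ennreal (f t - f s) \<le> N s t"
    proof (rule fibre_radius_local_lipschitz[OF X cov x0(1) V xV n1 \<eta>])
      fix U \<rho>
      assume U: "openin (topol X) U" "\<pi> x0 \<in> U" and \<rho>: "0 < \<rho>"
        and dens: "\<And>x. x \<in> ball 0 1 \<Longrightarrow> \<pi> x \<in> U \<Longrightarrow> ennreal (\<rho> / \<eta>) \<le> cover_density \<phi> \<pi> x"
        and lip: "\<And>p q. p \<in> U \<Longrightarrow> q \<in> U \<Longrightarrow> hyp_radius (fibre_radius \<pi> q) - hyp_radius (fibre_radius \<pi> p) \<le> \<eta> * \<rho> * cmod (\<phi> q - \<phi> p)"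
      have "\<gamma> t0 \<in> U" using U(2) x0(2) by simp
      then obtain d where d: "0 < d" "\<forall>t\<in>{a..b}. \<bar>t - t0\<bar> < d \<longrightarrow> \<gamma> t \<in> U"
        by (rule nearby_times[OF \<gamma> U(1) t0(1)])
      show ?thesis
      proof (intro exI[of _ d] conjI d(1) allI impI)
        fix s t assume st: "a \<le> s" "s \<le> t0" "t0 \<le> t" "t \<le> b" "t - s < d"
        have in_U: "\<gamma> u \<in> U" if u: "u \<in> {s..t}" for u
        proof -
          have "u \<in> {a..b}" "\<bar>u - t0\<bar> < d" using u st by auto
          then show ?thesis using d(2) by blast
        qed
        have h_ge: "ennreal (\<rho> / \<eta>) \<le> h u" if u: "u \<in> {s..t}" for u
        proof -
          have uab: "u \<in> {a..b}" using u st by auto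
          obtain x where x: "x \<in> ball 0 1" "\<gamma> u = \<pi> x" using S[OF uab] by blast
          have "\<pi> x \<in> U" using in_U[OF u] x(2) by simp
          from dens[OF x(1) this] show ?thesis using h[OF x(1) uab x(2)[symmetric]] by simp
        qed
        have "f t - f s \<le> \<eta> * \<rho> * cmod (?g t - ?g s)"
          unfolding f_def o_def using lip[of "\<gamma> s" "\<gamma> t"] in_U st by auto
        then have "ennreal (f t - f s) \<le> ennreal (\<eta> * \<rho> * cmod (?g t - ?g s))" by (rule ennreal_leI)
        also have "\<dots> = ennreal (\<eta> * \<rho>) * ennreal (dist (?g s) (?g t))"
          using \<rho> \<eta> by (subst ennreal_mult[symmetric]) (auto simp: dist_norm norm_minus_commute)
        also have "\<dots> \<le> ennreal (\<eta> * \<rho>) * path_variation ?g s t"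
          using st by (intro mult_left_mono dist_le_path_variation) auto
        also have "\<dots> = ennreal (\<eta>\<^sup>2) * (ennreal (\<rho> / \<eta>) * emeasure \<mu> {s<..t})"
        proof -
          have "emeasure \<mu> {s<..t} = path_variation ?g s t"
            unfolding \<mu>_def using st by (intro emeasure_variation_Ioc[OF fin gc]) auto
          moreover have "ennreal (\<eta>\<^sup>2) * ennreal (\<rho> / \<eta>) = ennreal (\<eta> * \<rho>)"
            using \<rho> \<eta> by (subst ennreal_mult[symmetric]) (auto simp: power2_eq_square)
          ultimately show ?thesis by (simp flip: mult.assoc)
        qed
        also have "ennreal (\<rho> / \<eta>) * emeasure \<mu> {s<..t} = (\<integral>\<^sup>+x\<in>{s<..t}. ennreal (\<rho> / \<eta>) \<partial>\<mu>)"
          by (rule nn_integral_cmult_indicator[symmetric]) (simp add: \<mu>_def)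
        also have "ennreal (\<eta>\<^sup>2) * \<dots> \<le> N s t"
          unfolding N_def using h_ge
          by (intro mult_left_mono nn_integral_mono) (auto simp: indicator_def)
        finally show "ennreal (f t - f s) \<le> N s t" .
      qed
    qed
  next
    fix t0 assume "t0 \<in> {a..b} \<inter> {t \<in> {a..b}. \<nu> (\<gamma> t) \<noteq> 1}"
    then have t0: "t0 \<in> {a..b}" "\<nu> (\<gamma> t0) \<noteq> 1" by auto
    obtain x0 where x0: "x0 \<in> ball 0 1" "\<gamma> t0 = \<pi> x0" using S[OF t0(1)] by blast
    obtain U where U: "openin (topol X) U" "\<pi> x0 \<in> U" "\<And>q. q \<in> U \<Longrightarrow> q \<noteq> \<pi> x0 \<Longrightarrow> \<nu> q = 1"
      using ramified_isolated[OF X cov x0(1)] by blast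
    have "\<gamma> t0 \<in> U" using U(2) x0(2) by simp
    then obtain d where d: "0 < d" "\<forall>t\<in>{a..b}. \<bar>t - t0\<bar> < d \<longrightarrow> \<gamma> t \<in> U"
      by (rule nearby_times[OF \<gamma> U(1) t0(1)])
    show "\<exists>d>0. \<forall>t\<in>{a..b} \<inter> {t \<in> {a..b}. \<nu> (\<gamma> t) \<noteq> 1}. \<bar>t - t0\<bar> < d \<longrightarrow> f t = f t0"
    proof (intro exI[of _ d] conjI d(1) ballI impI)
      fix t assume t: "t \<in> {a..b} \<inter> {t \<in> {a..b}. \<nu> (\<gamma> t) \<noteq> 1}" "\<bar>t - t0\<bar> < d"
      then have "\<gamma> t \<in> U" "\<nu> (\<gamma> t) \<noteq> 1" using d(2) by auto
      then have "\<gamma> t = \<gamma> t0" using U(3) x0(2) by metis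
      then show "f t = f t0" by (simp add: f_def)
    qed
  qed
  also have "N a b \<le> ennreal (\<eta>\<^sup>2) * arc_length_integral ?g a b h"
    unfolding N_def arc_length_integral_eq \<mu>_def
    by (intro mult_left_mono nn_integral_mono) (auto simp: indicator_def)
  finally show ?thesis by (simp add: f_def)
qed

text \<open>Connectedness keeps the curve in the image of \<pi>. The bounds for the pieces add up,
  starting from the fibre radius 0 of \<open>\<pi> 0\<close>, and \<open>\<eta>\<close> tends to
  1.\<close>

lemma path_length_ge:
  assumes C: "\<pi> ` ball 0 1 \<in> connected_components_of (topol X)"
    and dens: "\<And>V \<phi> x. (V, \<phi>) \<in> charts X \<Longrightarrow> x \<in> ball 0 1 \<Longrightarrow> \<pi> x \<in> V \<Longrightarrow> orbifold_density X \<phi> (\<pi> x) = cover_density \<phi> \<pi> x"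
    and l: "rectifiable_with_length X \<gamma> l" and \<gamma>0: "\<gamma> 0 = \<pi> 0"
  shows "\<gamma> 1 \<in> \<pi> ` ball 0 1" "ennreal (hyp_radius (fibre_radius \<pi> (\<gamma> 1))) \<le> l"
proof -
  obtain n t U \<phi> where t: "t 0 = 0" "t n = (1::real)"
    and pieces: "\<forall>i<n. t i \<le> t (Suc i) \<and> (U i, \<phi> i) \<in> charts X \<and> \<gamma> ` {t i..t (Suc i)} \<subseteq> U i \<and>
           path_variation (\<phi> i \<circ> \<gamma>) (t i) (t (Suc i)) < \<infinity>"
    and l_eq: "l = (\<Sum>i<n. arc_length_integral (\<phi> i \<circ> \<gamma>) (t i) (t (Suc i)) (\<lambda>s. orbifold_density X (\<phi> i) (\<gamma> s)))"
    and \<gamma>: "pathin (topol X) \<gamma>"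
    using l unfolding rectifiable_with_length_def by (elim conjE exE) (rule that)
  have \<gamma>c: "continuous_map (top_of_set {0..1}) (topol X) \<gamma>" using \<gamma> by (simp add: pathin_def)
  have im: "\<gamma> ` {0..1} \<subseteq> \<pi> ` ball 0 1"
  proof (rule connected_components_of_maximal[OF C])
    show "connectedin (topol X) (\<gamma> ` {0..1})"
      by (rule connectedin_continuous_map_image[OF \<gamma>c]) (simp add: connectedin_subtopology)
    have "\<pi> 0 \<in> \<pi> ` ball 0 1 \<inter> \<gamma> ` {0..1}"
    proof
      show "\<pi> 0 \<in> \<gamma> ` {0..1}" unfolding \<gamma>0[symmetric] by (rule imageI) simp
    qed simp
    then show "\<not> disjnt (\<pi> ` ball 0 1) (\<gamma> ` {0..1})" unfolding disjnt_def by blast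
  qed
  show "\<gamma> 1 \<in> \<pi> ` ball 0 1" using im by (metis atLeastAtMost_iff imageI order.refl subsetD zero_le_one)
  have t_ge: "i \<le> n \<Longrightarrow> 0 \<le> t i" for i
  proof (induction i)
    case (Suc i)
    then have "0 \<le> t i" "t i \<le> t (Suc i)" using pieces[rule_format, of i] by simp_all
    then show ?case by linarith
  qed (simp add: t)
  have t_le: "t i \<le> 1" if "i \<le> n" for i
    using that
  proof (induction i rule: inc_induct)
    case (step i)
    have "t i \<le> t (Suc i)" using pieces[rule_format, OF step.hyps(2)] by blast
    then show ?case using step.IH by linarith
  qed (simp add: t)
  define f where "f s = hyp_radius (fibre_radius \<pi> (\<gamma> s))" for s
  have bound: "ennreal (f (t k) - f (t 0)) \<le> ennreal (\<eta>\<^sup>2) * (\<Sum>i<k. arc_length_integral (\<phi> i \<circ> \<gamma>) (t i) (t (Suc i)) (\<lambda>s. orbifold_density X (\<phi> i) (\<gamma> s)))"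
    if "k \<le> n" and \<eta>: "1 < \<eta>" for k \<eta>
    using that(1)
  proof (induction k)
    case (Suc k)
    then have kn: "k < n" by simp
    note p = pieces[rule_format, OF kn]
    have sub: "{t k..t (Suc k)} \<subseteq> {0..1}" using t_ge[of k] t_le[of "Suc k"] kn by auto
    have c: "continuous_map (top_of_set {t k..t (Suc k)}) (topol X) \<gamma>"
      by (rule continuous_map_from_subtopology_mono[OF \<gamma>c sub])
    have "ennreal (f (t (Suc k)) - f (t k)) \<le> ennreal (\<eta>\<^sup>2) * arc_length_integral (\<phi> k \<circ> \<gamma>) (t k) (t (Suc k)) (\<lambda>s. orbifold_density X (\<phi> k) (\<gamma> s))"
      unfolding f_def
    proof (rule piece_length_ge[OF _ _ c _ _ _ _ \<eta>])
      show "\<gamma> ` {t k..t (Suc k)} \<subseteq> \<pi> ` ball 0 1" using im sub by blast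
      fix x s assume x: "x \<in> ball 0 1" "s \<in> {t k..t (Suc k)}" "\<pi> x = \<gamma> s"
      have "\<pi> x \<in> U k" using p x(2,3) by auto
      then show "orbifold_density X (\<phi> k) (\<gamma> s) = cover_density (\<phi> k) \<pi> x"
        using dens[of "U k" "\<phi> k" x] p x(1,3) by simp
    qed (use p in auto)
    moreover have "ennreal (f (t (Suc k)) - f (t 0)) \<le> ennreal (f (t k) - f (t 0)) + ennreal (f (t (Suc k)) - f (t k))"
      using ennreal_add_le[of "f (t k) - f (t 0)" "f (t (Suc k)) - f (t k)"] by simp
    moreover have "ennreal (f (t k) - f (t 0)) \<le> ennreal (\<eta>\<^sup>2) * (\<Sum>i<k. arc_length_integral (\<phi> i \<circ> \<gamma>) (t i) (t (Suc i)) (\<lambda>s. orbifold_density X (\<phi> i) (\<gamma> s)))"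
      by (rule Suc.IH) (use Suc.prems in simp)
    ultimately show ?case unfolding sum.lessThan_Suc distrib_left by (meson add_mono order_trans)
  qed simp
  have f0: "f 0 = 0"
  proof -
    have "fibre_radius \<pi> (\<pi> 0) \<le> 0" using fibre_radius_le[OF X cov, of 0] by simp
    moreover have "0 \<le> fibre_radius \<pi> (\<pi> 0)" by (rule fibre_radius_bounds(1)[OF X cov]) simp
    ultimately show ?thesis by (simp add: f_def \<gamma>0)
  qed
  have le: "ennreal (f 1) \<le> ennreal (\<eta>\<^sup>2) * l" if "1 < \<eta>" for \<eta>
    using bound[of n \<eta>] that by (simp add: t f0 l_eq)
  show "ennreal (hyp_radius (fibre_radius \<pi> (\<gamma> 1))) \<le> l"
  proof (cases "l = \<infinity>")
    case False
    then obtain m where m: "l = ennreal m" "0 \<le> m" by (cases l) auto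
    have "f 1 \<le> \<eta>\<^sup>2 * m" if "1 < \<eta>" for \<eta>
      using le[OF that] m by (simp add: ennreal_mult[symmetric] del: ennreal_mult'')
    then have ev: "eventually (\<lambda>\<eta>. f 1 \<le> \<eta>\<^sup>2 * m) (at_right (1::real))"
      unfolding eventually_at_right_field by (intro exI[of _ 2]) auto
    have "((\<lambda>\<eta>::real. \<eta>\<^sup>2 * m) \<longlongrightarrow> 1\<^sup>2 * m) (at_right 1)" by (intro tendsto_intros)
    then have "f 1 \<le> 1\<^sup>2 * m" by (rule tendsto_lowerbound[OF _ ev]) simp
    then show ?thesis using m by (simp add: f_def ennreal_leI)
  qed simp
qed

lemma cover_holomorphic_on:
  assumes V: "(V, \<phi>) \<in> charts X"
  shows "open {x \<in> ball 0 1. \<pi> x \<in> V}" "(\<lambda>w. \<phi> (\<pi> w)) holomorphic_on {x \<in> ball 0 1. \<pi> x \<in> V}"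
proof -
  show "open {x \<in> ball 0 1. \<pi> x \<in> V}"
    by (rule open_preimage_ball[OF disc_coverD(1)[OF cov] chart_inj(1)[OF X V]])
  show "(\<lambda>w. \<phi> (\<pi> w)) holomorphic_on {x \<in> ball 0 1. \<pi> x \<in> V}"
  proof (rule analytic_imp_holomorphic, unfold analytic_on_def, rule ballI)
    fix x assume "x \<in> {x \<in> ball 0 1. \<pi> x \<in> V}"
    then have x: "x \<in> ball 0 1" "\<pi> x \<in> V" by auto
    obtain e where "0 < e" "(\<lambda>w. \<phi> (\<pi> w)) holomorphic_on ball x e"
      by (rule cover_holomorphic[OF X cov x(1) V x(2)]) (rule that)
    then show "\<exists>e>0. (\<lambda>w. \<phi> (\<pi> w)) holomorphic_on ball x e" by blast
  qed
qed

text \<open>The image of the segment from \<open>0\<close> to \<open>y\<close> competes in the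
  infimum. Its pulled-back density is that of the disc, so each piece has length at most the
  increment of the hyperbolic radius, and the pieces telescope.\<close>

lemma radial_path_length:
  assumes dens: "\<And>V \<phi> x. (V, \<phi>) \<in> charts X \<Longrightarrow> x \<in> ball 0 1 \<Longrightarrow> \<pi> x \<in> V \<Longrightarrow> orbifold_density X \<phi> (\<pi> x) = cover_density \<phi> \<pi> x"
    and y: "y \<in> ball 0 1" "y \<noteq> 0"
  shows "orbifold_dist X (\<pi> 0) (\<pi> y) \<le> ennreal (hyp_radius (cmod y))"
proof -
  define \<gamma> where "\<gamma> t = \<pi> (complex_of_real t * y)" for t
  have ty: "complex_of_real t * y \<in> ball 0 1" if "t \<in> {0..1}" for t
  proof -
    have "\<bar>t\<bar> * cmod y \<le> 1 * cmod y" using that by (intro mult_right_mono) auto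
    then show ?thesis using y(1) by (simp add: norm_mult)
  qed
  have cm: "continuous_map (top_of_set {0..1}) (top_of_set (ball 0 1)) (\<lambda>t. complex_of_real t * y)"
    using ty by (auto simp: continuous_map_in_subtopology simp del: mem_ball intro!: continuous_intros)
  have \<gamma>c: "continuous_map (top_of_set {0..1}) (topol X) \<gamma>"
    using continuous_map_compose[OF cm disc_coverD(1)[OF cov]] by (simp add: o_def \<gamma>_def[abs_def])
  have \<gamma>X: "\<gamma> t \<in> points X" if "t \<in> {0..1}" for t
    unfolding \<gamma>_def by (rule disc_coverD(2)[OF cov ty[OF that]])
  \<comment> \<open>A Lebesgue number of this cover gives an equidistant subdivision, each interval
    of which is mapped into one chart.\<close>
  define \<C> where "\<C> = {B. open B \<and> (\<exists>V \<phi>. (V, \<phi>) \<in> charts X \<and> \<gamma> ` (B \<inter> {0..1}) \<subseteq> V)}"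
  have cover: "{0..1} \<subseteq> \<Union>\<C>"
  proof
    fix t0 :: real assume t0: "t0 \<in> {0..1}"
    obtain V \<phi> where V: "(V, \<phi>) \<in> charts X" "\<gamma> t0 \<in> V" by (rule chart_at[OF X \<gamma>X[OF t0]])
    obtain d where d: "0 < d" "\<forall>t\<in>{0..1}. \<bar>t - t0\<bar> < d \<longrightarrow> \<gamma> t \<in> V"
      by (rule nearby_times[OF \<gamma>c chart_inj(1)[OF X V(1)] t0 V(2)])
    have "\<gamma> ` (ball t0 d \<inter> {0..1}) \<subseteq> V"
      using d(2) by (auto simp: dist_real_def abs_minus_commute)
    then have "ball t0 d \<in> \<C>" unfolding \<C>_def using V(1) by blast
    then show "t0 \<in> \<Union>\<C>" using d(1) by (intro UnionI[of "ball t0 d"]) auto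
  qed
  have "\<C> \<noteq> {}" using cover by force
  moreover have "open B" if "B \<in> \<C>" for B using that unfolding \<C>_def by blast
  ultimately obtain \<delta> where \<delta>: "0 < \<delta>" "\<And>T. T \<subseteq> {0..1} \<Longrightarrow> diameter T < \<delta> \<Longrightarrow> \<exists>B\<in>\<C>. T \<subseteq> B"
    using Lebesgue_number_lemma[OF compact_Icc _ cover] by metis
  obtain n where n: "0 < n" "1 / real n < \<delta>"
    using reals_Archimedean[OF \<delta>(1)] by (metis inverse_eq_divide zero_less_Suc)
  define t where "t i = real i / real n" for i
  have tS: "t (Suc i) = t i + 1 / real n" for i by (simp add: t_def add_divide_distrib)
  have t01: "{t i..t (Suc i)} \<subseteq> {0..1}" if "i < n" for i
    using that n(1) by (auto simp: t_def field_simps intro: order_trans)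
  have "\<exists>V \<phi>. (V, \<phi>) \<in> charts X \<and> \<gamma> ` {t i..t (Suc i)} \<subseteq> V" if i: "i < n" for i
  proof -
    have "diameter {t i..t (Suc i)} = 1 / real n" using n(1) by (simp add: diameter_closed_interval tS)
    then have "diameter {t i..t (Suc i)} < \<delta>" using n(2) by simp
    from \<delta>(2)[OF t01[OF i] this] obtain B where B: "B \<in> \<C>" "{t i..t (Suc i)} \<subseteq> B" by (rule bexE)
    obtain V \<phi> where V: "(V, \<phi>) \<in> charts X" "\<gamma> ` (B \<inter> {0..1}) \<subseteq> V" using B(1) unfolding \<C>_def by blast
    have "{t i..t (Suc i)} \<subseteq> B \<inter> {0..1}" using B(2) t01[OF i] by (rule Int_greatest)
    then have "\<gamma> ` {t i..t (Suc i)} \<subseteq> \<gamma> ` (B \<inter> {0..1})" by (rule image_mono)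
    also note V(2)
    finally show ?thesis using V(1) by blast
  qed
  then obtain V \<phi> where V: "\<And>i. i < n \<Longrightarrow> (V i, \<phi> i) \<in> charts X \<and> \<gamma> ` {t i..t (Suc i)} \<subseteq> V i" by metis
  define K where "K s = hyp_radius (s * cmod y)" for s
  let ?I = "\<lambda>i. arc_length_integral (\<phi> i \<circ> \<gamma>) (t i) (t (Suc i)) (\<lambda>s. orbifold_density X (\<phi> i) (\<gamma> s))"
  have piece: "path_variation (\<phi> i \<circ> \<gamma>) (t i) (t (Suc i)) < \<infinity> \<and> ?I i \<le> ennreal (K (t (Suc i)) - K (t i))"
    if i: "i < n" for i
  proof -
    let ?a = "t i" and ?b = "t (Suc i)" and ?F = "\<lambda>w. \<phi> i (\<pi> w)"
    let ?O = "{x \<in> ball 0 1. \<pi> x \<in> V i}"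
    note Vi = V[OF i, THEN conjunct1]
    have ab: "?a \<le> ?b" by (simp add: tS)
    have yO: "complex_of_real s * y \<in> ?O" if "s \<in> {?a..?b}" for s
    proof -
      have "s \<in> {0..1}" using t01[OF i] that by blast
      moreover have "\<gamma> s \<in> V i" using V[OF i] that by blast
      ultimately show ?thesis using ty[of s] unfolding \<gamma>_def by blast
    qed
    define g' where "g' s = y * deriv ?F (complex_of_real s * y)" for s
    have deriv: "((\<phi> i \<circ> \<gamma>) has_vector_derivative g' s) (at s within {?a..?b})" if s: "s \<in> {?a..?b}" for s
    proof -
      have F: "(?F has_field_derivative deriv ?F (complex_of_real s * y)) (at (complex_of_real s * y))"
      proof (rule cover_has_derivative[OF X cov _ Vi])
        show "complex_of_real s * y \<in> ball 0 1" "\<pi> (complex_of_real s * y) \<in> V i" using yO[OF s] by blast+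
      qed
      have "((\<lambda>s. s *\<^sub>R y) has_vector_derivative y) (at s within {?a..?b})"
        unfolding has_vector_derivative_def
        by (rule bounded_linear_imp_has_derivative[OF bounded_linear_scaleR_left])
      then have lin: "((\<lambda>s. complex_of_real s * y) has_vector_derivative y) (at s within {?a..?b})"
        by (simp only: scaleR_conv_of_real)
      have "((?F \<circ> (\<lambda>s. complex_of_real s * y)) has_vector_derivative y * deriv ?F (complex_of_real s * y)) (at s within {?a..?b})"
        by (rule field_vector_diff_chain_within[OF lin has_field_derivative_at_within[OF F]])
      then show ?thesis by (simp add: o_def \<gamma>_def g'_def)
    qed
    have g'c: "continuous_on {?a..?b} g'"
    proof -
      have "continuous_on ?O (deriv ?F)"
        by (rule holomorphic_on_imp_continuous_on[OF holomorphic_deriv[OF cover_holomorphic_on(2,1)[OF Vi]]])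
      then have "continuous_on {?a..?b} (\<lambda>s. deriv ?F (complex_of_real s * y))"
      proof (rule continuous_on_compose2)
        show "continuous_on {?a..?b} (\<lambda>s. complex_of_real s * y)" by (intro continuous_intros)
        show "(\<lambda>s. complex_of_real s * y) ` {?a..?b} \<subseteq> ?O" using yO by (rule image_subsetI)
      qed
      then show ?thesis unfolding g'_def by (intro continuous_intros)
    qed
    define k where "k s = 2 * cmod y / (1 - (s * cmod y)\<^sup>2)" for s
    have sy: "0 \<le> s * cmod y" "s * cmod y < 1" if s: "s \<in> {?a..?b}" for s
    proof -
      have s01: "s \<in> {0..1}" using t01[OF i] s by blast
      then show "0 \<le> s * cmod y" by simp
      show "s * cmod y < 1" using ty[OF s01] s01 by (simp add: norm_mult)
    qed
    have k0: "0 < 1 - (s * cmod y)\<^sup>2" if "s \<in> {?a..?b}" for s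
      using sy[OF that] by (simp add: abs_square_less_1)
    have "?I i \<le> ennreal (K ?b - K ?a)"
    proof (rule C1_arc_length_integral_le[OF ab deriv g'c])
      show "continuous_on {?a..?b} k" unfolding k_def
        using k0 by (intro continuous_intros) force
      show "0 \<le> k s" if "s \<in> {?a..?b}" for s using k0[OF that] by (simp add: k_def)
      show "(K has_vector_derivative k s) (at s within {?a..?b})" if s: "s \<in> {?a..?b}" for s
      proof -
        have pos: "0 < 1 + s * cmod y" "0 < 1 - s * cmod y" using sy[OF s] by auto
        let ?r = "cmod y"
        have "((\<lambda>s. 1 + s * ?r) has_real_derivative ?r) (at s)" "((\<lambda>s. 1 - s * ?r) has_real_derivative - ?r) (at s)"
          by (auto intro!: derivative_eq_intros)
        from DERIV_diff[OF DERIV_chain2[OF DERIV_ln_divide[OF pos(1)] this(1)] DERIV_chain2[OF DERIV_ln_divide[OF pos(2)] this(2)]]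
        have "((\<lambda>s. ln (1 + s * ?r) - ln (1 - s * ?r)) has_real_derivative
            1 / (1 + s * ?r) * ?r - 1 / (1 - s * ?r) * (- ?r)) (at s)" .
        moreover have "1 / (1 + s * ?r) * ?r - 1 / (1 - s * ?r) * (- ?r) = k s"
        proof -
          define q where "q = s * ?r"
          have q: "1 + q \<noteq> 0" "1 - q \<noteq> 0" using pos by (auto simp: q_def)
          have "1 - q\<^sup>2 = (1 + q) * (1 - q)" by (simp add: power2_eq_square algebra_simps)
          then show ?thesis unfolding k_def q_def[symmetric] using q by (simp add: add_frac_eq) (simp add: algebra_simps)
        qed
        ultimately have "((\<lambda>s. ln (1 + s * ?r) - ln (1 - s * ?r)) has_vector_derivative k s) (at s within {?a..?b})"
          unfolding has_real_derivative_iff_has_vector_derivative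
          by (metis has_vector_derivative_at_within)
        then show ?thesis
        proof (rule has_vector_derivative_transform[OF s, rotated])
          fix u assume "u \<in> {?a..?b}"
          then show "K u = ln (1 + u * ?r) - ln (1 - u * ?r)"
            unfolding K_def using sy by (intro hyp_radius_eq) auto
        qed
      qed
      show "orbifold_density X (\<phi> i) (\<gamma> s) \<le> ennreal (k s) / ennreal (cmod (g' s))" if s: "s \<in> {?a..?b}" for s
      proof -
        let ?x = "complex_of_real s * y"
        have x: "?x \<in> ball 0 1" "\<pi> ?x \<in> V i" using yO[OF s] by auto
        define D where "D = cmod (deriv ?F ?x)"
        have "disc_density ?x * cmod y = k s"
          using sy(1)[OF s] by (simp add: disc_density_def k_def norm_mult power_mult_distrib)
        moreover have dd: "0 < disc_density ?x" by (rule disc_density_pos) (use x(1) in simp)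
        ultimately have ks: "ennreal (k s) = ennreal (disc_density ?x) * ennreal (cmod y)"
          by (metis ennreal_mult less_imp_le norm_ge_zero)
        have g's: "ennreal (cmod (g' s)) = ennreal D * ennreal (cmod y)"
          unfolding g'_def D_def norm_mult by (subst ennreal_mult) (simp_all only: norm_ge_zero mult.commute)
        have "orbifold_density X (\<phi> i) (\<gamma> s) = ennreal (disc_density ?x) / ennreal D"
          unfolding \<gamma>_def dens[OF Vi x] by (simp add: cover_density_def D_def)
        also have "\<dots> = ennreal (k s) / ennreal (cmod (g' s))"
        proof (cases "D = 0")
          case True
          \<comment> \<open>At a ramified point both sides are infinite; here
            \<open>y \<noteq> 0\<close> guarantees that the numerator on the right is not 0.\<close>
          have "ennreal (disc_density ?x) * ennreal (cmod y) \<noteq> 0" using dd y(2) by simp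
          then show ?thesis using True dd by (simp add: ks g's ennreal_divide_zero)
        next
          case False
          then have D: "0 < D" by (simp add: D_def)
          have "disc_density ?x / D = (disc_density ?x * cmod y) / (D * cmod y)" using y(2) by simp
          moreover have "ennreal (disc_density ?x) / ennreal D = ennreal (disc_density ?x / D)"
            by (rule divide_ennreal) (use dd D in auto)
          moreover have "ennreal (disc_density ?x * cmod y) / ennreal (D * cmod y) = ennreal ((disc_density ?x * cmod y) / (D * cmod y))"
            by (rule divide_ennreal) (use dd D y(2) in auto)
          moreover have "ennreal (k s) = ennreal (disc_density ?x * cmod y)" "ennreal (cmod (g' s)) = ennreal (D * cmod y)"
            unfolding ks g's using dd D by (auto simp only: ennreal_mult less_imp_le norm_ge_zero)
          ultimately show ?thesis by simp
        qed
        finally show ?thesis by simp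
      qed
    qed
    then show ?thesis using C1_variation_finite[OF ab deriv g'c] by simp
  qed
  have rl: "rectifiable_with_length X \<gamma> (\<Sum>i<n. ?I i)"
    unfolding rectifiable_with_length_def
  proof (intro conjI exI)
    show "pathin (topol X) \<gamma>" using \<gamma>c by (simp add: pathin_def)
    show "t 0 = 0" "t n = 1" using n(1) by (auto simp: t_def)
    show "\<forall>i<n. t i \<le> t (Suc i) \<and> (V i, \<phi> i) \<in> charts X \<and> \<gamma> ` {t i..t (Suc i)} \<subseteq> V i \<and>
       path_variation (\<phi> i \<circ> \<gamma>) (t i) (t (Suc i)) < \<infinity>"
      using V piece by (simp add: tS)
  qed simp
  have "\<gamma> 0 = \<pi> 0" "\<gamma> 1 = \<pi> y" by (auto simp: \<gamma>_def)
  then have "orbifold_dist X (\<pi> 0) (\<pi> y) \<le> (\<Sum>i<n. ?I i)"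
    unfolding orbifold_dist_def using rl by (intro Inf_lower) blast
  also have "\<dots> \<le> (\<Sum>i<n. ennreal (K (t (Suc i)) - K (t i)))" by (intro sum_mono) (use piece in auto)
  also have "\<dots> = ennreal (\<Sum>i<n. K (t (Suc i)) - K (t i))"
  proof (rule sum_ennreal)
    fix i assume "i \<in> {..<n}"
    then have i: "i < n" by simp
    have t1: "0 \<le> t i" "t i \<le> t (Suc i)" "t (Suc i) \<le> 1"
      using i n(1) by (simp add: t_def, simp add: tS, simp add: t_def)
    have "t (Suc i) * cmod y \<le> 1 * cmod y" using t1 by (intro mult_right_mono) auto
    then have "K (t i) \<le> K (t (Suc i))" unfolding K_def using y(1) t1 by (intro hyp_radius_mono mult_right_mono) auto
    then show "0 \<le> K (t (Suc i)) - K (t i)" by simp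
  qed
  also have "(\<Sum>i<n. K (t (Suc i)) - K (t i)) = K (t n) - K (t 0)" by (rule sum_lessThan_telescope)
  also have "\<dots> = hyp_radius (cmod y)" using n(1) by (simp add: t_def K_def)
  finally show ?thesis .
qed

end


section \<open>Comparison of the densities\<close>

lemma disc_cover_centred:
  assumes cov: "disc_cover X \<nu> \<pi>0" and z: "z \<in> \<pi>0 ` ball 0 1"
  obtains \<pi> where "disc_cover X \<nu> \<pi>" "\<pi> ` ball 0 1 = \<pi>0 ` ball 0 1" "\<pi> 0 = z"
proof -
  obtain x where x: "x \<in> ball 0 1" "z = \<pi>0 x" using z by blast
  have "cmod (- x) < 1" using x(1) by simp
  note M = disc_cover_Moebius[OF cov this]
  have "\<pi>0 (Moebius_function 0 (- x) 0) = z" using x(2) by (simp add: Moebius_function_of_zero)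
  with M show ?thesis by (rule that)
qed

lemma cover_density_centre:
  assumes "deriv (\<lambda>y. \<phi> (\<pi> y)) 0 \<noteq> 0"
  shows "cover_density \<phi> \<pi> 0 = ennreal (2 / cmod (deriv (\<lambda>y. \<phi> (\<pi> y)) 0))"
proof -
  have "disc_density 0 = 2" by (simp add: disc_density_def)
  moreover have "ennreal 2 / ennreal (cmod (deriv (\<lambda>y. \<phi> (\<pi> y)) 0)) = ennreal (2 / cmod (deriv (\<lambda>y. \<phi> (\<pi> y)) 0))"
    by (rule divide_ennreal) (use assms in auto)
  ultimately show ?thesis by (simp only: cover_density_def)
qed

text \<open>Both \<open>\<xi>\<close> and the Moebius function centred at \<open>y\<close> have a
  simple zero at \<open>y\<close>. Their quotient does not vanish nearby and thus has an m-th root,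
  by which a root of \<open>\<xi> \<circ> h\<close> is converted into one of the Moebius transform
  of \<open>h\<close>.\<close>

lemma Moebius_root_at_zero:
  assumes \<xi>: "\<xi> holomorphic_on ball y e" "inj_on \<xi> (ball y e)" "\<xi> y = 0" and e: "0 < e" and y: "cmod y < 1"
    and h: "h holomorphic_on ball x d" "h x = y" "\<And>w. w \<in> ball x d \<Longrightarrow> h w \<in> ball y e"
      "\<And>w. w \<in> ball x d \<Longrightarrow> h w \<in> ball 0 1" and d: "0 < d" and m: "0 < m"
    and P: "P holomorphic_on ball x d" "\<And>w. w \<in> ball x d \<Longrightarrow> \<xi> (h w) = P w ^ m"
  obtains d' G where "0 < d'" "G holomorphic_on ball x d'" "\<And>w. w \<in> ball x d' \<Longrightarrow> G w ^ m = Moebius_function 0 y (h w)"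
proof -
  have ye: "y \<in> ball y e" using e by simp
  obtain k where k: "k holomorphic_on ball y e" "k y = deriv \<xi> y" "\<And>w. w \<in> ball y e \<Longrightarrow> \<xi> w = (w - y) * k w"
    by (rule zero_factor[OF \<xi>(1) open_ball ye \<xi>(3)]) (rule that)
  have ky: "k y \<noteq> 0" unfolding k(2) by (rule holomorphic_injective_imp_regular[OF \<xi>(1) open_ball \<xi>(2) ye])
  have kh: "(\<lambda>w. k (h w)) holomorphic_on ball x d"
  proof -
    have "h ` ball x d \<subseteq> ball y e" using h(3) by (rule image_subsetI)
    from holomorphic_on_compose_gen[OF h(1) k(1) this] show ?thesis by (simp only: o_def)
  qed
  have "open (ball x d \<inter> (\<lambda>w. k (h w)) -` (- {0}))"
    by (rule continuous_open_preimage[OF holomorphic_on_imp_continuous_on[OF kh]]) auto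
  moreover have "x \<in> ball x d \<inter> (\<lambda>w. k (h w)) -` (- {0})" using d ky h(2) by simp
  ultimately obtain d' where d': "0 < d'" "ball x d' \<subseteq> ball x d \<inter> (\<lambda>w. k (h w)) -` (- {0})" by (rule openE)
  have sub: "ball x d' \<subseteq> ball x d" and knz: "\<And>w. w \<in> ball x d' \<Longrightarrow> k (h w) \<noteq> 0" using d'(2) by blast+
  let ?q = "\<lambda>w. 1 - cnj y * h w"
  have qnz: "?q w \<noteq> 0" if "w \<in> ball x d'" for w
  proof
    assume "?q w = 0"
    then have "cmod (cnj y * h w) = 1" by (metis eq_iff_diff_eq_0 norm_one)
    moreover have "cmod (h w) < 1" using h(4)[of w] that sub by auto
    ultimately show False using y norm_mult_less[of "cnj y" 1 "h w" 1] by simp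
  qed
  let ?c = "\<lambda>w. 1 / (k (h w) * ?q w)"
  have hc: "?c holomorphic_on ball x d'"
    using knz qnz holomorphic_on_subset[OF kh sub] holomorphic_on_subset[OF h(1) sub]
    by (intro holomorphic_intros) auto
  have "?c w \<noteq> 0" if "w \<in> ball x d'" for w using knz[OF that] qnz[OF that] by simp
  from nonvanishing_nth_root[OF hc this d'(1) m]
  obtain c0 where c0: "c0 holomorphic_on ball x d'" "\<And>w. w \<in> ball x d' \<Longrightarrow> c0 w ^ m = ?c w"
    by blast
  show ?thesis
  proof (rule that[OF d'(1), of "\<lambda>w. P w * c0 w"])
    show "(\<lambda>w. P w * c0 w) holomorphic_on ball x d'"
      using holomorphic_on_subset[OF P(1) sub] c0(1) by (intro holomorphic_intros)
    fix w assume w: "w \<in> ball x d'"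
    then have wd: "w \<in> ball x d" using sub by blast
    have "(P w * c0 w) ^ m = \<xi> (h w) * ?c w" by (simp only: power_mult_distrib P(2)[OF wd] c0(2)[OF w])
    also have "\<dots> = (h w - y) / ?q w" unfolding k(3)[OF h(3)[OF wd]] using knz[OF w] by simp
    finally show "(P w * c0 w) ^ m = Moebius_function 0 y (h w)" by (simp only: Moebius_function_simple)
  qed
qed

text \<open>With r the hyperbolic radius of \<open>k\<close>, one has
  \<open>(1 - k) / (1 + k) = exp (- r)\<close>, and
  \<open>4 k = (1 + k)^2 - (1 - k)^2\<close>.\<close>

lemma ramified_bound_eq:
  fixes k \<kappa> :: real
  assumes k: "0 \<le> k" "k < 1" and \<kappa>: "0 \<le> \<kappa>" "\<kappa> \<le> 2 * sqrt k / (1 + k)"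
  shows "\<kappa>\<^sup>2 \<le> 1 - exp (- 2 * hyp_radius k)"
proof -
  have "exp (- 2 * hyp_radius k) = (1 / exp (hyp_radius k))\<^sup>2"
    by (simp add: power2_eq_square exp_minus field_simps flip: exp_add)
  also have "\<dots> = ((1 - k) / (1 + k))\<^sup>2" using k by (simp add: exp_hyp_radius)
  finally have "1 - exp (- 2 * hyp_radius k) = 1 - ((1 - k) / (1 + k))\<^sup>2" by simp
  also have "\<dots> = (2 * sqrt k / (1 + k))\<^sup>2"
  proof -
    have nz: "(1 + k)\<^sup>2 \<noteq> 0" using k by simp
    have "(2 * sqrt k / (1 + k))\<^sup>2 = 4 * k / (1 + k)\<^sup>2" using k by (simp add: power_divide power_mult_distrib)
    moreover have "4 * k = (1 + k)\<^sup>2 - (1 - k)\<^sup>2" by (simp add: power2_eq_square algebra_simps)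
    ultimately have "(2 * sqrt k / (1 + k))\<^sup>2 = (1 + k)\<^sup>2 / (1 + k)\<^sup>2 - (1 - k)\<^sup>2 / (1 + k)\<^sup>2"
      by (simp only: diff_divide_distrib)
    then show ?thesis using nz by (simp add: power_divide)
  qed
  finally show ?thesis using power_mono[OF \<kappa>(2,1), of 2] by simp
qed

lemma (in included_surface) topol_eq: "topol X' = subtopology (topol X) (points X')"
  unfolding topology_eq
proof (intro allI iffI)
  fix T assume T: "openin (topol X') T"
  then have "T \<subseteq> points X'" by (rule openin_subset)
  then show "openin (subtopology (topol X) (points X')) T"
    using incl_open[OF T] by (metis inf.absorb1 openin_subtopology)
next
  fix T assume "openin (subtopology (topol X) (points X')) T"
  then show "openin (topol X') T" using openin_restrict by (auto simp: openin_subtopology)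
qed

text \<open>For \<open>x = exp R\<close> the quotient is \<open>tanh (R / 2)\<close>, the Euclidean
  radius of the hyperbolic disc of radius \<open>R\<close> about \<open>0\<close>.\<close>

lemma half_tanh_bounds:
  fixes x :: real
  assumes "1 < x"
  shows "0 < (x - 1) / (x + 1)" "(x - 1) / (x + 1) < 1"
  using assms by (auto simp: field_simps)

text \<open>Both coverings, also that of \<open>X'\<close>, are based at \<open>z\<close> and
  described in the charts of \<open>X\<close>, so that their derivatives at \<open>0\<close> can be
  compared.\<close>

locale pointed_inclusion = included_surface +
  fixes z :: 'a and \<pi>' \<pi> :: "complex \<Rightarrow> 'a"
  assumes hyp': "hyperbolic_orbifold X'" and hyp: "hyperbolic_orbifold X"
    and cov': "disc_cover X (ramif X') \<pi>'" and cov: "disc_cover X (ramif X) \<pi>"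
    and C': "\<pi>' ` ball 0 1 \<in> connected_components_of (topol X')"
    and C: "\<pi> ` ball 0 1 \<in> connected_components_of (topol X)"
    and z: "\<pi>' 0 = z" "\<pi> 0 = z" "ramif X' z = 1"
begin

lemma ramif_pos: "p \<in> points X' \<Longrightarrow> 1 \<le> ramif X' p" "p \<in> points X \<Longrightarrow> 1 \<le> ramif X p"
  using hyp' hyp by (auto simp: hyperbolic_orbifold_def riemann_orbifold_def)

lemma ramif_dvd: "p \<in> points X' \<Longrightarrow> ramif X p dvd ramif X' p"
  using incl by (simp add: holomorphic_inclusion_def)

lemma image': "\<pi>' ` ball 0 1 \<subseteq> points X'"
  using C' by (rule connected_components_of_subset)

lemma z_in: "z \<in> points X'"
  using image' z(1) by (metis centre_in_ball imageI subsetD zero_less_one)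

lemma ramif_z: "ramif X z = 1"
  using ramif_dvd[OF z_in] z(3) by simp

lemma not_in_frontier:
  assumes "p \<in> points X'"
  shows "p \<notin> (topol X) frontier_of (points X')"
  using assms points_open by (simp add: frontier_of_def interior_of_openin)

lemma boundary_ramif:
  assumes "p \<in> orbifold_boundary X' X" "p \<in> points X'"
  shows "ramif X p < ramif X' p"
  using assms not_in_frontier by (auto simp: orbifold_boundary_def)

lemma image_subset: "\<pi>' ` ball 0 1 \<subseteq> \<pi> ` ball 0 1"
proof (rule connected_components_of_maximal[OF C])
  have "connectedin (topol X') (\<pi>' ` ball 0 1)" using C' by (rule connectedin_connected_components_of)
  then have "connectedin (topol X) ((\<lambda>z. z) ` \<pi>' ` ball 0 1)"
    by (rule connectedin_continuous_map_image[OF incl_continuous])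
  then show "connectedin (topol X) (\<pi>' ` ball 0 1)" by simp
  have "z \<in> \<pi> ` ball 0 1" "z \<in> \<pi>' ` ball 0 1" using z(1,2) by (metis centre_in_ball imageI zero_less_one)+
  then show "\<not> disjnt (\<pi> ` ball 0 1) (\<pi>' ` ball 0 1)" unfolding disjnt_def by blast
qed

section \<open>The lift of the smaller covering and its behaviour over the boundary\<close>

definition h :: "complex \<Rightarrow> complex" where
  "h = (SOME h. h holomorphic_on ball 0 1 \<and> h 0 = 0 \<and> (\<forall>w\<in>ball 0 1. h w \<in> ball 0 1 \<and> \<pi> (h w) = \<pi>' w))"

lemma h: "h holomorphic_on ball 0 1" "h 0 = 0" "\<And>w. w \<in> ball 0 1 \<Longrightarrow> h w \<in> ball 0 1"
  "\<And>w. w \<in> ball 0 1 \<Longrightarrow> \<pi> (h w) = \<pi>' w"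
proof -
  have dv: "ramif X (\<pi>' x) dvd ramif X' (\<pi>' x)" if "x \<in> ball 0 1" for x
    using that image' by (intro ramif_dvd) blast
  have 0: "0 \<in> ball (0::complex) 1" "\<pi> 0 = \<pi>' 0" using z by auto
  have "\<exists>h. h holomorphic_on ball 0 1 \<and> h 0 = 0 \<and> (\<forall>w\<in>ball 0 1. h w \<in> ball 0 1 \<and> \<pi> (h w) = \<pi>' w)"
  proof (rule cover_lift[OF X cov' cov zero_less_one order.refl image_subset dv 0])
    fix k assume k: "k holomorphic_on ball 0 1" "k 0 = 0" "\<And>w. w \<in> ball 0 1 \<Longrightarrow> k w \<in> ball 0 1"
      "\<And>w. w \<in> ball 0 1 \<Longrightarrow> \<pi> (k w) = \<pi>' w"
    show ?thesis by (intro exI[of _ k] conjI ballI k)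
  qed
  then have "h holomorphic_on ball 0 1 \<and> h 0 = 0 \<and> (\<forall>w\<in>ball 0 1. h w \<in> ball 0 1 \<and> \<pi> (h w) = \<pi>' w)"
    unfolding h_def by (rule someI_ex)
  then show "h holomorphic_on ball 0 1" "h 0 = 0" "\<And>w. w \<in> ball 0 1 \<Longrightarrow> h w \<in> ball 0 1"
    "\<And>w. w \<in> ball 0 1 \<Longrightarrow> \<pi> (h w) = \<pi>' w" by simp_all
qed

text \<open>
  Over a boundary point, \<open>h\<close> either omits the fibre or is ramified to the constant order
  \<open>ramif X' b / ramif X b\<close>; in both cases \<open>h\<close> factors through a power map branched over \<open>y\<close>.
\<close>

lemma boundary_fibre_bound:
  assumes y: "y \<in> ball 0 1" and b: "\<pi> y \<in> orbifold_boundary X' X"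
  shows "y \<noteq> 0" "cmod (deriv h 0) \<le> 2 * sqrt (cmod y) / (1 + cmod y)"
proof -
  have y1: "cmod y < 1" using y by simp
  show y0: "y \<noteq> 0"
  proof
    assume "y = 0"
    then have "ramif X z < ramif X' z" using boundary_ramif[of z] b z_in z(2) by simp
    then show False using z(3) ramif_z by simp
  qed
  define m where "m = (if \<pi> y \<in> points X' then ramif X' (\<pi> y) div ramif X (\<pi> y) else 2)"
  have mX': "ramif X' (\<pi> y) = m * ramif X (\<pi> y) \<and> 2 \<le> m" if p: "\<pi> y \<in> points X'"
  proof
    show eq: "ramif X' (\<pi> y) = m * ramif X (\<pi> y)" using ramif_dvd[OF p] p by (simp add: m_def)
    have "m * ramif X (\<pi> y) > 1 * ramif X (\<pi> y)" using boundary_ramif[OF b p] eq by simp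
    then have "1 < m" by (simp only: mult_less_cancel2)
    then show "2 \<le> m" by simp
  qed
  have m2: "2 \<le> m" using mX' by (cases "\<pi> y \<in> points X'") (auto simp: m_def)
  then have m0: "0 < m" by simp
  show "cmod (deriv h 0) \<le> 2 * sqrt (cmod y) / (1 + cmod y)"
  proof (rule ramified_Schwarz[OF h(1) _ h(2) y1 y0 m2])
    show "h \<in> ball 0 1 \<rightarrow> ball 0 1" using h(3) by blast
    fix x :: complex assume x: "x \<in> ball 0 1"
    show "\<exists>e>0. \<exists>G. G holomorphic_on ball x e \<and> (\<forall>w\<in>ball x e. G w ^ m = Moebius_function 0 y (h w))"
    proof (cases "h x = y")
      case False
      have hol: "(\<lambda>w. Moebius_function 0 y (h w)) holomorphic_on ball 0 1"
      proof -
        have "h ` ball 0 1 \<subseteq> ball 0 1" using h(3) by blast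
        from holomorphic_on_compose_gen[OF h(1) Moebius_function_holomorphic[OF y1, of 0] this]
        show ?thesis by (simp only: o_def)
      qed
      have "open (ball 0 1 \<inter> h -` (- {y}))"
        by (rule continuous_open_preimage[OF holomorphic_on_imp_continuous_on[OF h(1)]]) auto
      moreover have "x \<in> ball 0 1 \<inter> h -` (- {y})" using x False by simp
      ultimately obtain e where e: "0 < e" "ball x e \<subseteq> ball 0 1 \<inter> h -` (- {y})" by (rule openE)
      have nz: "Moebius_function 0 y (h w) \<noteq> 0" if w: "w \<in> ball x e" for w
      proof
        assume 0: "Moebius_function 0 y (h w) = 0"
        have w1: "h w \<in> ball 0 1" "h w \<noteq> y" using w e(2) h(3) by auto
        have "h w = Moebius_function 0 (- y) 0" using Moebius_inverse(1)[OF y1 w1(1)] 0 by simp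
        then show False using w1(2) by (simp add: Moebius_function_of_zero)
      qed
      have sub: "ball x e \<subseteq> ball 0 1" using e(2) by blast
      obtain G where "G holomorphic_on ball x e" "\<And>w. w \<in> ball x e \<Longrightarrow> G w ^ m = Moebius_function 0 y (h w)"
        using nonvanishing_nth_root[OF holomorphic_on_subset[OF hol sub] nz e(1) m0] by blast
      then show ?thesis using e(1) by blast
    next
      case True
      have p: "\<pi>' x = \<pi> y" using h(4)[OF x] True by simp
      have pX': "\<pi> y \<in> points X'" using image' x p by (metis imageI subsetD)
      note mm = mX'[OF pX', THEN conjunct1]
      obtain V \<phi> where V: "(V, \<phi>) \<in> charts X" "\<pi> y \<in> V" by (rule chart_at[OF X disc_coverD(2)[OF cov y]])
      have V': "\<pi>' x \<in> V" using V(2) p by simp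
      obtain e \<xi> where n: "0 < ramif X (\<pi> y)" and e: "0 < e" "ball y e \<subseteq> ball 0 1" "\<pi> ` ball y e \<subseteq> V"
        and \<xi>: "\<xi> holomorphic_on ball y e" "inj_on \<xi> (ball y e)" "\<xi> y = 0"
        "\<forall>w\<in>ball y e. \<phi> (\<pi> w) = \<phi> (\<pi> y) + \<xi> w ^ ramif X (\<pi> y)"
        by (rule disc_cover_normal_form[OF cov y V]) (rule that)
      obtain e' \<xi>' where e': "0 < e'" "ball x e' \<subseteq> ball 0 1" "\<pi>' ` ball x e' \<subseteq> V"
        and \<xi>': "\<xi>' holomorphic_on ball x e'" "inj_on \<xi>' (ball x e')" "\<xi>' x = 0"
        "\<forall>w\<in>ball x e'. \<phi> (\<pi>' w) = \<phi> (\<pi>' x) + \<xi>' w ^ ramif X' (\<pi>' x)"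
        by (rule disc_cover_normal_form[OF cov' x V(1) V']) (rule that)
      have he': "h holomorphic_on ball x e'" by (rule holomorphic_on_subset[OF h(1) e'(2)])
      have "open (ball x e' \<inter> h -` ball y e)"
        by (rule continuous_open_preimage[OF holomorphic_on_imp_continuous_on[OF he']]) auto
      moreover have "x \<in> ball x e' \<inter> h -` ball y e" using e(1) e'(1) True by simp
      ultimately obtain d where d: "0 < d" "ball x d \<subseteq> ball x e' \<inter> h -` ball y e" by (rule openE)
      have de': "ball x d \<subseteq> ball x e'" and hd: "\<And>w. w \<in> ball x d \<Longrightarrow> h w \<in> ball y e" using d(2) by blast+
      have hol_h: "h holomorphic_on ball x d" by (rule holomorphic_on_subset[OF he' de'])
      have hol_\<xi>h: "(\<lambda>w. \<xi> (h w)) holomorphic_on ball x d"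
      proof -
        have "h ` ball x d \<subseteq> ball y e" using hd by (rule image_subsetI)
        from holomorphic_on_compose_gen[OF hol_h \<xi>(1) this] show ?thesis by (simp only: o_def)
      qed
      have hol_\<xi>': "(\<lambda>w. \<xi>' w ^ m) holomorphic_on ball x d"
        using holomorphic_on_subset[OF \<xi>'(1) de'] by (intro holomorphic_intros)
      have eq: "\<xi> (h w) ^ ramif X (\<pi> y) = (\<xi>' w ^ m) ^ ramif X (\<pi> y)" if w: "w \<in> ball x d" for w
      proof -
        have we': "w \<in> ball x e'" using w de' by blast
        have "w \<in> ball 0 1" using we' e'(2) by blast
        then have "\<pi> (h w) = \<pi>' w" by (rule h(4))
        then have "\<xi> (h w) ^ ramif X (\<pi> y) = \<xi>' w ^ ramif X' (\<pi> y)"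
          using bspec[OF \<xi>(4) hd[OF w]] bspec[OF \<xi>'(4) we'] p by simp
        then show ?thesis by (simp only: mm power_mult)
      qed
      obtain \<omega> where \<omega>: "\<omega> ^ ramif X (\<pi> y) = 1" "\<And>w. w \<in> ball x d \<Longrightarrow> \<xi> (h w) = \<omega> * \<xi>' w ^ m"
        using equal_powers_imp_proportional[OF open_ball connected_ball hol_\<xi>' hol_\<xi>h n eq] by blast
      have "\<omega> \<noteq> 0" using \<omega>(1) n by (auto simp: zero_power)
      \<comment> \<open>An m-th root of the constant factor, which can thus be absorbed into the
        root of \<open>\<xi> \<circ> h\<close>.\<close>
      define \<omega>' where "\<omega>' = exp (Ln \<omega> / of_nat m)"
      have \<omega>': "\<omega>' ^ m = \<omega>"
        unfolding \<omega>'_def using m0 \<open>\<omega> \<noteq> 0\<close> by (simp flip: exp_of_nat_mult)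
      have hol_P: "(\<lambda>w. \<omega>' * \<xi>' w) holomorphic_on ball x d"
        using holomorphic_on_subset[OF \<xi>'(1) de'] by (intro holomorphic_intros)
      have P: "\<xi> (h w) = (\<omega>' * \<xi>' w) ^ m" if "w \<in> ball x d" for w
        using \<omega>(2)[OF that] by (simp add: power_mult_distrib \<omega>')
      have hd1: "h w \<in> ball 0 1" if "w \<in> ball x d" for w using hd[OF that] e(2) by blast
      obtain d' G where "0 < d'" "G holomorphic_on ball x d'" "\<And>w. w \<in> ball x d' \<Longrightarrow> G w ^ m = Moebius_function 0 y (h w)"
        using Moebius_root_at_zero[OF \<xi>(1-3) e(1) y1 hol_h True hd hd1 d(1) m0 hol_P P] by blast
      then show ?thesis by blast
    qed
  qed
qed

lemma density':
  assumes "(V, \<phi>) \<in> charts X" "x \<in> ball 0 1" "\<pi>' x \<in> V"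
  shows "orbifold_density X' \<phi> (\<pi>' x) = cover_density \<phi> \<pi>' x"
  using orbifold_density_eq[OF hyp' C' cov' refl assms(2,1,3)] .

lemma density:
  assumes "(V, \<phi>) \<in> charts X" "x \<in> ball 0 1" "\<pi> x \<in> V"
  shows "orbifold_density X \<phi> (\<pi> x) = cover_density \<phi> \<pi> x"
  using included_surface.orbifold_density_eq[OF included_surface_refl[OF X] hyp C cov refl assms(2,1,3)] .

section \<open>The bounds in terms of the distance to the boundary\<close>

context
  fixes R :: real
  assumes fin: "orbifold_setdist X {z} (orbifold_boundary X' X) < \<infinity>"
    and R: "R = enn2real (orbifold_setdist X {z} (orbifold_boundary X' X))"
begin

lemma setdist_eq: "(INF b\<in>orbifold_boundary X' X. orbifold_dist X z b) = ennreal R"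
  using fin by (simp add: R orbifold_setdist_def)

text \<open>The image of the radius ending at \<open>y\<close> joins \<open>z\<close> to the
  boundary.\<close>

lemma R_le:
  assumes y: "y \<in> ball 0 1" and b: "\<pi> y \<in> orbifold_boundary X' X"
  shows "R \<le> hyp_radius (cmod y)"
proof -
  have "ennreal R \<le> orbifold_dist X z (\<pi> y)"
    unfolding setdist_eq[symmetric] by (rule INF_lower[OF b])
  also have "\<dots> \<le> ennreal (hyp_radius (cmod y))"
    unfolding z(2)[symmetric]
    by (rule radial_path_length[OF X cov _ y boundary_fibre_bound(1)[OF y b]]) (rule density)
  finally show ?thesis
    using y by (subst (asm) ennreal_le_iff) (auto intro: hyp_radius_nonneg)
qed

text \<open>An almost shortest curve from \<open>z\<close> to the boundary is at least as long as
  the hyperbolic distance from \<open>0\<close> to the nearest point of the fibre over its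
  endpoint.\<close>

lemma boundary_near:
  assumes "0 < e"
  obtains y where "y \<in> ball 0 1" "\<pi> y \<in> orbifold_boundary X' X" "hyp_radius (cmod y) < R + e"
proof -
  have R0: "0 \<le> R" by (simp add: R)
  have "(INF b\<in>orbifold_boundary X' X. orbifold_dist X z b) < ennreal (R + e)"
    unfolding setdist_eq using assms R0 by (intro ennreal_lessI) auto
  then obtain b where b: "b \<in> orbifold_boundary X' X" "orbifold_dist X z b < ennreal (R + e)"
    unfolding INF_less_iff by blast
  then obtain l \<gamma> where l: "l < ennreal (R + e)" "\<gamma> 0 = z" "\<gamma> 1 = b" "rectifiable_with_length X \<gamma> l"
    unfolding orbifold_dist_def Inf_less_iff by blast
  have \<gamma>0: "\<gamma> 0 = \<pi> 0" using l(2) z(2) by simp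
  have p: "b \<in> \<pi> ` ball 0 1" "ennreal (hyp_radius (fibre_radius \<pi> b)) \<le> l"
    unfolding l(3)[symmetric]
  proof -
    have dens: "orbifold_density X \<phi> (\<pi> x) = cover_density \<phi> \<pi> x"
      if "(V, \<phi>) \<in> charts X" "x \<in> ball 0 1" "\<pi> x \<in> V" for V \<phi> x
      using that by (rule density)
    show "\<gamma> 1 \<in> \<pi> ` ball 0 1"
      by (rule path_length_ge(1)[OF X cov C _ l(4) \<gamma>0]) (rule dens)
    show "ennreal (hyp_radius (fibre_radius \<pi> (\<gamma> 1))) \<le> l"
      by (rule path_length_ge(2)[OF X cov C _ l(4) \<gamma>0]) (rule dens)
  qed
  obtain y where y: "y \<in> ball 0 1" "\<pi> y = b" "fibre_radius \<pi> b = cmod y"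
    by (rule fibre_radius_attained[OF X cov p(1)])
  have "ennreal (hyp_radius (cmod y)) < ennreal (R + e)" using p(2) l(1) y(3) by simp
  then have "hyp_radius (cmod y) < R + e" using y(1) by (subst (asm) ennreal_less_iff) (auto intro: hyp_radius_nonneg)
  then show ?thesis using that[OF y(1)] y(2) b(1) by simp
qed

text \<open>The infimum \<open>R\<close> need not be attained, so the bound is applied at boundary
  fibre points at distance less than \<open>R + e\<close>, and \<open>e\<close> tends to 0.\<close>

lemma deriv_h_bound: "(cmod (deriv h 0))\<^sup>2 \<le> 1 - exp (- 2 * R)"
proof -
  have "(cmod (deriv h 0))\<^sup>2 \<le> 1 - exp (- 2 * (R + e))" if e: "0 < e" for e
  proof -
    obtain y where y: "y \<in> ball 0 1" "\<pi> y \<in> orbifold_boundary X' X" "hyp_radius (cmod y) < R + e"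
      by (rule boundary_near[OF e])
    have "(cmod (deriv h 0))\<^sup>2 \<le> 1 - exp (- 2 * hyp_radius (cmod y))"
      by (rule ramified_bound_eq[OF norm_ge_zero _ norm_ge_zero boundary_fibre_bound(2)[OF y(1,2)]]) (use y(1) in simp)
    also have "\<dots> \<le> 1 - exp (- 2 * (R + e))" using y(3) by simp
    finally show ?thesis .
  qed
  then have ev: "eventually (\<lambda>e. (cmod (deriv h 0))\<^sup>2 \<le> 1 - exp (- 2 * (R + e))) (at_right (0::real))"
    unfolding eventually_at_right_field by (intro exI[of _ 1]) auto
  have "((\<lambda>e::real. 1 - exp (- 2 * (R + e))) \<longlongrightarrow> 1 - exp (- 2 * (R + 0))) (at_right 0)"
    by (intro tendsto_intros)
  then have "(cmod (deriv h 0))\<^sup>2 \<le> 1 - exp (- 2 * (R + 0))" by (rule tendsto_lowerbound[OF _ ev]) simp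
  then show ?thesis by simp
qed

text \<open>\<open>ball 0 s\<close> is the hyperbolic disc of radius \<open>R\<close>, which by
  \<open>R_le\<close> contains no point over the boundary. Its image is connected, contains
  \<open>z\<close> and avoids the frontier, so it stays in \<open>X'\<close>; there the ramification
  of the two orbifolds coincides.\<close>

lemma interior_disc:
  assumes R0: "0 < R" and s: "s = (exp R - 1) / (exp R + 1)"
  shows "\<pi> ` ball 0 s \<subseteq> \<pi>' ` ball 0 1" "\<And>x. x \<in> ball 0 s \<Longrightarrow> ramif X' (\<pi> x) dvd ramif X (\<pi> x)"
proof -
  have eR: "1 < exp R" using R0 by simp
  have s01: "0 < s" "s < 1" unfolding s using half_tanh_bounds[OF eR] by blast+
  have sub: "ball 0 s \<subseteq> ball (0::complex) 1" using s01 by auto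
  have nb: "\<pi> x \<notin> orbifold_boundary X' X" if x: "x \<in> ball 0 s" for x
  proof
    assume b: "\<pi> x \<in> orbifold_boundary X' X"
    have x1: "x \<in> ball 0 1" using x sub by blast
    have "exp R \<le> exp (hyp_radius (cmod x))" using R_le[OF x1 b] by simp
    also have "\<dots> = (1 + cmod x) / (1 - cmod x)" using x1 by (intro exp_hyp_radius) auto
    finally have "exp R * (1 - cmod x) \<le> 1 + cmod x" using x1 by (simp add: field_simps)
    then have "exp R - 1 \<le> cmod x * (exp R + 1)" by (simp add: algebra_simps)
    moreover have "0 < exp R + 1" using eR by linarith
    ultimately have "s \<le> cmod x" by (simp add: s pos_divide_le_eq)
    then show False using x by simp
  qed
  have cm: "continuous_map (top_of_set (ball 0 s)) (topol X) \<pi>"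
    by (rule continuous_map_from_subtopology_mono[OF disc_coverD(1)[OF cov] sub])
  have conn: "connectedin (topol X) (\<pi> ` ball 0 s)"
    by (rule connectedin_continuous_map_image[OF cm]) (simp add: connectedin_subtopology)
  have zs: "z \<in> \<pi> ` ball 0 s" using z(2) s01(1) by (metis centre_in_ball imageI)
  have "\<pi> ` ball 0 s \<inter> (topol X) frontier_of (points X') = {}"
    using nb by (auto simp: orbifold_boundary_def)
  then have pX': "\<pi> ` ball 0 s \<subseteq> points X'"
    using connectedin_Int_frontier_of[OF conn, of "points X'"] zs z_in by blast
  have "connectedin (topol X') (\<pi> ` ball 0 s)"
    by (subst topol_eq) (use conn pX' in \<open>simp add: connectedin_subtopology\<close>)
  moreover have "\<not> disjnt (\<pi>' ` ball 0 1) (\<pi> ` ball 0 s)"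
  proof -
    have "z \<in> \<pi>' ` ball 0 1" using z(1) by (metis centre_in_ball imageI zero_less_one)
    then show ?thesis using zs unfolding disjnt_def by blast
  qed
  ultimately show "\<pi> ` ball 0 s \<subseteq> \<pi>' ` ball 0 1" by (rule connected_components_of_maximal[OF C'])
  fix x :: complex assume x: "x \<in> ball 0 s"
  then have px: "\<pi> x \<in> points X'" using pX' by blast
  have "ramif X' (\<pi> x) \<le> ramif X (\<pi> x)" using nb[OF x] px by (auto simp: orbifold_boundary_def)
  moreover have "ramif X (\<pi> x) \<le> ramif X' (\<pi> x)"
    using ramif_dvd[OF px] ramif_pos(1)[OF px] by (intro dvd_imp_le) auto
  ultimately show "ramif X' (\<pi> x) dvd ramif X (\<pi> x)" by simp
qed

text \<open>The ratio of the densities is \<open>|a| / |a'|\<close> for the coordinate derivatives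
  of the two coverings at \<open>0\<close>. The lift \<open>h\<close> gives
  \<open>a' = a h'(0)\<close>, and the lift \<open>k\<close> of \<pi> through \<open>\<pi>'\<close>
  on the disc of radius \<open>s\<close> gives \<open>a = a' k'(0)\<close>; so the two bounds are
  Schwarz estimates for \<open>h\<close> and \<open>k\<close>.\<close>

lemma density_ratio_bounds:
  assumes V: "(V, \<phi>) \<in> charts X" "z \<in> V"
  shows "1 < exp R / sqrt (exp (2 * R) - 1)"
    "ennreal (exp R / sqrt (exp (2 * R) - 1)) \<le> orbifold_density X' \<phi> z / orbifold_density X \<phi> z"
    "orbifold_density X' \<phi> z / orbifold_density X \<phi> z \<le> ennreal (1 + 2 / (exp R - 1))"
proof -
  have 0: "0 \<in> ball (0::complex) 1" by simp
  have V0: "\<pi> 0 \<in> V" "\<pi>' 0 \<in> V" using V(2) z by auto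
  define a where "a = deriv (\<lambda>w. \<phi> (\<pi> w)) 0"
  define a' where "a' = deriv (\<lambda>w. \<phi> (\<pi>' w)) 0"
  have a: "a \<noteq> 0" unfolding a_def
    using cover_deriv_nonzero_iff[OF X cov 0 V(1) V0(1)] ramif_z z(2) by simp
  have a': "a' \<noteq> 0" unfolding a'_def
    using cover_deriv_nonzero_iff[OF X cov' 0 V(1) V0(2)] z(1,3) by simp
  have ah: "a' = a * deriv h 0"
    using cover_lift_deriv[OF X cov' cov h(1) 0 order.refl h(3,4) V(1) V0(2)] by (simp add: a_def a'_def h(2))
  define \<kappa> where "\<kappa> = cmod (deriv h 0)"
  \<comment> \<open>Positivity of \<open>\<kappa>\<close>, due to \<open>z\<close> being unramified
    in both orbifolds, forces \<open>R > 0\<close>; thus the denominators in the bounds are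
    positive.\<close>
  have \<kappa>: "0 < \<kappa>" using a' ah by (auto simp: \<kappa>_def)
  have \<kappa>R: "\<kappa>\<^sup>2 \<le> 1 - exp (- 2 * R)" using deriv_h_bound by (simp add: \<kappa>_def)
  have "0 < \<kappa>\<^sup>2" using \<kappa> by simp
  then have "exp (- 2 * R) < exp 0" unfolding exp_zero using \<kappa>R by linarith
  then have "- 2 * R < 0" by (simp only: exp_less_cancel_iff)
  then have R0: "0 < R" by simp
  have "orbifold_density X' \<phi> z / orbifold_density X \<phi> z = ennreal (2 / cmod a') / ennreal (2 / cmod a)"
    using density'[OF V(1) 0 V0(2)] density[OF V(1) 0 V0(1)] a a' z(1,2)
    by (simp add: cover_density_centre a_def a'_def)
  also have "\<dots> = ennreal (cmod a / cmod a')"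
    using a a' by (simp add: divide_ennreal)
  finally have ratio: "orbifold_density X' \<phi> z / orbifold_density X \<phi> z = ennreal (cmod a / cmod a')" .
  define E where "E = sqrt (exp (2 * R) - 1)"
  have e2: "exp (2 * R) = (exp R)\<^sup>2" by (simp add: power2_eq_square flip: exp_add)
  have E: "0 < E" "E\<^sup>2 = (exp R)\<^sup>2 - 1" using R0 by (auto simp: E_def simp flip: e2)
  have "E\<^sup>2 < (exp R)\<^sup>2" using E(2) by simp
  then have "E < exp R" by (rule power2_less_imp_less) simp
  then show "1 < exp R / sqrt (exp (2 * R) - 1)" unfolding E_def[symmetric] using E(1) by simp
  have "(exp R * \<kappa>)\<^sup>2 \<le> E\<^sup>2"
  proof -
    have "(exp R * \<kappa>)\<^sup>2 \<le> (exp R)\<^sup>2 * (1 - exp (- 2 * R))"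
      unfolding power_mult_distrib by (rule mult_left_mono[OF \<kappa>R]) simp
    also have "\<dots> = E\<^sup>2" unfolding E(2) e2[symmetric] by (simp add: algebra_simps flip: exp_add)
    finally show ?thesis .
  qed
  then have "exp R * \<kappa> \<le> E" by (rule power2_le_imp_le) (use E(1) in simp)
  moreover have "cmod a / cmod a' = 1 / \<kappa>" using a by (simp add: ah \<kappa>_def norm_mult)
  moreover have "exp R / E \<le> 1 / \<kappa>" if "exp R * \<kappa> \<le> E" using that E(1) \<kappa> by (simp add: field_simps)
  ultimately have "exp R / E \<le> cmod a / cmod a'" by simp
  then show "ennreal (exp R / sqrt (exp (2 * R) - 1)) \<le> orbifold_density X' \<phi> z / orbifold_density X \<phi> z"
    unfolding ratio E_def[symmetric] by (rule ennreal_leI)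
  define s where "s = (exp R - 1) / (exp R + 1)"
  have eR: "1 < exp R" using R0 by simp
  have s01: "0 < s" "s < 1" unfolding s_def using half_tanh_bounds[OF eR] by blast+
  note disc = interior_disc[OF R0 s_def]
  have "\<pi>' 0 = \<pi> 0" using z by simp
  then obtain k where k: "k holomorphic_on ball 0 s" "k 0 = 0" "\<And>w. w \<in> ball 0 s \<Longrightarrow> k w \<in> ball 0 1"
    "\<And>w. w \<in> ball 0 s \<Longrightarrow> \<pi>' (k w) = \<pi> w"
    using cover_lift[OF X cov cov' s01(1) less_imp_le[OF s01(2)] disc 0] by blast
  have sub: "ball 0 s \<subseteq> ball (0::complex) 1" using s01 by auto
  have 0: "0 \<in> ball (0::complex) s" using s01(1) by simp
  have "a = a' * deriv k 0"
    using cover_lift_deriv[OF X cov cov' k(1) 0 sub k(3,4) V(1) V0(1)] by (simp add: a_def a'_def k(2))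
  then have "cmod a / cmod a' = cmod (deriv k 0)" using a' by (simp add: norm_mult)
  also have "\<dots> \<le> 1 / s" using k(3) by (intro Schwarz_deriv_ball[OF k(1) _ k(2) s01(1)]) auto
  also have "\<dots> = 1 + 2 / (exp R - 1)" using eR by (simp add: s_def field_simps)
  finally show "orbifold_density X' \<phi> z / orbifold_density X \<phi> z \<le> ennreal (1 + 2 / (exp R - 1))"
    unfolding ratio by (rule ennreal_leI)
qed

end

end

lemma (in included_surface) centred_cover:
  assumes hyp: "hyperbolic_orbifold X'" and z: "z \<in> points X'"
  obtains \<pi> where "disc_cover X (ramif X') \<pi>" "\<pi> ` ball 0 1 \<in> connected_components_of (topol X')" "\<pi> 0 = z"
proof -
  obtain C where CC: "C \<in> connected_components_of (topol X')" "z \<in> C"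
    using z Union_connected_components_of[of "topol X'"] by blast
  obtain \<pi>0 where \<pi>0: "orbifold_covering_map unit_disc (surface_restrict X' C) \<pi>0"
    using hyp CC by (auto simp: hyperbolic_orbifold_def)
  interpret covered_component X' X C \<pi>0
    by unfold_locales (use \<pi>0 CC hyp in \<open>auto simp: hyperbolic_orbifold_def riemann_orbifold_def\<close>)
  have "z \<in> \<pi>0 ` ball 0 1" using CC(2) image_\<pi> by simp
  then obtain \<pi> where "disc_cover X (ramif X') \<pi>" "\<pi> ` ball 0 1 = \<pi>0 ` ball 0 1" "\<pi> 0 = z"
    by (rule disc_cover_centred[OF disc_cover])
  then show ?thesis using that[of \<pi>] CC(1) image_\<pi> by simp
qed

text \<open>Both densities are taken in the same coordinate, a chart of \<open>X\<close> around
  \<open>z\<close>, so that their quotient is the ratio of the two metrics at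
  \<open>z\<close>.\<close>

theorem theorem1p5:
  fixes X' X :: "'a orbifold" and z :: 'a and U :: "'a set" and \<phi> :: "'a \<Rightarrow> complex" and R :: real
  assumes "hyperbolic_orbifold X'" and "hyperbolic_orbifold X"
    and "holomorphic_inclusion X' X"
    and "z \<in> points X'" and "ramif X' z = 1"
    and "orbifold_setdist X {z} (orbifold_boundary X' X) < \<infinity>"
    and "R = enn2real (orbifold_setdist X {z} (orbifold_boundary X' X))"
    and "(U, \<phi>) \<in> charts X" and "z \<in> U"
  shows "1 < exp R / sqrt (exp (2 * R) - 1) \<and>
         ennreal (exp R / sqrt (exp (2 * R) - 1))
           \<le> orbifold_density X' \<phi> z / orbifold_density X \<phi> z \<and>
         orbifold_density X' \<phi> z / orbifold_density X \<phi> z \<le> ennreal (1 + 2 / (exp R - 1))"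
proof -
  have RS: "riemann_surface X'" "riemann_surface X"
    using assms(1,2) by (auto simp: hyperbolic_orbifold_def riemann_orbifold_def)
  interpret included_surface X' X by unfold_locales (fact RS assms(3))+
  obtain \<pi>' where \<pi>': "disc_cover X (ramif X') \<pi>'" "\<pi>' ` ball 0 1 \<in> connected_components_of (topol X')" "\<pi>' 0 = z"
    by (rule centred_cover[OF assms(1,4)])
  have zX: "z \<in> points X" using assms(4) subset by blast
  obtain \<pi> where \<pi>: "disc_cover X (ramif X) \<pi>" "\<pi> ` ball 0 1 \<in> connected_components_of (topol X)" "\<pi> 0 = z"
    by (rule included_surface.centred_cover[OF included_surface_refl[OF RS(2)] assms(2) zX])
  interpret pointed_inclusion X' X z \<pi>' \<pi>
    by unfold_locales (fact assms(1,2,5) \<pi> \<pi>')+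
  show ?thesis
    using density_ratio_bounds[OF assms(6-9)] by blast
qed

end
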